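(* Let $b=b_1\otimes b_2$ and $b'=b_1'\otimes b_2'$ be pseudo-accretive functions in $L^\infty(\mathbb{R}^n\times\mathbb{R}^m)$, let $\mathcal{D}^n,\mathcal{D}^m$ be dyadic grids on $\mathbb{R}^n,\mathbb{R}^m$, and let $a\in BMO(\mathbb{R}^n\times\mathbb{R}^m)$. Then the full paraproduct $$\pi_a^{b',b}(f)=\sum_{K\in\mathcal{D}^n,\,V\in\mathcal{D}^m}\langle f\rangle^{b'}_{K\times V}\,M_b\Delta_K^{b_1}\Delta_V^{b_2}a$$ is bounded on $L^2(\mathbb{R}^n\times\mathbb{R}^m)$, and $$\|\pi_a^{b',b}(f)\|_{L^2(\mathbb{R}^n\times\mathbb{R}^m)}\le C\|a\|_{BMO(\mathbb{R}^n\times\mathbb{R}^m)}\|f\|_{L^2(\mathbb{R}^n\times\mathbb{R}^m)}\quad\text{for all } f\in L^2(\mathbb{R}^n\times\mathbb{R}^m),$$ where $C$ depends only on $n,m$ and the $L^\infty$ and pseudo-accretivity constants of $b,b'$.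
   Context: A function $b\in L^\infty(\mathbb{R}^n\times\mathbb{R}^m)$ is pseudo-accretive if there is $C>0$ with $\frac1{|R|}|\int_Rb|>C$ for every rectangle $R=K\times V$ ($K\subset\mathbb{R}^n$, $V\subset\mathbb{R}^m$ cubes with sides parallel to the axes). For $b=b_1\otimes b_2$, i.e. $b(x_1,x_2)=b_1(x_1)b_2(x_2)$, both factors are bounded and pseudo-accretive on cubes. A dyadic grid $\mathcal{D}^n$ is a shift $\{I+\sum_{i:2^{-i}<\ell(I)}2^{-i}\omega_i:I\in\mathcal{D}_0^n\}$ of the standard dyadic grid $\mathcal{D}_0^n$, $\omega_i\in\{0,1\}^n$, $i\in\mathbb{Z}$; $\mathcal{D}^n_p$ is the set of its cubes of side $2^{-p}$. Acting in the first variable, $E_p^{b_1}f=\sum_{I\in\mathcal{D}^n_p}\frac{\int_Ifb_1\,dx_1}{\int_Ib_1}\chi_I$, $\Delta_p^{b_1}=E_{p+1}^{b_1}-E_p^{b_1}$, and $\Delta_I^{b_1}=\chi_I\Delta_p^{b_1}$ for $I\in\mathcal{D}_p^n$; the operators $E_q^{b_2},\Delta_q^{b_2},\Delta_J^{b_2}$ are defined similarly in the second variable. $\langle f\rangle^{b'}_{K\times V}=\frac{\int_{K\times V}fb'}{\int_{K\times V}b'}$ and $M_bf=bf$. $BMO(\mathbb{R}^n\times\mathbb{R}^m)$ is product BMO, the dual of the product Hardy space $H^1(\mathbb{R}^n\times\mathbb{R}^m)$; equivalently, in the dyadic setting, one uses the dual of dyadic product $H^1$ for the given grids. The function $M_b\Delta_K^{b_1}\Delta_V^{b_2}a$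 is determined by $\langle M_b\Delta_K^{b_1}\Delta_V^{b_2}a,g\rangle=\langle a,M_b\Delta_K^{b_1}\Delta_V^{b_2}g\rangle$, where pairings are bilinear, $\langle f,g\rangle=\int fg$. The series is understood weakly, via pairing with $L^2$ functions. *)

theory Defs
  imports "HOL-Analysis.Analysis"
begin

section \<open>Cubes and dyadic grids\<close>

text \<open>All cubes are half-open.\<close>

definition cube :: "real ^ 'n \<Rightarrow> real \<Rightarrow> (real ^ 'n) set" where
  "cube a l = {x. \<forall>j. a $ j \<le> x $ j \<and> x $ j < a $ j + l}"

definition standard_dyadic_cubes :: "int \<Rightarrow> (real ^ 'n) set set" where
  "standard_dyadic_cubes p =
     {cube (2 powi (- p) *\<^sub>R k) (2 powi (- p)) | k. \<forall>j. k $ j \<in> \<int>}"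

definition grid_shift :: "(int \<Rightarrow> real ^ 'n) \<Rightarrow> int \<Rightarrow> real ^ 'n" where
  "grid_shift \<omega> p =
     (\<Sum>\<^sub>\<infinity>i\<in>{i. (2::real) powi (- i) < 2 powi (- p)}. 2 powi (- i) *\<^sub>R \<omega> i)"

definition dyadic_grid :: "(real ^ 'n) set set \<Rightarrow> bool" where
  "dyadic_grid D \<longleftrightarrow>
     (\<exists>\<omega>. (\<forall>i j. \<omega> i $ j \<in> {0, 1}) \<and>
          D = (\<Union>p. (\<lambda>I. (+) (grid_shift \<omega> p) ` I) ` standard_dyadic_cubes p))"

definition grid_level :: "(real ^ 'n) set set \<Rightarrow> int \<Rightarrow> (real ^ 'n) set set" where
  "grid_level D p = {I \<in> D. \<exists>a. I = cube a (2 powi (- p))}"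

definition level_of :: "(real ^ 'n) set \<Rightarrow> int" where
  "level_of I = (THE p. \<exists>a. I = cube a (2 powi (- p)))"

section \<open>Function spaces\<close>

text \<open>
  Functions are complex-valued Borel representatives of their classes modulo
  Lebesgue-null sets.
\<close>

definition Linfty_bounded :: "real \<Rightarrow> ('a::euclidean_space \<Rightarrow> complex) \<Rightarrow> bool" where
  "Linfty_bounded B b \<longleftrightarrow> b \<in> borel_measurable lborel \<and> (AE x in lborel. norm (b x) \<le> B)"

definition L2 :: "('a::euclidean_space \<Rightarrow> complex) set" where
  "L2 = {f \<in> borel_measurable lborel. integrable lborel (\<lambda>x. (norm (f x))\<^sup>2)}"

definition L2_norm :: "('a::euclidean_space \<Rightarrow> complex) \<Rightarrow> real" where
  "L2_norm f = sqrt (LINT x|lborel. (norm (f x))\<^sup>2)"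

definition tensor :: "('a \<Rightarrow> complex) \<Rightarrow> ('b \<Rightarrow> complex) \<Rightarrow> 'a \<times> 'b \<Rightarrow> complex"
    (infixr "\<otimes>\<^sub>t" 75) where
  "b\<^sub>1 \<otimes>\<^sub>t b\<^sub>2 = (\<lambda>(x\<^sub>1, x\<^sub>2). b\<^sub>1 x\<^sub>1 * b\<^sub>2 x\<^sub>2)"

definition pseudo_accretive :: "real \<Rightarrow> ((real ^ 'n) \<times> (real ^ 'm) \<Rightarrow> complex) \<Rightarrow> bool" where
  "pseudo_accretive c b \<longleftrightarrow> c > 0 \<and>
     (\<forall>u l v s. l > 0 \<longrightarrow> s > 0 \<longrightarrow>
        norm (LINT x:cube u l \<times> cube v s|lborel. b x)
          / measure lborel (cube u l \<times> cube v s) > c)"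

section \<open>Adapted martingale differences\<close>

text \<open>At every point at most one term of the sum over cubes is nonzero.\<close>

definition expect_op ::
  "(real ^ 'n) set set \<Rightarrow> (real ^ 'n \<Rightarrow> complex) \<Rightarrow> int
     \<Rightarrow> (real ^ 'n \<Rightarrow> complex) \<Rightarrow> real ^ 'n \<Rightarrow> complex" where
  "expect_op D b p f x =
     (\<Sum>\<^sub>\<infinity>I\<in>grid_level D p.
        (LINT y:I|lborel. f y * b y) / (LINT y:I|lborel. b y) * indicator I x)"

definition diff_op ::
  "(real ^ 'n) set set \<Rightarrow> (real ^ 'n \<Rightarrow> complex) \<Rightarrow> int
     \<Rightarrow> (real ^ 'n \<Rightarrow> complex) \<Rightarrow> real ^ 'n \<Rightarrow> complex" where
  "diff_op D b p f x = expect_op D b (p + 1) f x - expect_op D b p f x"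

definition diff_cube ::
  "(real ^ 'n) set set \<Rightarrow> (real ^ 'n \<Rightarrow> complex) \<Rightarrow> (real ^ 'n) set
     \<Rightarrow> (real ^ 'n \<Rightarrow> complex) \<Rightarrow> real ^ 'n \<Rightarrow> complex" where
  "diff_cube D b I f x = indicator I x * diff_op D b (level_of I) f x"

definition in_fst ::
  "(('a \<Rightarrow> complex) \<Rightarrow> 'a \<Rightarrow> complex) \<Rightarrow> ('a \<times> 'b \<Rightarrow> complex) \<Rightarrow> 'a \<times> 'b \<Rightarrow> complex" where
  "in_fst T f = (\<lambda>(x\<^sub>1, x\<^sub>2). T (\<lambda>y\<^sub>1. f (y\<^sub>1, x\<^sub>2)) x\<^sub>1)"

definition in_snd ::
  "(('b \<Rightarrow> complex) \<Rightarrow> 'b \<Rightarrow> complex) \<Rightarrow> ('a \<times> 'b \<Rightarrow> complex) \<Rightarrow> 'a \<times> 'b \<Rightarrow> complex" where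
  "in_snd T f = (\<lambda>(x\<^sub>1, x\<^sub>2). T (\<lambda>y\<^sub>2. f (x\<^sub>1, y\<^sub>2)) x\<^sub>2)"

definition diff_rect ::
  "(real ^ 'n) set set \<Rightarrow> (real ^ 'm) set set
     \<Rightarrow> (real ^ 'n \<Rightarrow> complex) \<Rightarrow> (real ^ 'm \<Rightarrow> complex)
     \<Rightarrow> (real ^ 'n) set \<Rightarrow> (real ^ 'm) set
     \<Rightarrow> ((real ^ 'n) \<times> (real ^ 'm) \<Rightarrow> complex) \<Rightarrow> (real ^ 'n) \<times> (real ^ 'm) \<Rightarrow> complex" where
  "diff_rect D E b\<^sub>1 b\<^sub>2 K V f = in_fst (diff_cube D b\<^sub>1 K) (in_snd (diff_cube E b\<^sub>2 V) f)"

definition rect_mean ::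
  "((real ^ 'n) \<times> (real ^ 'm) \<Rightarrow> complex) \<Rightarrow> (real ^ 'n) set \<Rightarrow> (real ^ 'm) set
     \<Rightarrow> ((real ^ 'n) \<times> (real ^ 'm) \<Rightarrow> complex) \<Rightarrow> complex" where
  "rect_mean b K V f = (LINT x:K \<times> V|lborel. f x * b x) / (LINT x:K \<times> V|lborel. b x)"

section \<open>Product Hardy space and product BMO\<close>

text \<open>
  Dyadic product \<open>H\<^sup>1\<close> with respect to the grids \<open>D\<close>, \<open>E\<close>: integrable functions whose
  square function, built from the unweighted martingale differences (\<open>b = 1\<close>), is
  integrable. Summability is required separately because \<open>infsum\<close> is \<open>0\<close> on
  divergent families.
\<close>

definition square_fun ::
  "(real ^ 'n) set set \<Rightarrow> (real ^ 'm) set set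
     \<Rightarrow> ((real ^ 'n) \<times> (real ^ 'm) \<Rightarrow> complex) \<Rightarrow> (real ^ 'n) \<times> (real ^ 'm) \<Rightarrow> real" where
  "square_fun D E f x =
     sqrt (\<Sum>\<^sub>\<infinity>(K, V)\<in>D \<times> E. (norm (diff_rect D E (\<lambda>_. 1) (\<lambda>_. 1) K V f x))\<^sup>2)"

definition H1 ::
  "(real ^ 'n) set set \<Rightarrow> (real ^ 'm) set set
     \<Rightarrow> ((real ^ 'n) \<times> (real ^ 'm) \<Rightarrow> complex) set" where
  "H1 D E = {f. integrable lborel f \<and>
     (AE x in lborel.
        (\<lambda>(K, V). (norm (diff_rect D E (\<lambda>_. 1) (\<lambda>_. 1) K V f x))\<^sup>2) summable_on D \<times> E) \<and>
     integrable lborel (square_fun D E f)}"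

definition H1_norm ::
  "(real ^ 'n) set set \<Rightarrow> (real ^ 'm) set set
     \<Rightarrow> ((real ^ 'n) \<times> (real ^ 'm) \<Rightarrow> complex) \<Rightarrow> real" where
  "H1_norm D E f = (LINT x|lborel. square_fun D E f x)"

text \<open>
  Product \<open>BMO\<close> in the dyadic setting is the dual of dyadic product \<open>H\<^sup>1\<close>: its elements are functionals, \<open>a \<phi>\<close> being the bilinear
  pairing of \<open>a\<close> with \<open>\<phi>\<close>. Values outside \<open>H\<^sup>1\<close> are irrelevant.
\<close>

definition BMO ::
  "(real ^ 'n) set set \<Rightarrow> (real ^ 'm) set set
     \<Rightarrow> (((real ^ 'n) \<times> (real ^ 'm) \<Rightarrow> complex) \<Rightarrow> complex) set" where
  "BMO D E = {a.
     (\<forall>\<phi>\<in>H1 D E. \<forall>\<psi>\<in>H1 D E. a (\<lambda>x. \<phi> x + \<psi> x) = a \<phi> + a \<psi>) \<and>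
     (\<forall>c. \<forall>\<phi>\<in>H1 D E. a (\<lambda>x. c * \<phi> x) = c * a \<phi>) \<and>
     (\<exists>A. \<forall>\<phi>\<in>H1 D E. norm (a \<phi>) \<le> A * H1_norm D E \<phi>)}"

definition BMO_norm ::
  "(real ^ 'n) set set \<Rightarrow> (real ^ 'm) set set
     \<Rightarrow> (((real ^ 'n) \<times> (real ^ 'm) \<Rightarrow> complex) \<Rightarrow> complex) \<Rightarrow> real" where
  "BMO_norm D E a = Inf {A. 0 \<le> A \<and> (\<forall>\<phi>\<in>H1 D E. norm (a \<phi>) \<le> A * H1_norm D E \<phi>)}"

section \<open>The full paraproduct\<close>

text \<open>
  The functional \<open>M\<^sub>b \<Delta>\<^sub>K \<Delta>\<^sub>V a\<close> for \<open>b = b\<^sub>1 \<otimes>\<^sub>t b\<^sub>2\<close>, defined by transposition.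
\<close>

definition mult_diff_rect ::
  "(real ^ 'n) set set \<Rightarrow> (real ^ 'm) set set
     \<Rightarrow> (real ^ 'n \<Rightarrow> complex) \<Rightarrow> (real ^ 'm \<Rightarrow> complex)
     \<Rightarrow> (((real ^ 'n) \<times> (real ^ 'm) \<Rightarrow> complex) \<Rightarrow> complex)
     \<Rightarrow> (real ^ 'n) set \<Rightarrow> (real ^ 'm) set
     \<Rightarrow> ((real ^ 'n) \<times> (real ^ 'm) \<Rightarrow> complex) \<Rightarrow> complex" where
  "mult_diff_rect D E b\<^sub>1 b\<^sub>2 a K V g =
     a (\<lambda>x. (b\<^sub>1 \<otimes>\<^sub>t b\<^sub>2) x * diff_rect D E b\<^sub>1 b\<^sub>2 K V g x)"

text \<open>
  \<open>h\<close> is the value of the paraproduct at \<open>f\<close>: the series converges to \<open>h\<close> weakly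
  (unconditionally) against every function in \<open>L\<^sup>2\<close>. This determines \<open>h\<close> up to null sets.
\<close>

definition is_full_paraproduct ::
  "(real ^ 'n) set set \<Rightarrow> (real ^ 'm) set set
     \<Rightarrow> (real ^ 'n \<Rightarrow> complex) \<Rightarrow> (real ^ 'm \<Rightarrow> complex)
     \<Rightarrow> (real ^ 'n \<Rightarrow> complex) \<Rightarrow> (real ^ 'm \<Rightarrow> complex)
     \<Rightarrow> (((real ^ 'n) \<times> (real ^ 'm) \<Rightarrow> complex) \<Rightarrow> complex)
     \<Rightarrow> ((real ^ 'n) \<times> (real ^ 'm) \<Rightarrow> complex)
     \<Rightarrow> ((real ^ 'n) \<times> (real ^ 'm) \<Rightarrow> complex) \<Rightarrow> bool" where
  "is_full_paraproduct D E b\<^sub>1' b\<^sub>2' b\<^sub>1 b\<^sub>2 a f h \<longleftrightarrow> h \<in> L2 \<and>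
     (\<forall>g\<in>L2. ((\<lambda>(K, V). rect_mean (b\<^sub>1' \<otimes>\<^sub>t b\<^sub>2') K V f * mult_diff_rect D E b\<^sub>1 b\<^sub>2 a K V g)
        has_sum (LINT x|lborel. h x * g x)) (D \<times> E))"

end

theory Submission
  imports Defs
begin

text \<open>
  By duality the series is paired with \<open>g\<close>, and one has to bound
  \<open>\<Sum>\<^sub>R |\<langle>f\<rangle>\<^sub>R| |a (b \<Delta>\<^sub>R g)|\<close> over finite sets of rectangles \<open>R = K \<times> V\<close>. Write
  \<open>|a (b \<Delta>\<^sub>R g)| = \<nu>\<^sub>R \<parallel>\<Delta>\<^sub>R g\<parallel>\<^sub>2\<close>. The square function bound \<open>\<Sum>\<^sub>R \<parallel>\<Delta>\<^sub>R g\<parallel>\<^sub>2\<^sup>2 \<le> C \<parallel>g\<parallel>\<^sub>2\<^sup>2\<close> and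
  Cauchy--Schwarz reduce the claim to \<open>\<Sum>\<^sub>R |\<langle>f\<rangle>\<^sub>R|\<^sup>2 \<nu>\<^sub>R\<^sup>2 \<le> C \<parallel>a\<parallel>\<^sup>2 \<parallel>f\<parallel>\<^sub>2\<^sup>2\<close>. This is a Carleson
  embedding: it follows from the \<open>L\<^sup>2\<close> bound for the strong maximal function once
  \<open>\<Sum>\<^sub>R \<nu>\<^sub>R\<^sup>2 \<le> C \<parallel>a\<parallel>\<^sup>2 |\<Union> R|\<close>, summed over any finite set of rectangles. For the latter, \<open>a\<close> is
  tested on \<open>\<Psi> = \<Sum>\<^sub>R s\<^sub>R b \<Delta>\<^sub>R g\<close> with suitable coefficients \<open>s\<^sub>R\<close>; by cancellation both \<open>\<Psi>\<close> and its
  unweighted square function live on \<open>\<Union> R\<close>, so \<open>\<parallel>\<Psi>\<parallel>\<close> in \<open>H\<^sup>1\<close> is at most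
  \<open>C |\<Union> R|\<^sup>1\<^sup>/\<^sup>2 \<parallel>\<Psi>\<parallel>\<^sub>2\<close>, and the dual square function bound controls \<open>\<parallel>\<Psi>\<parallel>\<^sub>2\<close>.

  In one parameter the adapted square function bound comes from a Bellman function argument for
  the pair of martingales generated by \<open>g b\<close> and \<open>b\<close>; two parameters are treated by iteration.
\<close>

section \<open>The Hilbert space of square-integrable functions\<close>

text \<open>No adapted Haar basis is chosen: \<open>\<nu> g P\<close> compares the value of
  \<open>a\<close> with the difference of the same \<open>g\<close>, and the packing bound is
  uniform in \<open>g\<close>. The obstacle is that the Hardy space is defined by unweighted
  differences while the test functions are adapted to \<open>b\<close>. The factor \<open>b\<close>
  reconciles them: \<open>b\<close> times an adapted difference has plain mean zero in each
  variable, so its integral vanishes over every dyadic rectangle that sticks out of its support. A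
  Bellman function is used because the quotients of averages are not a martingale for Lebesgue
  measure and adapted differences at distinct cubes are not orthogonal. Estimates are made on finite
  sets of rectangles, with uniform constants, so convergence is an issue only at the very end. The
  Bellman factor 8 and the energy factor 7 = 1 + 6 give 56; two unit-weight parameters give 56^2 for
  squared norms, hence 56 in the Hardy space norm; the strong maximal function adds the root of 16,
  and 224 = 4 * 56. The factors of \<open>b\<close> are determined only up to reciprocal scalars, so
  the final constant must be built from quantities that such a rescaling does not change.\<close>

lemma L2_iff:
  "f \<in> L2 \<longleftrightarrow> f \<in> borel_measurable lborel \<and> (\<integral>\<^sup>+x. ennreal ((norm (f x))\<^sup>2) \<partial>lborel) < \<infinity>"
  unfolding L2_def integrable_iff_bounded by auto

lemma L2_I:
  assumes "f \<in> borel_measurable borel" "(\<integral>\<^sup>+x. ennreal ((norm (f x))\<^sup>2) \<partial>lborel) < \<infinity>"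
  shows "f \<in> L2"
  using assms by (simp add: L2_iff)

lemma L2_measurable [measurable_dest]: "f \<in> L2 \<Longrightarrow> f \<in> borel_measurable borel"
  by (simp add: L2_iff)

lemma L2_integrable_square: "f \<in> L2 \<Longrightarrow> integrable lborel (\<lambda>x. (norm (f x))\<^sup>2)"
  by (simp add: L2_def)

lemma L2_norm_nonneg [simp]: "0 \<le> L2_norm f"
  by (simp add: L2_norm_def)

lemma L2_norm_power2: "(L2_norm f)\<^sup>2 = (LINT x|lborel. (norm (f x))\<^sup>2)"
  by (simp add: L2_norm_def)

lemma L2_nn_integral:
  "f \<in> L2 \<Longrightarrow> (\<integral>\<^sup>+x. ennreal ((norm (f x))\<^sup>2) \<partial>lborel) = ennreal ((L2_norm f)\<^sup>2)"
  by (subst nn_integral_eq_integral) (auto simp: L2_norm_power2 L2_def)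

lemma norm_mult_le_half_squares:
  fixes u v :: "'a::real_normed_algebra"
  shows "norm (u * v) \<le> ((norm u)\<^sup>2 + (norm v)\<^sup>2) / 2"
proof -
  have "norm (u * v) \<le> norm u * norm v" by (rule norm_mult_ineq)
  moreover have "2 * (norm u * norm v) \<le> (norm u)\<^sup>2 + (norm v)\<^sup>2"
    using sum_squares_bound[of "norm u" "norm v"] by (simp add: mult.assoc)
  ultimately show ?thesis by simp
qed

lemma norm_add_square_le:
  fixes u v :: "'a::real_normed_vector"
  shows "(norm (u + v))\<^sup>2 \<le> 2 * (norm u)\<^sup>2 + 2 * (norm v)\<^sup>2"
proof -
  have "(norm (u + v))\<^sup>2 \<le> (norm u + norm v)\<^sup>2"
    by (intro power_mono norm_triangle_ineq) auto
  also have "\<dots> \<le> 2 * (norm u)\<^sup>2 + 2 * (norm v)\<^sup>2"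
    using sum_squares_bound[of "norm u" "norm v"] by (simp add: power2_sum)
  finally show ?thesis .
qed

lemma L2_add:
  assumes "f \<in> L2" "g \<in> L2" shows "(\<lambda>x. f x + g x) \<in> L2"
proof -
  have [measurable]: "f \<in> borel_measurable borel" "g \<in> borel_measurable borel"
    using assms by (auto dest: L2_measurable)
  have "integrable lborel (\<lambda>x. 2 * (norm (f x))\<^sup>2 + 2 * (norm (g x))\<^sup>2)"
    using assms by (intro Bochner_Integration.integrable_add integrable_mult_right) (auto simp: L2_def)
  then have "integrable lborel (\<lambda>x. (norm (f x + g x))\<^sup>2)"
    by (rule Bochner_Integration.integrable_bound) (use norm_add_square_le in force)+
  then show ?thesis by (simp add: L2_def)
qed

lemma L2_scale:
  assumes "f \<in> L2" shows "(\<lambda>x. c * f x) \<in> L2"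
proof -
  have [measurable]: "f \<in> borel_measurable borel"
    using assms by (auto dest: L2_measurable)
  show ?thesis using assms by (simp add: L2_def norm_mult power_mult_distrib)
qed

lemma L2_norm_scale: "L2_norm (\<lambda>x. c * f x) = norm c * L2_norm f"
  by (simp add: L2_norm_def norm_mult power_mult_distrib real_sqrt_mult)

lemma L2_diff:
  assumes "f \<in> L2" "g \<in> L2" shows "(\<lambda>x. f x - g x) \<in> L2"
  using L2_add[OF assms(1) L2_scale[OF assms(2), of "-1"]] by simp

lemma L2_zero [simp]: "(\<lambda>x. 0) \<in> L2"
  by (simp add: L2_def)

lemma L2_sum:
  assumes "\<And>i. i \<in> A \<Longrightarrow> f i \<in> L2" shows "(\<lambda>x. \<Sum>i\<in>A. f i x) \<in> L2"
  using assms by (induction A rule: infinite_finite_induct) (auto intro: L2_add)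

lemma L2_cnj:
  assumes "f \<in> L2" shows "(\<lambda>x. cnj (f x)) \<in> L2"
proof -
  have [measurable]: "cnj \<in> borel_measurable borel"
    by (intro borel_measurable_continuous_onI continuous_intros)
  have [measurable]: "f \<in> borel_measurable borel" using assms by (rule L2_measurable)
  show ?thesis using assms by (simp add: L2_def)
qed

lemma L2_norm_cnj: "L2_norm (\<lambda>x. cnj (f x)) = L2_norm f"
  by (simp add: L2_norm_def)

lemma L2_mult_integrable:
  assumes "f \<in> L2" "g \<in> L2" shows "integrable lborel (\<lambda>x. f x * g x)"
proof -
  have [measurable]: "f \<in> borel_measurable borel" "g \<in> borel_measurable borel"
    using assms by (auto dest: L2_measurable)
  have "integrable lborel (\<lambda>x. ((norm (f x))\<^sup>2 + (norm (g x))\<^sup>2) / 2)"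
    using assms by (auto simp: L2_def)
  then show ?thesis
    by (rule Bochner_Integration.integrable_bound) (use norm_mult_le_half_squares in force)+
qed

lemma L2_Cauchy_Schwarz:
  assumes "f \<in> L2" "g \<in> L2"
  shows "(LINT x|lborel. norm (f x * g x)) \<le> L2_norm f * L2_norm g"
proof -
  let ?I = "LINT x|lborel. norm (f x * g x)"
  have int: "integrable lborel (\<lambda>x. norm (f x * g x))"
    using L2_mult_integrable[OF assms] by simp
  \<comment> \<open>The weights are free: \<open>s = b\<close>, \<open>t = a\<close> yields the
    product of the norms when both are positive, and weights depending on \<open>?I\<close> settle
    the case in which one norm is zero.\<close>
  have *: "2 * s * t * ?I \<le> s\<^sup>2 * (L2_norm f)\<^sup>2 + t\<^sup>2 * (L2_norm g)\<^sup>2" if "s \<ge> 0" "t \<ge> 0" for s t :: real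
  proof -
    have "2 * s * t * ?I = (LINT x|lborel. 2 * s * t * norm (f x * g x))" by simp
    also have "\<dots> \<le> (LINT x|lborel. s\<^sup>2 * (norm (f x))\<^sup>2 + t\<^sup>2 * (norm (g x))\<^sup>2)"
    proof (rule integral_mono)
      show "2 * s * t * norm (f x * g x) \<le> s\<^sup>2 * (norm (f x))\<^sup>2 + t\<^sup>2 * (norm (g x))\<^sup>2" for x
        using sum_squares_bound[of "s * norm (f x)" "t * norm (g x)"]
        by (simp add: norm_mult power_mult_distrib mult_ac)
    qed (use assms int in \<open>auto simp: L2_def\<close>)
    also have "\<dots> = s\<^sup>2 * (L2_norm f)\<^sup>2 + t\<^sup>2 * (L2_norm g)\<^sup>2"
      using assms by (subst Bochner_Integration.integral_add) (auto simp: L2_def L2_norm_power2)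
    finally show ?thesis .
  qed
  define a b where "a = L2_norm f" and "b = L2_norm g"
  have ab: "a \<ge> 0" "b \<ge> 0" by (auto simp: a_def b_def)
  have I0: "?I \<ge> 0" by simp
  show ?thesis
  proof (cases "a * b = 0")
    case False
    then have "a > 0" "b > 0" using ab by auto
    have "2 * b * a * ?I \<le> b\<^sup>2 * a\<^sup>2 + a\<^sup>2 * b\<^sup>2" using *[of b a] ab by (simp add: a_def b_def)
    then have "2 * (a * b) * ?I \<le> 2 * (a * b) * (a * b)" by (simp add: power2_eq_square algebra_simps)
    then have "?I \<le> a * b"
      using \<open>a > 0\<close> \<open>b > 0\<close> by (smt (verit) mult_le_cancel_left_pos mult_pos_pos)
    then show ?thesis by (simp add: a_def b_def)
  next
    case True
    have "?I \<le> 0"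
    proof (rule ccontr)
      assume "\<not> ?I \<le> 0"
      then have p: "?I > 0" by simp
      from True consider "a = 0" | "b = 0" by auto
      then show False
      proof cases
        case 1
        have "2 * (b\<^sup>2 / ?I) * ?I \<le> b\<^sup>2" if "b > 0"
          using *[of "b\<^sup>2 / ?I" 1] p 1 by (simp add: a_def b_def)
        moreover have "b \<noteq> 0" using *[of 1 1] p 1 by (auto simp: a_def b_def)
        with ab have "0 < b" by simp
        ultimately show False using p by (simp add: a_def b_def)
      next
        case 2
        have "2 * (a\<^sup>2 / ?I) * ?I \<le> a\<^sup>2" if "a > 0"
          using *[of 1 "a\<^sup>2 / ?I"] p 2 by (simp add: a_def b_def)
        moreover have "a \<noteq> 0" using *[of 1 1] p 2 by (auto simp: a_def b_def)
        with ab have "0 < a" by simp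
        ultimately show False using p by (simp add: a_def b_def)
      qed
    qed
    with True have "?I \<le> a * b" by linarith
    then show ?thesis unfolding a_def b_def .
  qed
qed

lemma L2_Cauchy_Schwarz_norm:
  assumes "f \<in> L2" "g \<in> L2"
  shows "norm (LINT x|lborel. f x * g x) \<le> L2_norm f * L2_norm g"
  using integral_norm_bound[of lborel "\<lambda>x. f x * g x"] L2_Cauchy_Schwarz[OF assms] by linarith

section \<open>Polarisation, completeness and Riesz representation\<close>

lemma L2_norm_add_power2:
  assumes "f \<in> L2" "g \<in> L2"
  shows "(L2_norm (\<lambda>x. f x + g x))\<^sup>2
    = (L2_norm f)\<^sup>2 + 2 * Re (LINT x|lborel. cnj (f x) * g x) + (L2_norm g)\<^sup>2"
proof -
  have *: "(norm (f x + g x))\<^sup>2 = (norm (f x))\<^sup>2 + 2 * Re (cnj (f x) * g x) + (norm (g x))\<^sup>2" for x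
    by (simp add: cmod_power2) (simp add: power2_eq_square algebra_simps)
  have i: "integrable lborel (\<lambda>x. cnj (f x) * g x)"
    by (intro L2_mult_integrable L2_cnj assms)
  have "(LINT x|lborel. (norm (f x))\<^sup>2 + 2 * Re (cnj (f x) * g x) + (norm (g x))\<^sup>2)
     = (L2_norm f)\<^sup>2 + 2 * Re (LINT x|lborel. cnj (f x) * g x) + (L2_norm g)\<^sup>2"
    unfolding L2_norm_power2 integral_Re[OF i, symmetric] integral_mult_right_zero[symmetric]
    by (subst Bochner_Integration.integral_add[symmetric]; (subst Bochner_Integration.integral_add[symmetric])?)
       (intro Bochner_Integration.integrable_add integrable_mult_right integrable_Re i L2_integrable_square assms refl)+
  then show ?thesis by (simp only: L2_norm_power2[of "\<lambda>x. f x + g x"] *)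
qed

text \<open>Decay \<open>(1/4)^n\<close> of the squared distances survives multiplication by
  \<open>2^n\<close>, so the series of \<open>2^n * |d n|^2\<close> has finite integral. This one
  weighted series gives almost everywhere convergence and, through its tails, the rate in
  norm.\<close>

lemma L2_complete:
  fixes g :: "nat \<Rightarrow> 'a::euclidean_space \<Rightarrow> complex"
  assumes L2: "\<And>n. g n \<in> L2" and fast: "\<And>n. (L2_norm (\<lambda>x. g (Suc n) x - g n x))\<^sup>2 \<le> (1/4) ^ n"
  obtains h where "h \<in> L2" "(\<lambda>n. L2_norm (\<lambda>x. h x - g n x)) \<longlonglongrightarrow> 0"
proof -
  have [measurable]: "g n \<in> borel_measurable borel" for n using L2 by (auto dest: L2_measurable)
  define d where "d n x = g (Suc n) x - g n x" for n x
  have d_L2: "d n \<in> L2" for n unfolding d_def[abs_def] by (intro L2_diff L2)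
  have [measurable]: "d n \<in> borel_measurable borel" for n using d_L2 by (auto dest: L2_measurable)
  have d_nn: "(\<integral>\<^sup>+x. ennreal ((norm (d n x))\<^sup>2) \<partial>lborel) \<le> ennreal ((1/4)^n)" for n
    unfolding L2_nn_integral[OF d_L2] using fast[of n] by (intro ennreal_leI) (simp add: d_def[abs_def])
  have bound: "(\<integral>\<^sup>+x. (\<Sum>n. ennreal (2^(n+k) * (norm (d (n+k) x))\<^sup>2)) \<partial>lborel) \<le> ennreal (2 * (1/2)^k)" for k
  proof -
    have "(\<integral>\<^sup>+x. (\<Sum>n. ennreal (2^(n+k) * (norm (d (n+k) x))\<^sup>2)) \<partial>lborel)
      = (\<Sum>n. ennreal (2^(n+k)) * (\<integral>\<^sup>+x. ennreal ((norm (d (n+k) x))\<^sup>2) \<partial>lborel))"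
      by (subst nn_integral_suminf) (auto simp: ennreal_mult nn_integral_cmult)
    also have "\<dots> \<le> (\<Sum>n. ennreal ((1/2)^(n+k)))"
    proof (intro suminf_le allI summableI)
      fix n
      have "ennreal (2^(n+k)) * (\<integral>\<^sup>+x. ennreal ((norm (d (n+k) x))\<^sup>2) \<partial>lborel)
        \<le> ennreal (2^(n+k)) * ennreal ((1/4)^(n+k))" by (intro mult_left_mono d_nn) auto
      also have "\<dots> = ennreal (2^(n+k) * (1/4)^(n+k))" by (simp add: ennreal_mult)
      also have "(2::real)^(n+k) * (1/4)^(n+k) = (1/2)^(n+k)"
        by (simp flip: power_mult_distrib)
      finally show "ennreal (2^(n+k)) * (\<integral>\<^sup>+x. ennreal ((norm (d (n+k) x))\<^sup>2) \<partial>lborel) \<le> ennreal ((1/2)^(n+k))" .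
    qed
    also have "\<dots> = ennreal (\<Sum>n. (1/2)^(n+k))"
      by (rule suminf_ennreal2) (auto simp: power_add intro!: summable_mult2 summable_geometric)
    also have "(\<Sum>n. (1/2::real)^(n+k)) = 2 * (1/2)^k"
      by (simp add: power_add suminf_mult2[symmetric] suminf_geometric)
    finally show ?thesis .
  qed
  have conv: "AE x in lborel. convergent (\<lambda>n. g n x)"
  proof -
    have "AE x in lborel. (\<Sum>n. ennreal (2^n * (norm (d n x))\<^sup>2)) \<noteq> \<infinity>"
      using bound[of 0] by (intro nn_integral_PInf_AE) (auto simp: top_unique dest: le_less_trans)
    then show ?thesis
    proof (rule AE_mp, intro AE_I2 impI)
      fix x assume fin: "(\<Sum>n. ennreal (2^n * (norm (d n x))\<^sup>2)) \<noteq> \<infinity>"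
      have sm: "summable (\<lambda>n. 2^n * (norm (d n x))\<^sup>2)"
        using fin by (intro summable_suminf_not_top) auto
      then have "Bseq (\<lambda>n. 2^n * (norm (d n x))\<^sup>2)"
        by (intro convergent_imp_Bseq convergentI[OF summable_LIMSEQ_zero])
      then obtain L where L: "L > 0" "\<And>n. 2^n * (norm (d n x))\<^sup>2 \<le> L"
        unfolding Bseq_def by auto
      have "norm (d n x) \<le> sqrt L * (1 / sqrt 2)^n" for n
      proof -
        have "(norm (d n x))\<^sup>2 \<le> L * (1/2)^n" using L(2)[of n] by (simp add: field_simps power_one_over)
        also have "\<dots> = (sqrt L * (1 / sqrt 2)^n)\<^sup>2"
          using L(1) by (simp add: power_mult_distrib power_divide flip: power_mult)
             (simp add: mult.commute[of n 2] power_mult)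
        finally show ?thesis by (rule power2_le_imp_le) (use L in auto)
      qed
      moreover have "summable (\<lambda>n. sqrt L * (1 / sqrt 2)^n)"
        by (intro summable_mult summable_geometric) simp
      ultimately have "summable (\<lambda>n. d n x)"
        using summable_comparison_test'[of "\<lambda>n. sqrt L * (1 / sqrt 2)^n" 0 "\<lambda>n. d n x"] by blast
      then have "convergent (\<lambda>n. \<Sum>i<n. d i x)" by (simp add: summable_iff_convergent)
      moreover have "(\<Sum>i<n. d i x) = g n x - g 0 x" for n
        unfolding d_def by (rule sum_lessThan_telescope)
      ultimately have "convergent (\<lambda>n. g n x - g 0 x)" by simp
      then have "convergent (\<lambda>n. (g n x - g 0 x) + g 0 x)" by (intro convergent_add convergent_const)
      then show "convergent (\<lambda>n. g n x)" by simp
    qed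
  qed
  \<comment> \<open>\<open>lim\<close> has an unspecified value where the sequence diverges; this
    happens only on a null set.\<close>
  define h where "h x = lim (\<lambda>n. g n x)" for x
  have [measurable]: "h \<in> borel_measurable borel" unfolding h_def[abs_def] by measurable
  have lim: "AE x in lborel. (\<lambda>n. g n x) \<longlonglongrightarrow> h x"
    using conv by (auto simp: h_def convergent_LIMSEQ_iff)
  have Sn: "(norm (g (n + k) x - g k x))\<^sup>2 \<le> 2 * (\<Sum>i<n. 2^(i+k) * (norm (d (i+k) x))\<^sup>2)" for n k x
  proof -
    have "norm (g (n + k) x - g k x) = norm (\<Sum>i<n. d (i+k) x)"
      using sum_lessThan_telescope[of "\<lambda>i. g (i+k) x" n] by (simp add: d_def)
    also have "\<dots> \<le> (\<Sum>i<n. norm (d (i+k) x))" by (rule norm_sum)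
    \<comment> \<open>The split-off weights have squares summing to at most 2, which is the factor 2
      of the estimate; the inverse weights lead to the series bounded before.\<close>
    also have "\<dots> = (\<Sum>i<n. (1 / sqrt (2^i)) * (sqrt (2^i) * norm (d (i+k) x)))" by simp
    finally have "(norm (g (n + k) x - g k x))\<^sup>2 \<le> (\<Sum>i<n. (1 / sqrt (2^i)) * (sqrt (2^i) * norm (d (i+k) x)))\<^sup>2"
      by (intro power_mono) auto
    also have "\<dots> \<le> (\<Sum>i<n. (1 / sqrt (2^i))\<^sup>2) * (\<Sum>i<n. (sqrt (2^i) * norm (d (i+k) x))\<^sup>2)"
      by (rule Cauchy_Schwarz_ineq_sum)
    also have "\<dots> = (\<Sum>i<n. (1 / 2)^i) * (\<Sum>i<n. 2^i * (norm (d (i+k) x))\<^sup>2)"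
      by (simp add: power_divide power_mult_distrib power_one_over)
    also have "\<dots> \<le> 2 * (\<Sum>i<n. 2^i * (norm (d (i+k) x))\<^sup>2)"
    proof (intro mult_right_mono sum_nonneg)
      have "(\<Sum>i<n. (1 / 2)^i) = 2 * (1 - (1/2::real)^n)" by (simp add: sum_gp_strict)
      then show "(\<Sum>i<n. (1 / 2)^i) \<le> (2::real)" by simp
    qed simp
    also have "\<dots> \<le> 2 * (\<Sum>i<n. 2^(i+k) * (norm (d (i+k) x))\<^sup>2)"
      by (intro mult_left_mono sum_mono mult_right_mono power_increasing) auto
    finally show ?thesis .
  qed
  have nnb: "(\<integral>\<^sup>+x. ennreal ((norm (h x - g k x))\<^sup>2) \<partial>lborel) \<le> ennreal (4 * (1/2)^k)" for k
  proof -
    have "AE x in lborel. ennreal ((norm (h x - g k x))\<^sup>2) \<le> 2 * (\<Sum>n. ennreal (2^(n+k) * (norm (d (n+k) x))\<^sup>2))"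
      using lim
    proof (rule AE_mp, intro AE_I2 impI)
      fix x assume lx: "(\<lambda>n. g n x) \<longlonglongrightarrow> h x"
      have "(\<lambda>n. ennreal ((norm (g (n + k) x - g k x))\<^sup>2)) \<longlonglongrightarrow> ennreal ((norm (h x - g k x))\<^sup>2)"
        using LIMSEQ_ignore_initial_segment[OF lx, of k] by (intro tendsto_ennrealI tendsto_intros)
      moreover have "ennreal ((norm (g (n + k) x - g k x))\<^sup>2)
          \<le> 2 * (\<Sum>n. ennreal (2^(n+k) * (norm (d (n+k) x))\<^sup>2))" for n
      proof -
        have "ennreal ((norm (g (n + k) x - g k x))\<^sup>2) \<le> ennreal (2 * (\<Sum>i<n. 2^(i+k) * (norm (d (i+k) x))\<^sup>2))"
          by (intro ennreal_leI Sn)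
        also have "\<dots> = 2 * (\<Sum>i<n. ennreal (2^(i+k) * (norm (d (i+k) x))\<^sup>2))"
          by (subst ennreal_mult') (auto simp: sum_nonneg)
        also have "\<dots> \<le> 2 * (\<Sum>n. ennreal (2^(n+k) * (norm (d (n+k) x))\<^sup>2))"
          by (intro mult_left_mono sum_le_suminf) auto
        finally show ?thesis .
      qed
      ultimately show "ennreal ((norm (h x - g k x))\<^sup>2) \<le> 2 * (\<Sum>n. ennreal (2^(n+k) * (norm (d (n+k) x))\<^sup>2))"
        by (rule LIMSEQ_le_const2[OF _ exI, OF _ allI, OF _ impI])
    qed
    then have "(\<integral>\<^sup>+x. ennreal ((norm (h x - g k x))\<^sup>2) \<partial>lborel)
        \<le> (\<integral>\<^sup>+x. 2 * (\<Sum>n. ennreal (2^(n+k) * (norm (d (n+k) x))\<^sup>2)) \<partial>lborel)"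
      by (rule nn_integral_mono_AE)
    also have "\<dots> = 2 * (\<integral>\<^sup>+x. (\<Sum>n. ennreal (2^(n+k) * (norm (d (n+k) x))\<^sup>2)) \<partial>lborel)"
      by (rule nn_integral_cmult) measurable
    also have "\<dots> \<le> 2 * ennreal (2 * (1/2)^k)" by (intro mult_left_mono bound) auto
    also have "\<dots> = ennreal (2 * (2 * (1/2)^k))" by (subst ennreal_mult) auto
    finally show ?thesis by simp
  qed
  have hg: "(\<lambda>x. h x - g k x) \<in> L2" for k
    by (intro L2_I le_less_trans[OF nnb[of k]]) auto
  have "h \<in> L2" using L2_add[OF hg[of 0] L2[of 0]] by simp
  moreover have "(\<lambda>n. L2_norm (\<lambda>x. h x - g n x)) \<longlonglongrightarrow> 0"
  proof -
    have "(L2_norm (\<lambda>x. h x - g n x))\<^sup>2 \<le> 4 * (1/2)^n" for n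
      using nnb[of n] unfolding L2_nn_integral[OF hg] by (subst (asm) ennreal_le_iff) auto
    moreover have "(\<lambda>n. 4 * (1/2::real)^n) \<longlonglongrightarrow> 0"
      by (intro tendsto_mult_right_zero LIMSEQ_power_zero) auto
    ultimately have "(\<lambda>n. (L2_norm (\<lambda>x. h x - g n x))\<^sup>2) \<longlonglongrightarrow> 0"
      using Lim_null_comparison[OF always_eventually, of "\<lambda>n. (L2_norm (\<lambda>x. h x - g n x))\<^sup>2" "\<lambda>n. 4 * (1/2)^n"]
      by simp
    then have "(\<lambda>n. sqrt ((L2_norm (\<lambda>x. h x - g n x))\<^sup>2)) \<longlonglongrightarrow> sqrt 0" by (rule tendsto_real_sqrt)
    then show ?thesis by simp
  qed
  ultimately show ?thesis by (rule that)
qed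

text \<open>The squared norm minus twice the real part of \<open>\<Lambda>\<close> is minimised. The
  pairing in the conclusion is bilinear whereas the inner product is conjugate linear in its first
  argument, so the function returned is the conjugate of the minimiser.\<close>

lemma L2_Riesz:
  fixes \<Lambda> :: "('a::euclidean_space \<Rightarrow> complex) \<Rightarrow> complex"
  assumes add: "\<And>f g. f \<in> L2 \<Longrightarrow> g \<in> L2 \<Longrightarrow> \<Lambda> (\<lambda>x. f x + g x) = \<Lambda> f + \<Lambda> g"
    and scale: "\<And>c f. f \<in> L2 \<Longrightarrow> \<Lambda> (\<lambda>x. c * f x) = c * \<Lambda> f"
    and bdd: "\<And>f. f \<in> L2 \<Longrightarrow> norm (\<Lambda> f) \<le> C * L2_norm f"
  obtains h where "h \<in> L2" "\<And>g. g \<in> L2 \<Longrightarrow> \<Lambda> g = (LINT x|lborel. h x * g x)"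
proof -
  define J where "J f = (L2_norm f)\<^sup>2 - 2 * Re (\<Lambda> f)" for f
  define ip where "ip f g = (LINT x|lborel. cnj (f x) * g x)" for f g :: "'a \<Rightarrow> complex"
  have ip_add: "ip f (\<lambda>x. g x + k x) = ip f g + ip f k" if "f \<in> L2" "g \<in> L2" "k \<in> L2" for f g k
    unfolding ip_def distrib_left
    by (intro Bochner_Integration.integral_add L2_mult_integrable L2_cnj that)
  have lower: "J f \<ge> - C\<^sup>2" if "f \<in> L2" for f
  proof -
    have "Re (\<Lambda> f) \<le> C * L2_norm f" using bdd[OF that] complex_Re_le_cmod[of "\<Lambda> f"] by linarith
    moreover have "(L2_norm f - C)\<^sup>2 \<ge> 0" by simp
    ultimately show ?thesis unfolding J_def by (simp add: power2_eq_square algebra_simps)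
  qed
  define m where "m = Inf (J ` L2)"
  have bddb: "bdd_below (J ` L2)" by (intro bdd_belowI[of _ "- C\<^sup>2"]) (use lower in auto)
  have m_le: "m \<le> J f" if "f \<in> L2" for f
    unfolding m_def using that by (intro cInf_lower bddb) auto
  \<comment> \<open>The tolerance is tuned to the midpoint argument below: consecutive
    near-minimisers of this quality are within \<open>(1/4)^n\<close> in squared norm, as
    \<open>L2_complete\<close> demands.\<close>
  have "\<exists>f\<in>L2. J f < m + (1/4)^n / 4" for n
  proof -
    have "\<exists>y\<in>J ` L2. y < m + (1/4)^n / 4" unfolding m_def
      by (subst cInf_less_iff[symmetric]) (use bddb in \<open>auto intro: L2_zero\<close>)
    then show ?thesis by auto
  qed
  then obtain g where g: "\<And>n. g n \<in> L2" "\<And>n. J (g n) < m + (1/4)^n / 4" by metis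
  have J_shift: "J (\<lambda>x. f x + k x) = J f + 2 * Re (ip f k) - 2 * Re (\<Lambda> k) + (L2_norm k)\<^sup>2"
    if "f \<in> L2" "k \<in> L2" for f k
    using that by (simp add: J_def L2_norm_add_power2 add ip_def)
  have cauchy: "(L2_norm (\<lambda>x. g (Suc n) x - g n x))\<^sup>2 \<le> (1/4)^n" for n
  proof -
    \<comment> \<open>Adding \<open>?h\<close> to \<open>g n\<close> gives the midpoint of two
      near-minimisers; comparing its value with \<open>m\<close> is the parallelogram law, expanded
      around \<open>g n\<close>.\<close>
    let ?k = "\<lambda>x. g (Suc n) x - g n x" let ?h = "\<lambda>x. (1/2) * ?k x"
    have k: "?k \<in> L2" "?h \<in> L2" by (intro L2_diff L2_scale g)+
    have a: "J (g (Suc n)) = J (g n) + 2 * Re (ip (g n) ?k) - 2 * Re (\<Lambda> ?k) + (L2_norm ?k)\<^sup>2"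
      using J_shift[OF g(1)[of n] k(1)] by simp
    have c1: "ip (g n) ?h = (1/2) * ip (g n) ?k"
      unfolding ip_def by (subst integral_mult_right_zero[symmetric]) (auto simp: algebra_simps)
    have c2: "(L2_norm ?h)\<^sup>2 = (L2_norm ?k)\<^sup>2 / 4"
      by (simp only: L2_norm_scale) (simp add: power2_eq_square)
    have c3: "\<Lambda> ?h = (1/2) * \<Lambda> ?k" by (rule scale[OF k(1)])
    have b: "J (\<lambda>x. g n x + ?h x) = J (g n) + Re (ip (g n) ?k) - Re (\<Lambda> ?k) + (L2_norm ?k)\<^sup>2 / 4"
      unfolding J_shift[OF g(1)[of n] k(2)] c1 c2 c3 by simp
    have "m \<le> J (\<lambda>x. g n x + ?h x)" by (intro m_le L2_add g k)
    then have "m \<le> J (g n) + Re (ip (g n) ?k) - Re (\<Lambda> ?k) + (L2_norm ?k)\<^sup>2 / 4" unfolding b .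
    have arith: "x \<le> e" if "m \<le> y + r - l + x / 4" "y < m + e / 4" "z < m + e' / 4" "z = y + 2 * r - 2 * l + x" "0 < e" "e' = e / 4"
      for x y z r l e e' :: real using that by argo
    show ?thesis by (rule arith[OF \<open>m \<le> J (g n) + _ - _ + _\<close> g(2)[of n] g(2)[of "Suc n"] a]) simp_all
  qed
  obtain h where h: "h \<in> L2" "(\<lambda>n. L2_norm (\<lambda>x. h x - g n x)) \<longlonglongrightarrow> 0"
    by (rule L2_complete[of g, OF g(1) cauchy])
  have ip_lim: "(\<lambda>n. ip (g n) k) \<longlonglongrightarrow> ip h k" if k: "k \<in> L2" for k
  proof -
    have "norm (ip (g n) k - ip h k) \<le> L2_norm (\<lambda>x. h x - g n x) * L2_norm k" for n
    proof -
      have "ip h k - ip (g n) k = (LINT x|lborel. cnj (h x - g n x) * k x)"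
        unfolding ip_def using L2_mult_integrable[OF L2_cnj k] h g by (simp add: algebra_simps)
      also have "norm \<dots> \<le> L2_norm (\<lambda>x. cnj (h x - g n x)) * L2_norm k"
        by (intro L2_Cauchy_Schwarz_norm L2_cnj L2_diff h g k)
      finally show ?thesis by (simp add: L2_norm_cnj norm_minus_commute del: complex_cnj_diff)
    qed
    moreover have "(\<lambda>n. L2_norm (\<lambda>x. h x - g n x) * L2_norm k) \<longlonglongrightarrow> 0"
      using tendsto_mult_left_zero[OF h(2)] by simp
    ultimately have "(\<lambda>n. ip (g n) k - ip h k) \<longlonglongrightarrow> 0"
      by (rule Lim_null_comparison[OF always_eventually, OF allI])
    then show ?thesis by (rule LIM_zero_cancel)
  qed
  have re: "Re (\<Lambda> k) = Re (ip h k)" if k: "k \<in> L2" for k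
  proof -
    define D where "D = Re (ip h k) - Re (\<Lambda> k)"
    \<comment> \<open>First variation of \<open>J\<close> in direction \<open>k\<close>, obtained
      along the minimising sequence and passed to the limit. Being valid for all real
      \<open>t\<close>, it forces the linear coefficient \<open>D\<close> to vanish.\<close>
    have main: "2 * t * D + t\<^sup>2 * (L2_norm k)\<^sup>2 \<ge> 0" for t :: real
    proof -
      let ?k = "\<lambda>x. complex_of_real t * k x"
      have k': "?k \<in> L2" by (intro L2_scale k)
      have "2 * t * Re (ip (g n) k) - 2 * t * Re (\<Lambda> k) + t\<^sup>2 * (L2_norm k)\<^sup>2 + (1/4)^n / 4 \<ge> 0" for n
      proof -
        have "ip (g n) ?k = complex_of_real t * ip (g n) k"
          unfolding ip_def by (subst integral_mult_right_zero[symmetric]) (auto simp: algebra_simps)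
        then have "J (\<lambda>x. g n x + ?k x) = J (g n) + 2 * t * Re (ip (g n) k) - 2 * t * Re (\<Lambda> k) + t\<^sup>2 * (L2_norm k)\<^sup>2"
          using J_shift[OF g(1)[of n] k'] scale[OF k, of t] by (simp add: L2_norm_scale power_mult_distrib)
        moreover have "m \<le> J (\<lambda>x. g n x + ?k x)" by (intro m_le L2_add g k')
        ultimately show ?thesis using g(2)[of n] by linarith
      qed
      moreover have "(\<lambda>n. 2 * t * Re (ip (g n) k) - 2 * t * Re (\<Lambda> k) + t\<^sup>2 * (L2_norm k)\<^sup>2 + (1/4)^n / 4)
        \<longlonglongrightarrow> 2 * t * Re (ip h k) - 2 * t * Re (\<Lambda> k) + t\<^sup>2 * (L2_norm k)\<^sup>2 + 0 / 4"
        by (intro tendsto_intros ip_lim k LIMSEQ_power_zero) auto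
      ultimately have "2 * t * Re (ip h k) - 2 * t * Re (\<Lambda> k) + t\<^sup>2 * (L2_norm k)\<^sup>2 + 0 / 4 \<ge> 0"
        by (intro LIMSEQ_le_const[of _ _ 0]) auto
      then show ?thesis by (simp add: D_def algebra_simps)
    qed
    have "D = 0"
    proof (rule ccontr)
      assume "D \<noteq> 0"
      \<comment> \<open>The added 1 keeps the test parameter \<open>- D / N\<close> meaningful when
        \<open>k\<close> has norm zero.\<close>
      define N where "N = (L2_norm k)\<^sup>2 + 1"
      have N: "N > 0" unfolding N_def by (smt (verit) zero_le_power2)
      have "2 * (- D / N) * D + (- D / N)\<^sup>2 * (L2_norm k)\<^sup>2 \<ge> 0" by (rule main)
      moreover have "(- D / N)\<^sup>2 * (L2_norm k)\<^sup>2 \<le> (- D / N)\<^sup>2 * N"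
        by (intro mult_left_mono) (auto simp: N_def)
      moreover have "(- D / N)\<^sup>2 * N = D\<^sup>2 / N" using N by (simp add: power2_eq_square)
      moreover have "2 * (- D / N) * D = - 2 * (D\<^sup>2 / N)" by (simp add: power2_eq_square)
      moreover have "D\<^sup>2 / N > 0" using \<open>D \<noteq> 0\<close> N by simp
      ultimately show False by linarith
    qed
    then show ?thesis by (simp add: D_def)
  qed
  have "\<Lambda> k = ip h k" if k: "k \<in> L2" for k
  proof (rule complex_eqI)
    show "Re (\<Lambda> k) = Re (ip h k)" by (rule re[OF k])
    \<comment> \<open>Imaginary parts are recovered from real parts at \<open>\<i> * k\<close>, by
      complex linearity of both sides.\<close>
    have "ip h (\<lambda>x. \<i> * k x) = \<i> * ip h k"
      unfolding ip_def by (subst integral_mult_right_zero[symmetric]) (auto simp: algebra_simps)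
    then show "Im (\<Lambda> k) = Im (ip h k)"
      using re[OF L2_scale[OF k, of \<i>]] scale[OF k, of \<i>] by simp
  qed
  then show ?thesis using that[of "\<lambda>x. cnj (h x)"] h(1) L2_cnj by (auto simp: ip_def)
qed

section \<open>A finite Carleson embedding\<close>

text \<open>The proof peels off the smallest weight: a layer-cake decomposition of \<open>w\<close>.\<close>

lemma finite_Carleson_embedding:
  fixes w \<nu> :: "'i \<Rightarrow> real" and H :: "'a \<Rightarrow> ennreal"
  assumes "finite F" and X: "\<And>i. i \<in> F \<Longrightarrow> X i \<in> sets M" and [measurable]: "H \<in> borel_measurable M"
    and w: "\<And>i. i \<in> F \<Longrightarrow> 0 \<le> w i" and \<nu>: "\<And>i. i \<in> F \<Longrightarrow> 0 \<le> \<nu> i"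
    and H: "\<And>i x. i \<in> F \<Longrightarrow> x \<in> X i \<Longrightarrow> ennreal (w i) \<le> H x"
    and carleson: "\<And>G. G \<subseteq> F \<Longrightarrow> ennreal (\<Sum>i\<in>G. \<nu> i) \<le> A * emeasure M (\<Union>i\<in>G. X i)"
  shows "ennreal (\<Sum>i\<in>F. w i * \<nu> i) \<le> A * (\<integral>\<^sup>+x. H x \<partial>M)"
  using assms
proof (induction "card F" arbitrary: F w H)
  case 0
  then show ?case by simp
next
  case (Suc n)
  note [measurable] = Suc.prems(3)
  have "F \<noteq> {}" using Suc.hyps by auto
  define j where "j = arg_min_on w F"
  have j: "j \<in> F" "\<And>i. i \<in> F \<Longrightarrow> w j \<le> w i"
    unfolding j_def using \<open>F \<noteq> {}\<close> Suc.prems(1) by (auto intro: arg_min_if_finite arg_min_least)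
  define U where "U = (\<Union>i\<in>F. X i)"
  have U[measurable]: "U \<in> sets M" unfolding U_def using Suc.prems(1,2) by auto
  define H' where "H' x = H x - ennreal (w j) * indicator U x" for x
  have w0: "w j \<ge> 0" using Suc.prems(4) j by auto
  have [measurable]: "H' \<in> borel_measurable M" unfolding H'_def[abs_def] by measurable
  have le: "ennreal (w j) * indicator U x \<le> H x" for x
    using Suc.prems(6) j(2) by (auto simp: U_def indicator_def intro: order_trans[OF ennreal_leI])
  have split: "H x = H' x + ennreal (w j) * indicator U x" for x
    unfolding H'_def using le by (simp add: diff_add_cancel_ennreal)
  have IH: "ennreal (\<Sum>i\<in>F - {j}. (w i - w j) * \<nu> i) \<le> A * (\<integral>\<^sup>+x. H' x \<partial>M)"
  proof (rule Suc.hyps(1))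
    show "n = card (F - {j})" using Suc.hyps(2) j Suc.prems(1) by simp
    fix i x assume "i \<in> F - {j}" "x \<in> X i"
    then show "ennreal (w i - w j) \<le> H' x"
      using Suc.prems(6)[of i x] w0 by (auto simp: H'_def U_def indicator_def ennreal_minus[symmetric] intro: ennreal_minus_mono)
  next
    fix G assume "G \<subseteq> F - {j}"
    then show "ennreal (\<Sum>i\<in>G. \<nu> i) \<le> A * emeasure M (\<Union>i\<in>G. X i)" by (intro Suc.prems(7)) auto
  qed (use Suc.prems j in auto)
  have "(\<Sum>i\<in>F. w i * \<nu> i) = (\<Sum>i\<in>F - {j}. (w i - w j) * \<nu> i) + w j * (\<Sum>i\<in>F. \<nu> i)"
  proof -
    have "(\<Sum>i\<in>F. w i * \<nu> i) = (\<Sum>i\<in>F. (w i - w j) * \<nu> i) + w j * (\<Sum>i\<in>F. \<nu> i)"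
      by (simp add: sum_distrib_left algebra_simps flip: sum.distrib)
    also have "(\<Sum>i\<in>F. (w i - w j) * \<nu> i) = (\<Sum>i\<in>F - {j}. (w i - w j) * \<nu> i)"
      using j Suc.prems(1) by (subst sum.remove[of F j]) auto
    finally show ?thesis .
  qed
  then have "ennreal (\<Sum>i\<in>F. w i * \<nu> i)
      = ennreal (\<Sum>i\<in>F - {j}. (w i - w j) * \<nu> i) + ennreal (w j) * ennreal (\<Sum>i\<in>F. \<nu> i)"
    using Suc.prems(5) w0 j by (subst ennreal_mult'[symmetric], simp, subst ennreal_plus[symmetric])
      (auto intro!: sum_nonneg mult_nonneg_nonneg)
  \<comment> \<open>The bottom layer has height \<open>w j\<close> on all of \<open>U\<close>, so it
    is paid for by the packing hypothesis for the whole of \<open>F\<close>; what lies above it is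
    the induction hypothesis.\<close>
  also have "\<dots> \<le> A * (\<integral>\<^sup>+x. H' x \<partial>M) + ennreal (w j) * (A * emeasure M U)"
    unfolding U_def by (intro add_mono IH mult_left_mono Suc.prems(7)) auto
  also have "\<dots> = A * ((\<integral>\<^sup>+x. H' x \<partial>M) + (\<integral>\<^sup>+x. ennreal (w j) * indicator U x \<partial>M))"
    by (simp add: nn_integral_cmult distrib_left mult_ac)
  also have "\<dots> = A * (\<integral>\<^sup>+x. H' x + ennreal (w j) * indicator U x \<partial>M)"
    by (subst nn_integral_add) auto
  also have "\<dots> = A * (\<integral>\<^sup>+x. H x \<partial>M)" by (simp flip: split)
  finally show ?case .
qed

section \<open>Geometry of dyadic grids\<close>

lemma cube_eq_Basis:
  fixes a :: "real ^ 'n"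
  shows "cube a l = {x. \<forall>i\<in>Basis. a \<bullet> i \<le> x \<bullet> i \<and> x \<bullet> i < (a + l *\<^sub>R One) \<bullet> i}"
proof -
  have "(\<forall>i\<in>Basis. P i) \<longleftrightarrow> (\<forall>j. P (axis j 1))" for P :: "real ^ 'n \<Rightarrow> bool"
    by (auto simp: Basis_vec_def)
  moreover have "axis j 1 \<in> (Basis :: (real ^ 'n) set)" for j :: 'n by (auto simp: Basis_vec_def)
  ultimately show ?thesis
    by (simp add: cube_def cart_eq_inner_axis inner_add_left inner_sum_left_Basis)
qed

lemma box_subset_cube: "box a (a + l *\<^sub>R One) \<subseteq> cube a l"
  by (auto simp: cube_eq_Basis mem_box less_imp_le)

lemma cube_subset_cbox: "cube a l \<subseteq> cbox a (a + l *\<^sub>R One)"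
  by (auto simp: cube_eq_Basis mem_box less_imp_le)

lemma cube_borel [measurable]: "cube a l \<in> sets borel"
proof -
  have "cube a l = (\<Inter>j. {x. a $ j \<le> x $ j} \<inter> {x. x $ j < a $ j + l})" by (auto simp: cube_def)
  also have "\<dots> \<in> sets borel"
    by (intro sets.countable_INT'' sets.Int borel_closed borel_open closed_Collect_le open_Collect_less continuous_intros)
       (auto simp: countable_finite)
  finally show ?thesis .
qed

lemma emeasure_cube_finite: "emeasure lborel (cube a l) < \<infinity>"
  using emeasure_mono[OF cube_subset_cbox, of a l lborel] emeasure_lborel_cbox_finite[of a "a + l *\<^sub>R One"]
  by (auto intro: le_less_trans)

lemma emeasure_cube_pos: "l > 0 \<Longrightarrow> 0 < emeasure lborel (cube a l)"
proof -
  assume l: "l > 0"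
  have "0 < emeasure lborel (box a (a + l *\<^sub>R One))"
    using l by (subst emeasure_lborel_box) (auto simp: inner_add_left inner_sum_left_Basis)
  also have "\<dots> \<le> emeasure lborel (cube a l)" by (intro emeasure_mono box_subset_cube) auto
  finally show ?thesis .
qed

lemma measure_cube_pos: "l > 0 \<Longrightarrow> 0 < measure lborel (cube a l)"
  using emeasure_cube_pos[of l a] emeasure_cube_finite[of a l]
  by (simp add: measure_def enn2real_positive_iff less_top)

lemma translate_cube: "(+) v ` cube a l = cube (v + a) l"
proof (intro set_eqI iffI)
  fix x assume "x \<in> cube (v + a) l"
  then have "x - v \<in> cube a l" by (auto simp: cube_def algebra_simps)
  then show "x \<in> (+) v ` cube a l" by (intro image_eqI[of _ _ "x - v"]) auto
qed (auto simp: cube_def algebra_simps)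

text \<open>A half-open cube contains its lower corner, which is minimal in every coordinate, so
  position and side can be read off from the set. This makes the level of a cell well
  defined.\<close>

lemma cube_inject:
  assumes eq: "cube a l = cube a' l'" and "l > 0" "l' > 0"
  shows "a = a'" "l = l'"
proof -
  have "a \<in> cube a' l'" "a' \<in> cube a l" unfolding eq[symmetric] using assms(2)
    by (simp add: cube_def) (unfold eq, use assms(3) in \<open>simp add: cube_def\<close>)
  then show a: "a = a'" by (auto simp: cube_def vec_eq_iff intro: antisym)
  have "\<not> l < l'" if "cube a l = cube a l'" "l > 0" for l l'
  proof
    assume "l < l'"
    then have "(\<chi> j. a $ j + l) \<in> cube a l'" "(\<chi> j. a $ j + l) \<notin> cube a l"
      using that(2) by (auto simp: cube_def)
    with that(1) show False by simp
  qed
  from this[of l l'] this[of l' l] eq a assms(2,3) show "l = l'" by force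
qed

text \<open>Comparison with a geometric series. Summability must be established because
  \<open>infsum\<close> of a divergent family is 0, which would break the recursion of the
  shifts.\<close>

lemma summable_grid_shift:
  fixes \<omega> :: "int \<Rightarrow> real ^ 'n"
  assumes "\<And>i j. \<omega> i $ j \<in> {0, 1}"
  shows "(\<lambda>i. 2 powi (- i) *\<^sub>R \<omega> i) summable_on {p<..}"
proof -
  have "summable (\<lambda>n. 2 powi (- (p + 1)) * (1/2::real) ^ n)"
    by (intro summable_mult summable_geometric) auto
  then have "(\<lambda>n. 2 powi (- (p + 1)) * (1/2::real) ^ n) summable_on UNIV"
    by (intro norm_summable_imp_summable_on) (simp add: abs_mult power_abs)
  also have "(\<lambda>n. 2 powi (- (p + 1)) * (1/2::real) ^ n) = (\<lambda>n. 2 powi (- (p + 1 + int n)))"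
    by (auto simp: power_int_diff power_int_add power_int_minus field_simps)
  also have "\<dots> summable_on UNIV \<longleftrightarrow> (\<lambda>i. (2::real) powi (- i)) summable_on {p<..}"
    by (rule summable_on_reindex_bij_betw, rule bij_betwI[where g = "\<lambda>i. nat (i - p - 1)"]) auto
  finally have "(\<lambda>i. (2::real) powi (- i) * of_nat CARD('n)) summable_on {p<..}"
    by (rule summable_on_cmult_left)
  then have "(\<lambda>i. norm ((2::real) powi (- i) * of_nat CARD('n))) summable_on {p<..}"
    by (simp add: abs_mult)
  then have "(\<lambda>i. norm (2 powi (- i) *\<^sub>R \<omega> i)) summable_on {p<..}"
  proof (rule Infinite_Sum.abs_summable_on_comparison_test)
    fix i
    have "norm (\<omega> i) \<le> (\<Sum>j\<in>UNIV. \<bar>\<omega> i $ j\<bar>)" by (rule norm_le_l1_cart)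
    also have "\<dots> \<le> (\<Sum>j\<in>(UNIV::'n set). 1)"
      using assms by (intro sum_mono) (smt (verit) insertE empty_iff)
    finally show "norm (2 powi (- i) *\<^sub>R \<omega> i) \<le> norm ((2::real) powi (- i) * of_nat CARD('n))"
      by (simp add: abs_mult)
  qed
  then show ?thesis by (rule abs_summable_summable)
qed

lemma two_powi_less_iff: "(2::real) powi a < 2 powi b \<longleftrightarrow> a < b"
  using power_int_strict_increasing[of a b "2::real"] power_int_strict_increasing[of b a "2::real"]
  by (cases a b rule: linorder_cases) auto

lemma two_powi_eq_iff: "(2::real) powi a = 2 powi b \<longleftrightarrow> a = b"
  using two_powi_less_iff[of a b] two_powi_less_iff[of b a] by (cases a b rule: linorder_cases) auto

text \<open>The largest term of the shift is split off. Consecutive shifts differ by 0 or one finer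
  side length in each coordinate, which keeps successive levels nested.\<close>

lemma grid_shift_step:
  fixes \<omega> :: "int \<Rightarrow> real ^ 'n"
  assumes "\<And>i j. \<omega> i $ j \<in> {0, 1}"
  shows "grid_shift \<omega> p = 2 powi (- (p + 1)) *\<^sub>R \<omega> (p + 1) + grid_shift \<omega> (p + 1)"
proof -
  have set: "{i. (2::real) powi (- i) < 2 powi (- q)} = {q<..}" for q by (auto simp: two_powi_less_iff)
  have "{p<..} = insert (p + 1) {p + 1<..}" by auto
  then show ?thesis
    unfolding grid_shift_def set
    using infsum_insert[OF summable_grid_shift[where p = "p + 1", OF assms], of "p + 1"] by simp
qed

section \<open>Combinatorics of one dyadic grid: cells, nesting, children\<close>

locale grid =
  fixes D :: "(real ^ 'n) set set"
  assumes dyadic: "dyadic_grid D"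
begin

text \<open>The cells of level \<open>p\<close> are the fibres of the integer coordinates
  \<open>idx p\<close>, floors of shifted and scaled coordinates. Refinement becomes integer
  arithmetic, halving after subtraction of the shift digit \<open>w p\<close>; disjointness, nesting
  and finiteness of children are later derived from this encoding.\<close>

lemma grid_structure:
  obtains idx :: "int \<Rightarrow> real ^ 'n \<Rightarrow> 'n \<Rightarrow> int" and w :: "int \<Rightarrow> 'n \<Rightarrow> int"
  where "\<And>p. grid_level D p = range (\<lambda>k. {x. idx p x = k})"
    "\<And>p x. idx p x = (\<lambda>j. (idx (p + 1) x j - w p j) div 2)"
    "D = (\<Union>p. grid_level D p)"
    "\<And>p k. \<exists>x. idx p x = k"
proof -
  obtain \<omega> where \<omega>: "\<And>i j. \<omega> i $ j \<in> {0, 1}"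
    and D: "D = (\<Union>p. (\<lambda>I. (+) (grid_shift \<omega> p) ` I) ` standard_dyadic_cubes p)"
    using dyadic unfolding dyadic_grid_def by auto
  define s where "s = grid_shift \<omega>"
  define idx where "idx p x j = \<lfloor>(x $ j - s p $ j) * 2 powi p\<rfloor>" for p x j
  define w where "w p j = \<lfloor>\<omega> (p + 1) $ j\<rfloor>" for p j
  have pos: "(2::real) powi p > 0" for p by simp
  have inv: "(2::real) powi (- p) = 1 / 2 powi p" for p by (simp add: power_int_minus field_simps)
  have cube_idx: "cube (s p + 2 powi (- p) *\<^sub>R (\<chi> j. of_int (k j))) (2 powi (- p)) = {x. idx p x = k}" for p k
  proof -
    have "idx p x = k \<longleftrightarrow> (\<forall>j. s p $ j + 2 powi (- p) * of_int (k j) \<le> x $ j \<and>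
        x $ j < s p $ j + 2 powi (- p) * of_int (k j) + 2 powi (- p))" for x
      using pos[of p] by (auto simp: fun_eq_iff idx_def floor_eq_iff inv field_simps)
    then show ?thesis by (auto simp: cube_def)
  qed
  have std: "(\<lambda>I. (+) (s p) ` I) ` standard_dyadic_cubes p = range (\<lambda>k. {x. idx p x = k})" for p
  proof -
    have "(\<forall>j. k $ j \<in> \<int>) \<longleftrightarrow> (\<exists>k'. k = (\<chi> j. of_int (k' j)))" for k :: "real ^ 'n"
      unfolding Ints_def vec_eq_iff by (auto simp: image_iff) metis
    then have "standard_dyadic_cubes p = range (\<lambda>k. cube (2 powi (- p) *\<^sub>R (\<chi> j::'n. of_int (k j))) (2 powi (- p)))"
      unfolding standard_dyadic_cubes_def by auto
    then show ?thesis by (simp add: image_image translate_cube cube_idx)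
  qed
  have D': "D = (\<Union>p. range (\<lambda>k. {x. idx p x = k}))"
    using D std unfolding s_def by simp
  have lev: "grid_level D p = range (\<lambda>k. {x. idx p x = k})" for p
  proof (intro set_eqI iffI)
    fix I assume "I \<in> grid_level D p"
    then obtain a where I: "I \<in> D" "I = cube a (2 powi (- p))" by (auto simp: grid_level_def)
    from I(1) obtain q k where q: "I = {x. idx q x = k}" by (auto simp: D')
    \<comment> \<open>\<open>grid_level\<close> selects by side length among all cells of
      \<open>D\<close>; since the set determines its side, no cell of another level \<open>q\<close>
      slips in.\<close>
    with I(2) have "cube a (2 powi (- p)) = cube (s q + 2 powi (- q) *\<^sub>R (\<chi> j. of_int (k j))) (2 powi (- q))"
      by (simp add: cube_idx)
    then have "(2::real) powi (- p) = 2 powi (- q)" by (rule cube_inject(2)) auto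
    then have "p = q" by (simp add: two_powi_eq_iff)
    with q show "I \<in> range (\<lambda>k. {x. idx p x = k})" by auto
  next
    fix I assume "I \<in> range (\<lambda>k. {x. idx p x = k})"
    then obtain k where k: "I = {x. idx p x = k}" by auto
    then have "I \<in> D" by (auto simp: D')
    moreover have "\<exists>a. I = cube a (2 powi (- p))" unfolding k cube_idx[symmetric] by blast
    ultimately show "I \<in> grid_level D p" by (simp add: grid_level_def)
  qed
  show ?thesis
  proof (rule that)
    show "grid_level D p = range (\<lambda>k. {x. idx p x = k})" for p by (rule lev)
    show "D = (\<Union>p. grid_level D p)" unfolding lev by (rule D')
    show "\<exists>x. idx p x = k" for p k
    proof (rule exI[of _ "s p + 2 powi (- p) *\<^sub>R (\<chi> j. of_int (k j))"])
      have "s p + 2 powi (- p) *\<^sub>R (\<chi> j. of_int (k j)) \<in> {x. idx p x = k}"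
        unfolding cube_idx[symmetric] by (simp add: cube_def)
      then show "idx p (s p + 2 powi (- p) *\<^sub>R (\<chi> j. of_int (k j))) = k" by simp
    qed
    show "idx p x = (\<lambda>j. (idx (p + 1) x j - w p j) div 2)" for p x
    proof
      fix j
      define t where "t = (x $ j - s (p + 1) $ j) * 2 powi (p + 1)"
      have wj: "\<omega> (p + 1) $ j = of_int (w p j)" using \<omega>[of "p + 1" j] by (auto simp: w_def)
      have "s p $ j = 2 powi (- (p + 1)) * of_int (w p j) + s (p + 1) $ j"
        using grid_shift_step[where p = p, OF \<omega>] by (simp add: s_def flip: wj)
      then have "(x $ j - s p $ j) * 2 powi p = (t - of_int (w p j)) / 2"
        by (simp add: t_def power_int_add power_int_minus power_int_diff field_simps)
      \<comment> \<open>Taking floors commutes with division by a positive integer, so the coarse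
        index depends on \<open>x\<close> only through the fine one.\<close>
      then have "idx p x j = \<lfloor>(t - of_int (w p j)) / of_int 2\<rfloor>"
        unfolding idx_def by (simp only: of_int_numeral)
      also have "\<dots> = \<lfloor>t - of_int (w p j)\<rfloor> div 2"
        by (rule floor_divide_real_eq_div) simp
      also have "\<lfloor>t - of_int (w p j)\<rfloor> = idx (p + 1) x j - w p j" by (simp add: idx_def t_def)
      finally show "idx p x j = (idx (p + 1) x j - w p j) div 2" .
    qed
  qed
qed

lemma Union_levels: "(\<Union>p. grid_level D p) = D"
  by (rule grid_structure) (rule sym)

lemma level_subset: "I \<in> grid_level D p \<Longrightarrow> I \<in> D"
  by (simp add: grid_level_def)

lemma level_of_eq: "I \<in> grid_level D p \<Longrightarrow> level_of I = p"
  unfolding level_of_def grid_level_def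
  by (auto intro!: the_equality dest!: cube_inject(2) simp: two_powi_eq_iff)

lemma in_level_of:
  assumes "I \<in> D" shows "I \<in> grid_level D (level_of I)"
proof -
  have "I \<in> (\<Union>p. grid_level D p)" unfolding Union_levels by (rule assms)
  then obtain p where p: "I \<in> grid_level D p" by blast
  show ?thesis unfolding level_of_eq[OF p] by (rule p)
qed

lemma countable_level: "countable (grid_level D p)"
proof -
  obtain idx :: "int \<Rightarrow> real ^ 'n \<Rightarrow> 'n \<Rightarrow> int" where
    lev: "\<And>p. grid_level D p = range (\<lambda>k. {x. idx p x = k})"
    by (rule grid_structure) (rule that)
  show ?thesis unfolding lev by simp
qed

lemma countable_D: "countable D"
proof -
  have "countable (\<Union>p. grid_level D p)" by (intro countable_UN countable_level) simp
  then show ?thesis by (simp only: Union_levels)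
qed

lemma cell_is_cube:
  assumes "I \<in> D" obtains a l where "l > 0" "I = cube a l"
proof -
  from in_level_of[OF assms] obtain a where "I = cube a (2 powi (- level_of I))"
    unfolding grid_level_def by blast
  then show ?thesis by (rule that[rotated]) simp
qed

lemma borel_cell [measurable]: "I \<in> D \<Longrightarrow> I \<in> sets borel"
  by (erule cell_is_cube) (simp add: cube_borel)

lemma emeasure_cell:
  assumes "I \<in> D" shows "0 < emeasure lborel I" "emeasure lborel I < \<infinity>"
proof -
  obtain a l where "l > 0" "I = cube a l" by (rule cell_is_cube[OF assms])
  then show "0 < emeasure lborel I" "emeasure lborel I < \<infinity>"
    using emeasure_cube_pos[of l a] emeasure_cube_finite[of a l] by auto
qed

lemma measure_cell_pos: "I \<in> D \<Longrightarrow> 0 < measure lborel I"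
  using emeasure_cell[of I] by (simp add: measure_def enn2real_positive_iff less_top)

lemma emeasure_cell_eq: "I \<in> D \<Longrightarrow> emeasure lborel I = ennreal (measure lborel I)"
  using emeasure_cell[of I] by (simp add: emeasure_eq_ennreal_measure)

lemma level_unique:
  assumes "I \<in> grid_level D p" "J \<in> grid_level D p" "x \<in> I" "x \<in> J"
  shows "I = J"
proof -
  obtain idx :: "int \<Rightarrow> real ^ 'n \<Rightarrow> 'n \<Rightarrow> int" where
    lev: "\<And>p. grid_level D p = range (\<lambda>k. {x. idx p x = k})"
    by (rule grid_structure) (rule that)
  show ?thesis using assms unfolding lev by auto
qed

definition cell :: "int \<Rightarrow> real ^ 'n \<Rightarrow> (real ^ 'n) set" where
  "cell p x = (THE I. I \<in> grid_level D p \<and> x \<in> I)"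

lemma cell: "cell p x \<in> grid_level D p" "x \<in> cell p x"
proof -
  obtain idx :: "int \<Rightarrow> real ^ 'n \<Rightarrow> 'n \<Rightarrow> int" where
    lev: "\<And>p. grid_level D p = range (\<lambda>k. {x. idx p x = k})"
    by (rule grid_structure) (rule that)
  have "\<exists>I. I \<in> grid_level D p \<and> x \<in> I" unfolding lev by auto
  then have "\<exists>!I. I \<in> grid_level D p \<and> x \<in> I" using level_unique by blast
  from theI'[OF this] show "cell p x \<in> grid_level D p" "x \<in> cell p x" by (auto simp: cell_def)
qed

lemma cell_D: "cell p x \<in> D"
  by (rule level_subset[OF cell(1)])

lemma cell_eq: "I \<in> grid_level D p \<Longrightarrow> x \<in> I \<Longrightarrow> cell p x = I"
  by (rule level_unique[OF cell(1) _ cell(2)])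

lemma cell_nonempty: "I \<in> D \<Longrightarrow> \<exists>x. x \<in> I"
  using emeasure_cell(1)[of I] by (metis emeasure_empty equals0I less_irrefl)

text \<open>The fine index determines the coarse one, so all points of \<open>Q\<close> share the
  same coarse cell.\<close>

lemma nested_step:
  assumes "Q \<in> grid_level D (p + 1)" "I \<in> grid_level D p" "x \<in> Q" "x \<in> I"
  shows "Q \<subseteq> I"
proof -
  obtain idx :: "int \<Rightarrow> real ^ 'n \<Rightarrow> 'n \<Rightarrow> int" and w :: "int \<Rightarrow> 'n \<Rightarrow> int"
  where lev: "\<And>p. grid_level D p = range (\<lambda>k. {x. idx p x = k})"
    and rec: "\<And>p x. idx p x = (\<lambda>j. (idx (p + 1) x j - w p j) div 2)"
    by (rule grid_structure) (rule that)
  from assms have "Q = {y. idx (p + 1) y = idx (p + 1) x}" "I = {y. idx p y = idx p x}"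
    unfolding lev by auto
  then show ?thesis using rec[of p] by auto
qed

lemma nested_add:
  assumes "Q \<in> grid_level D (p + int k)" "I \<in> grid_level D p" "x \<in> Q" "x \<in> I"
  shows "Q \<subseteq> I"
  using assms
proof (induction k arbitrary: Q)
  case 0
  then have "Q = I" by (intro level_unique[of Q p I x]) simp_all
  then show ?case by simp
next
  case (Suc k)
  have "Q \<subseteq> cell (p + int k) x"
    by (rule nested_step[OF _ cell(1) Suc.prems(3) cell(2)]) (use Suc.prems(1) in \<open>simp add: ac_simps\<close>)
  also have "\<dots> \<subseteq> I" by (rule Suc.IH[OF cell(1) Suc.prems(2) cell(2) Suc.prems(4)])
  finally show ?case .
qed

lemma nested:
  assumes "Q \<in> grid_level D q" "I \<in> grid_level D p" "p \<le> q" "x \<in> Q" "x \<in> I"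
  shows "Q \<subseteq> I"
  by (rule nested_add[of _ _ "nat (q - p)" _ x]) (use assms in auto)

lemma subset_or_disjoint:
  assumes "I \<in> D" "J \<in> D"
  shows "I \<subseteq> J \<or> J \<subseteq> I \<or> I \<inter> J = {}"
proof (cases "I \<inter> J = {}")
  case False
  then obtain x where "x \<in> I" "x \<in> J" by auto
  then show ?thesis
    using nested[OF in_level_of[OF assms(1)] in_level_of[OF assms(2)], of x]
      nested[OF in_level_of[OF assms(2)] in_level_of[OF assms(1)], of x] by linarith
qed auto

definition children :: "(real ^ 'n) set \<Rightarrow> (real ^ 'n) set set" where
  "children I = {Q \<in> grid_level D (level_of I + 1). Q \<subseteq> I}"

lemma children_level: "Q \<in> children I \<Longrightarrow> Q \<in> grid_level D (level_of I + 1)"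
  by (simp add: children_def)

lemma children_D: "Q \<in> children I \<Longrightarrow> Q \<in> D"
  by (rule level_subset[OF children_level])

lemma children_subset: "Q \<in> children I \<Longrightarrow> Q \<subseteq> I"
  by (simp add: children_def)

lemma finite_children:
  assumes "I \<in> D" shows "finite (children I)"
proof -
  obtain idx :: "int \<Rightarrow> real ^ 'n \<Rightarrow> 'n \<Rightarrow> int" and w :: "int \<Rightarrow> 'n \<Rightarrow> int"
  where lev: "\<And>p. grid_level D p = range (\<lambda>k. {x. idx p x = k})"
    and rec: "\<And>p x. idx p x = (\<lambda>j. (idx (p + 1) x j - w p j) div 2)"
    and ne: "\<And>p k. \<exists>x. idx p x = k"
    by (rule grid_structure) (rule that)
  define p where "p = level_of I"
  obtain k where k: "I = {x. idx p x = k}" using in_level_of[OF assms] by (auto simp: lev p_def)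
  \<comment> \<open>In each coordinate \<open>div 2\<close> has exactly two preimages, hence at most
    \<open>2^n\<close> children in dimension \<open>n\<close>.\<close>
  have "children I \<subseteq> (\<lambda>k'. {x. idx (p + 1) x = k'}) ` (\<Pi>\<^sub>E j\<in>UNIV. {2 * k j + w p j, 2 * k j + w p j + 1})"
  proof
    fix Q assume Q: "Q \<in> children I"
    then obtain k' where k': "Q = {x. idx (p + 1) x = k'}" by (auto simp: children_def lev p_def)
    obtain x where x: "idx (p + 1) x = k'" using ne by blast
    then have "idx p x = k" using Q k k' by (auto dest: children_subset)
    then have "\<And>j. k j = (k' j - w p j) div 2" using rec[of p x] x by (auto simp: fun_eq_iff)
    then have "k' j \<in> {2 * k j + w p j, 2 * k j + w p j + 1}" for j by (simp; presburger)
    then show "Q \<in> (\<lambda>k'. {x. idx (p + 1) x = k'}) ` (\<Pi>\<^sub>E j\<in>UNIV. {2 * k j + w p j, 2 * k j + w p j + 1})"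
      using k' by auto
  qed
  then show ?thesis by (rule finite_subset) (auto intro!: finite_imageI finite_PiE)
qed

lemma cell_child: "I \<in> D \<Longrightarrow> x \<in> I \<Longrightarrow> cell (level_of I + 1) x \<in> children I"
  unfolding children_def using nested_step[OF cell(1) in_level_of _ , of I x x] cell
  by simp

lemma Union_children: "I \<in> D \<Longrightarrow> \<Union>(children I) = I"
proof
  assume I: "I \<in> D"
  show "\<Union>(children I) \<subseteq> I" using children_subset by blast
  show "I \<subseteq> \<Union>(children I)"
  proof
    fix x assume "x \<in> I"
    then show "x \<in> \<Union>(children I)" by (intro UnionI[OF cell_child[OF I] cell(2)])
  qed
qed

lemma disjoint_children: "disjoint (children I)"
proof (rule disjointI)
  fix Q Q' assume *: "Q \<in> children I" "Q' \<in> children I" "Q \<noteq> Q'"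
  have False if "x \<in> Q" "x \<in> Q'" for x
    using level_unique[OF children_level[OF *(1)] children_level[OF *(2)] that] *(3) by simp
  then show "Q \<inter> Q' = {}" by blast
qed

lemma sum_children_indicator:
  fixes v :: "(real ^ 'n) set \<Rightarrow> 'b::real_normed_algebra_1"
  assumes "I \<in> D"
  shows "(\<Sum>Q\<in>children I. v Q * indicator Q x) = indicator I x * v (cell (level_of I + 1) x)"
proof (cases "x \<in> I")
  case True
  have "(\<Sum>Q\<in>children I. v Q * indicator Q x) = (\<Sum>Q\<in>{cell (level_of I + 1) x}. v Q * indicator Q x)"
  proof (rule sum.mono_neutral_right)
    show "\<forall>Q\<in>children I - {cell (level_of I + 1) x}. v Q * indicator Q x = 0"
      using cell_eq[OF children_level, of _ I x] by (auto simp: indicator_def)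
    show "finite (children I)" by (rule finite_children[OF assms])
    show "{cell (level_of I + 1) x} \<subseteq> children I" using cell_child[OF assms True] by simp
  qed
  with True show ?thesis by (simp add: cell(2))
next
  case False
  then have "v Q * indicator Q x = 0" if "Q \<in> children I" for Q
    using children_subset that by (auto simp: indicator_def)
  with False show ?thesis by simp
qed

section \<open>Finite formulas for adapted differences, and integration over children\<close>

lemma expect_op_eq:
  "expect_op D b p f x = (LINT y:cell p x|lborel. f y * b y) / (LINT y:cell p x|lborel. b y)"
proof -
  let ?g = "\<lambda>I. (LINT y:I|lborel. f y * b y) / (LINT y:I|lborel. b y) * indicator I x"
  have "expect_op D b p f x = infsum ?g {cell p x}"
    unfolding expect_op_def
  proof (rule infsum_cong_neutral)
    fix I assume "I \<in> grid_level D p - {cell p x}"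
    then show "?g I = 0" using cell_eq[of I p x] by (auto simp: indicator_def)
  qed (simp_all add: cell(1))
  then show ?thesis by (simp add: cell(2))
qed

text \<open>On \<open>I\<close> the coarse cell is \<open>I\<close> itself and the fine cell runs
  through its children. The infinite sums of the definitions collapse to a step function with
  finitely many values, the form used from here on.\<close>

lemma diff_cube_eq:
  assumes "I \<in> D"
  shows "diff_cube D b I f x = (\<Sum>Q\<in>children I.
     ((LINT y:Q|lborel. f y * b y) / (LINT y:Q|lborel. b y)
      - (LINT y:I|lborel. f y * b y) / (LINT y:I|lborel. b y)) * indicator Q x)"
proof -
  have "cell (level_of I) x = I" if "x \<in> I" by (rule cell_eq[OF in_level_of[OF assms] that])
  then show ?thesis
    unfolding sum_children_indicator[OF assms] diff_cube_def diff_op_def expect_op_eq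
    by (auto simp: indicator_def)
qed

lemma set_integrable_child:
  fixes f :: "real ^ 'n \<Rightarrow> 'b::{banach, second_countable_topology}"
  assumes "set_integrable lborel I f" "Q \<in> children I"
  shows "set_integrable lborel Q f"
  by (rule set_integrable_subset[OF assms(1)])
    (use borel_cell[OF children_D[OF assms(2)]] children_subset[OF assms(2)] in auto)

lemma disjoint_family_children: "disjoint_family_on (\<lambda>Q. Q) (children I)"
  using disjoint_children by (auto simp: disjoint_family_on_def disjoint_def)

lemma set_integral_children:
  fixes f :: "real ^ 'n \<Rightarrow> 'b::{banach, second_countable_topology}"
  assumes "I \<in> D" "set_integrable lborel I f"
  shows "(LINT x:I|lborel. f x) = (\<Sum>Q\<in>children I. LINT x:Q|lborel. f x)"
proof -
  have "(LINT x:(\<Union>Q\<in>children I. Q)|lborel. f x) = (\<Sum>Q\<in>children I. LINT x:Q|lborel. f x)"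
    by (rule set_integral_finite_Union)
      (use finite_children[OF assms(1)] disjoint_family_children set_integrable_child[OF assms(2)]
          borel_cell[OF children_D] in auto)
  then show ?thesis using Union_children[OF assms(1)] by simp
qed

lemma measure_children:
  assumes "I \<in> D"
  shows "measure lborel I = (\<Sum>Q\<in>children I. measure lborel Q)"
proof -
  have "set_integrable lborel I (\<lambda>_. 1 :: real)"
    using assms emeasure_cell[OF assms] by (auto simp: set_integrable_def less_top)
  from set_integral_children[OF assms this] show ?thesis
    using assms by (simp add: set_lebesgue_integral_def children_D borel_cell cong: sum.cong)
qed

lemma nn_integral_children:
  assumes "I \<in> D" and [measurable]: "u \<in> borel_measurable borel"
  shows "(\<integral>\<^sup>+x\<in>I. u x \<partial>lborel) = (\<Sum>Q\<in>children I. \<integral>\<^sup>+x\<in>Q. u x \<partial>lborel)"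
proof -
  have [measurable]: "Q \<in> sets borel" if "Q \<in> children I" for Q
    using that by (intro borel_cell children_D)
  have "indicator I x = (\<Sum>Q\<in>children I. indicator Q x :: ennreal)" for x
    using indicator_UN_disjoint[OF finite_children[OF assms(1)] disjoint_family_children, of x]
    by (simp add: Union_children[OF assms(1)])
  then have "(\<integral>\<^sup>+x\<in>I. u x \<partial>lborel) = (\<integral>\<^sup>+x. (\<Sum>Q\<in>children I. u x * indicator Q x) \<partial>lborel)"
    by (simp add: sum_distrib_left)
  also have "\<dots> = (\<Sum>Q\<in>children I. \<integral>\<^sup>+x\<in>Q. u x \<partial>lborel)"
    by (rule nn_integral_sum) measurable
  finally show ?thesis .
qed

text \<open>The cells of one level form a countable partition. Viewing \<open>u\<close> as the
  density of a measure turns the decomposition of its integral into countable additivity, so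
  infinite values do no harm.\<close>

lemma nn_integral_level_mono:
  assumes [measurable]: "u \<in> borel_measurable borel" "v \<in> borel_measurable borel"
    and le: "\<And>I. I \<in> grid_level D p \<Longrightarrow> (\<integral>\<^sup>+x\<in>I. u x \<partial>lborel) \<le> (\<integral>\<^sup>+x\<in>I. v x \<partial>lborel)"
  shows "(\<integral>\<^sup>+x. u x \<partial>lborel) \<le> (\<integral>\<^sup>+x. v x \<partial>lborel)"
proof -
  have *: "(\<integral>\<^sup>+x. u x \<partial>lborel) = (\<integral>\<^sup>+I. (\<integral>\<^sup>+x\<in>I. u x \<partial>lborel) \<partial>count_space (grid_level D p))"
    if [measurable]: "u \<in> borel_measurable borel" for u :: "real ^ 'n \<Rightarrow> ennreal"
  proof -
    let ?M = "density lborel u"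
    have "(\<Union>I\<in>grid_level D p. I) = UNIV"
      by (rule UNIV_eq_I[symmetric], rule UN_I[OF cell(1)], rule cell(2))
    moreover have "emeasure ?M (\<Union>I\<in>grid_level D p. I) = (\<integral>\<^sup>+I. emeasure ?M I \<partial>count_space (grid_level D p))"
      by (rule emeasure_UN_countable)
         (use level_unique[of _ p] level_subset[of _ p] countable_level[of p] in \<open>auto simp: disjoint_family_on_def\<close>)
    moreover have "emeasure ?M I = (\<integral>\<^sup>+x\<in>I. u x \<partial>lborel)" if "I \<in> grid_level D p" for I
      using borel_cell[OF level_subset[OF that]] by (subst emeasure_density) auto
    ultimately show ?thesis
      by (simp add: emeasure_density cong: nn_integral_cong_simp)
  qed
  show ?thesis unfolding *[OF assms(1)] *[OF assms(2)] by (rule nn_integral_mono) (use le in auto)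
qed

end

section \<open>Adapted square functions in one parameter\<close>

lemma L2_bounded_indicator:
  fixes h :: "'a::euclidean_space \<Rightarrow> complex"
  assumes [measurable]: "h \<in> borel_measurable borel" "A \<in> sets borel"
    and fin: "emeasure lborel A < \<infinity>" and bdd: "AE x in lborel. norm (h x) \<le> M"
  shows "(\<lambda>x. h x * indicator A x) \<in> L2"
    "(L2_norm (\<lambda>x. h x * indicator A x))\<^sup>2 \<le> M\<^sup>2 * measure lborel A"
proof -
  have le: "(\<integral>\<^sup>+x. ennreal ((norm (h x * indicator A x))\<^sup>2) \<partial>lborel) \<le> ennreal (M\<^sup>2 * measure lborel A)"
  proof -
    have "(\<integral>\<^sup>+x. ennreal ((norm (h x * indicator A x))\<^sup>2) \<partial>lborel)
      \<le> (\<integral>\<^sup>+x. ennreal (M\<^sup>2) * indicator A x \<partial>lborel)"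
      by (rule nn_integral_mono_AE, rule AE_mp[OF bdd])
         (auto simp: indicator_def intro!: ennreal_leI power_mono)
    also have "\<dots> = ennreal (M\<^sup>2 * measure lborel A)"
      using fin by (simp add: nn_integral_cmult emeasure_eq_ennreal_measure ennreal_mult)
    finally show ?thesis .
  qed
  show L2: "(\<lambda>x. h x * indicator A x) \<in> L2"
    by (intro L2_I le_less_trans[OF le]) auto
  show "(L2_norm (\<lambda>x. h x * indicator A x))\<^sup>2 \<le> M\<^sup>2 * measure lborel A"
    using le unfolding L2_nn_integral[OF L2] by (subst (asm) ennreal_le_iff) auto
qed

lemma bounded_set_integral:
  fixes h :: "'a::euclidean_space \<Rightarrow> complex"
  assumes [measurable]: "h \<in> borel_measurable borel" "A \<in> sets borel"
    and fin: "emeasure lborel A < \<infinity>" and bdd: "AE x in lborel. norm (h x) \<le> B"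
  shows "set_integrable lborel A h" "norm (LINT x:A|lborel. h x) \<le> B * measure lborel A"
proof -
  have i: "integrable lborel (\<lambda>x. B * indicator A x)" using fin by (simp add: less_top)
  have le: "AE x in lborel. norm (indicator A x *\<^sub>R h x) \<le> B * indicator A x"
    using bdd by eventually_elim (auto simp: indicator_def)
  show int: "set_integrable lborel A h"
    unfolding set_integrable_def
  proof (rule Bochner_Integration.integrable_bound[OF i])
    show "AE x in lborel. norm (indicator A x *\<^sub>R h x) \<le> norm (B * indicator A x)"
      using le by eventually_elim simp
  qed measurable
  have "norm (LINT x:A|lborel. h x) \<le> (LINT x|lborel. norm (indicator A x *\<^sub>R h x))"
    unfolding set_lebesgue_integral_def by (rule integral_norm_bound)
  also have "\<dots> \<le> (LINT x|lborel. B * indicator A x)"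
    by (rule integral_mono_AE[OF integrable_norm[OF int[unfolded set_integrable_def]] i le])
  also have "\<dots> = B * measure lborel A" by simp
  finally show "norm (LINT x:A|lborel. h x) \<le> B * measure lborel A" .
qed

lemma L2_indicator:
  assumes "f \<in> L2" and [measurable]: "A \<in> sets borel"
  shows "(\<lambda>x. f x * indicator A x) \<in> L2"
proof -
  have [measurable]: "f \<in> borel_measurable borel" using assms by (rule_tac L2_measurable)
  have "integrable lborel (\<lambda>x. (norm (f x * indicator A x))\<^sup>2)"
    by (rule Bochner_Integration.integrable_bound[OF L2_integrable_square[OF assms(1)]])
       (auto simp: indicator_def)
  then show ?thesis by (simp add: L2_def)
qed

lemma L2_norm_indicator:
  assumes "f \<in> L2" and [measurable]: "A \<in> sets borel"
  shows "ennreal ((L2_norm (\<lambda>x. f x * indicator A x))\<^sup>2) = (\<integral>\<^sup>+x\<in>A. ennreal ((norm (f x))\<^sup>2) \<partial>lborel)"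
  unfolding L2_nn_integral[OF L2_indicator[OF assms], symmetric]
  by (intro nn_integral_cong) (auto simp: indicator_def)

text \<open>Pointwise Bellman inequality: the right-hand side is the increment of
  \<open>|F \<beta>|\<^sup>2 + 6 M\<^sup>2 |F|\<^sup>2\<close> minus its part linear in \<open>(F' - F, \<beta>' - \<beta>)\<close>, which averages out over
  the children of a cube.\<close>

lemma quotient_Bellman_step:
  fixes F F' \<beta> \<beta>' :: complex
  assumes c: "0 < c" "c \<le> norm \<beta>" "c \<le> norm \<beta>'" and M: "norm \<beta> \<le> M" "norm \<beta>' \<le> M"
  shows "(norm (F' / \<beta>' - F / \<beta>))\<^sup>2 \<le> 8 / c ^ 4 *
    (((norm (F' * \<beta>'))\<^sup>2 + 6 * M\<^sup>2 * (norm F')\<^sup>2) - ((norm (F * \<beta>))\<^sup>2 + 6 * M\<^sup>2 * (norm F)\<^sup>2)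
      - 2 * Re (cnj (F * \<beta>) * (F * (\<beta>' - \<beta>) + \<beta> * (F' - F))) - 12 * M\<^sup>2 * Re (cnj F * (F' - F)))"
proof -
  \<comment> \<open>\<open>q\<close> is the increment of the product \<open>z = F * \<beta>\<close>.
    Of the cross term \<open>cnj z * q\<close> only the part with \<open>e * d\<close> is quadratic
    in the increments; the rest is the linear part that the inequality subtracts.\<close>
  define d e z q where "d = F' - F" and "e = \<beta>' - \<beta>" and "z = F * \<beta>" and "q = F * e + \<beta>' * d"
  have sq: "(norm (u + v))\<^sup>2 = (norm u)\<^sup>2 + 2 * Re (cnj u * v) + (norm v)\<^sup>2" for u v :: complex
    by (simp add: cmod_power2) (simp add: power2_eq_square algebra_simps)
  have zq: "F' * \<beta>' = z + q" and F': "F' = F + d" by (auto simp: z_def q_def d_def e_def algebra_simps)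
  have qq: "q = (F * e + \<beta> * d) + e * d" by (simp add: q_def e_def algebra_simps)
  have bracket: "((norm (F' * \<beta>'))\<^sup>2 + 6 * M\<^sup>2 * (norm F')\<^sup>2) - ((norm (F * \<beta>))\<^sup>2 + 6 * M\<^sup>2 * (norm F)\<^sup>2)
      - 2 * Re (cnj (F * \<beta>) * (F * (\<beta>' - \<beta>) + \<beta> * (F' - F))) - 12 * M\<^sup>2 * Re (cnj F * (F' - F))
     = 2 * Re (cnj z * (e * d)) + (norm q)\<^sup>2 + 6 * M\<^sup>2 * (norm d)\<^sup>2"
  proof -
    have "(norm (F' * \<beta>'))\<^sup>2 = (norm z)\<^sup>2 + 2 * Re (cnj z * (F * e + \<beta> * d)) + 2 * Re (cnj z * (e * d)) + (norm q)\<^sup>2"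
    proof -
      have "Re (cnj z * q) = Re (cnj z * (F * e + \<beta> * d)) + Re (cnj z * (e * d))"
        by (simp only: qq distrib_left plus_complex.sel)
      then show ?thesis unfolding zq sq by linarith
    qed
    moreover have "(norm F')\<^sup>2 = (norm F)\<^sup>2 + 2 * Re (cnj F * d) + (norm d)\<^sup>2"
      unfolding F' sq ..
    ultimately show ?thesis
      unfolding z_def[symmetric] d_def[symmetric] e_def[symmetric] by (simp add: algebra_simps)
  qed
  define x y where "x = norm (F * e)" and "y = M * norm d"
  have M0: "M \<ge> 0" using M(1) norm_ge_zero order_trans by blast
  have "\<bar>Re (cnj z * (e * d))\<bar> \<le> norm \<beta> * (norm (F * e) * norm d)"
    using abs_Re_le_cmod[of "cnj z * (e * d)"] by (simp add: z_def norm_mult mult_ac)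
  also have "\<dots> \<le> M * (norm (F * e) * norm d)" using M by (intro mult_right_mono) auto
  finally have cross: "\<bar>Re (cnj z * (e * d))\<bar> \<le> x * y" by (simp add: x_def y_def mult_ac)
  have "x\<^sup>2 \<le> 2 * (norm q)\<^sup>2 + 2 * (norm (\<beta>' * d))\<^sup>2"
    using norm_add_square_le[of q "- (\<beta>' * d)"] by (simp add: q_def x_def)
  moreover have "(norm (\<beta>' * d))\<^sup>2 \<le> y\<^sup>2"
    unfolding y_def norm_mult using M by (intro power_mono mult_right_mono) auto
  ultimately have ql: "(norm q)\<^sup>2 \<ge> x\<^sup>2 / 2 - y\<^sup>2" by linarith
  \<comment> \<open>With these weights the lower bound becomes
    \<open>- x^2/4 - 4 y^2 + x^2/2 - y^2 + 6 y^2 = x^2/4 + y^2\<close>: the coefficient 6 of the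
    Bellman function leaves a positive remainder in both variables.\<close>
  have "x * y \<le> x\<^sup>2 / 8 + 2 * y\<^sup>2"
    using zero_le_power2[of "x / 2 - 2 * y"] by (simp add: power2_eq_square algebra_simps)
  with cross ql have br: "2 * Re (cnj z * (e * d)) + (norm q)\<^sup>2 + 6 * M\<^sup>2 * (norm d)\<^sup>2 \<ge> x\<^sup>2 / 4 + y\<^sup>2"
    unfolding y_def power_mult_distrib by linarith
  have nz: "\<beta> \<noteq> 0" "\<beta>' \<noteq> 0" using c by auto
  have "F' / \<beta>' - F / \<beta> = (\<beta> * d + - (F * e)) / (\<beta> * \<beta>')"
    using nz by (simp add: d_def e_def field_simps)
  then have "(norm (F' / \<beta>' - F / \<beta>))\<^sup>2 = (norm (\<beta> * d + - (F * e)))\<^sup>2 / (norm \<beta> * norm \<beta>')\<^sup>2"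
    by (simp add: norm_divide norm_mult power_divide)
  also have "\<dots> \<le> (2 * y\<^sup>2 + 2 * x\<^sup>2) / c ^ 4"
  proof (intro frac_le)
    have "(norm (\<beta> * d + - (F * e)))\<^sup>2 \<le> 2 * (norm (\<beta> * d))\<^sup>2 + 2 * x\<^sup>2"
      using norm_add_square_le[of "\<beta> * d" "- (F * e)"] by (simp add: x_def)
    moreover have "(norm (\<beta> * d))\<^sup>2 \<le> y\<^sup>2"
      unfolding y_def norm_mult using M by (intro power_mono mult_right_mono) auto
    ultimately show "(norm (\<beta> * d + - (F * e)))\<^sup>2 \<le> 2 * y\<^sup>2 + 2 * x\<^sup>2" by linarith
    have "c * c \<le> norm \<beta> * norm \<beta>'" using c by (intro mult_mono) auto
    then have "(c * c)\<^sup>2 \<le> (norm \<beta> * norm \<beta>')\<^sup>2" using c by (intro power_mono) auto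
    then show "c ^ 4 \<le> (norm \<beta> * norm \<beta>')\<^sup>2" by (simp add: power2_eq_square power4_eq_xxxx mult_ac)
  qed (use c in auto)
  \<comment> \<open>\<open>2 * x^2\<close> is eight times \<open>x^2 / 4\<close>; this fixes the
    factor 8.\<close>
  also have "\<dots> \<le> 8 / c ^ 4 * (x\<^sup>2 / 4 + y\<^sup>2)" using c by (simp add: field_simps)
  also have "\<dots> \<le> 8 / c ^ 4 * (2 * Re (cnj z * (e * d)) + (norm q)\<^sup>2 + 6 * M\<^sup>2 * (norm d)\<^sup>2)"
    using c br by (intro mult_left_mono) auto
  finally show ?thesis unfolding bracket .
qed

text \<open>The weights are made for the duality argument: \<open>1 / (2 * A)\<close> times a square
  function bound with constant \<open>A\<close> costs one half of the quantity to be estimated, and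
  that half can be absorbed.\<close>

lemma weighted_Young:
  fixes A M m x y :: real
  assumes A: "0 < A" and m: "0 \<le> m"
  shows "x * y * (M * m) \<le> A * M\<^sup>2 / 2 * (m * x\<^sup>2) + 1 / (2 * A) * (m * y\<^sup>2)"
proof -
  have "0 \<le> m * ((A * M * x - y)\<^sup>2 / (2 * A))" using A m by simp
  also have "(A * M * x - y)\<^sup>2 / (2 * A) = A * M\<^sup>2 / 2 * x\<^sup>2 + 1 / (2 * A) * y\<^sup>2 - x * M * y"
    using A by (simp add: power2_eq_square divide_simps) (simp add: algebra_simps)
  finally show ?thesis by (simp add: algebra_simps)
qed

section \<open>Functions that are constant on cells\<close>

context grid
begin

text \<open>Any function of the cell is admissible, since a level has only countably many cells and
  each is a Borel set.\<close>

lemma cell_measurable: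
  "(\<lambda>x. g (cell p x)) \<in> borel_measurable borel"
proof (rule measurableI)
  fix A
  have "(\<lambda>x. g (cell p x)) -` A = (\<Union>I\<in>{I \<in> grid_level D p. g I \<in> A}. I)"
  proof (intro set_eqI iffI)
    fix x assume "x \<in> (\<lambda>x. g (cell p x)) -` A"
    then show "x \<in> (\<Union>I\<in>{I \<in> grid_level D p. g I \<in> A}. I)"
      using cell(1)[of p x] cell(2)[of x p] by (intro UN_I[of "cell p x"]) auto
  next
    fix x assume "x \<in> (\<Union>I\<in>{I \<in> grid_level D p. g I \<in> A}. I)"
    then obtain I where "I \<in> grid_level D p" "g I \<in> A" "x \<in> I" by blast
    then show "x \<in> (\<lambda>x. g (cell p x)) -` A" using cell_eq[of I p x] by simp
  qed
  moreover have "(\<Union>I\<in>{I \<in> grid_level D p. g I \<in> A}. I) \<in> sets borel"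
    using countable_level[of p] by (intro sets.countable_UN'') (auto intro: borel_cell level_subset)
  ultimately show "(\<lambda>x. g (cell p x)) -` A \<inter> space borel \<in> sets borel" by simp
qed simp

lemma nn_integral_cell_const:
  assumes "I \<in> grid_level D p"
  shows "(\<integral>\<^sup>+x\<in>I. g (cell p x) \<partial>lborel) = g I * emeasure lborel I"
proof -
  have "(\<integral>\<^sup>+x\<in>I. g (cell p x) \<partial>lborel) = (\<integral>\<^sup>+x. g I * indicator I x \<partial>lborel)"
    by (intro nn_integral_cong) (auto simp: indicator_def cell_eq[OF assms])
  then show ?thesis using borel_cell[OF level_subset[OF assms]] by (simp add: nn_integral_cmult)
qed

lemma nn_integral_cell_children:
  assumes "I \<in> D"
  shows "(\<integral>\<^sup>+x\<in>I. g (cell (level_of I + 1) x) \<partial>lborel) = (\<Sum>Q\<in>children I. g Q * emeasure lborel Q)"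
proof -
  have [measurable]: "(\<lambda>x. g (cell (level_of I + 1) x)) \<in> borel_measurable borel" by (rule cell_measurable)
  show ?thesis
    unfolding nn_integral_children[OF assms cell_measurable]
    by (intro sum.cong refl nn_integral_cell_const children_level)
qed

definition step_fun :: "(real ^ 'n) set \<Rightarrow> ((real ^ 'n) set \<Rightarrow> complex) \<Rightarrow> real ^ 'n \<Rightarrow> complex" where
  "step_fun I v x = (\<Sum>Q\<in>children I. v Q * indicator Q x)"

lemma step_fun_measurable: "step_fun I v \<in> borel_measurable borel"
proof -
  have [measurable]: "Q \<in> sets borel" if "Q \<in> children I" for Q
    using that by (intro borel_cell children_D)
  show ?thesis unfolding step_fun_def[abs_def] by measurable
qed

lemma nn_integral_step_fun:
  assumes "I \<in> D"
  shows "(\<integral>\<^sup>+x. ennreal ((norm (step_fun I v x))\<^sup>2) \<partial>lborel)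
    = ennreal (\<Sum>Q\<in>children I. measure lborel Q * (norm (v Q))\<^sup>2)"
proof -
  have "(\<integral>\<^sup>+x. ennreal ((norm (step_fun I v x))\<^sup>2) \<partial>lborel)
    = (\<integral>\<^sup>+x\<in>I. ennreal ((norm (v (cell (level_of I + 1) x)))\<^sup>2) \<partial>lborel)"
    unfolding step_fun_def sum_children_indicator[OF assms]
    by (intro nn_integral_cong) (auto simp: indicator_def)
  also have "\<dots> = (\<Sum>Q\<in>children I. ennreal ((norm (v Q))\<^sup>2) * emeasure lborel Q)"
    by (rule nn_integral_cell_children[OF assms])
  also have "\<dots> = (\<Sum>Q\<in>children I. ennreal (measure lborel Q * (norm (v Q))\<^sup>2))"
    by (intro sum.cong refl) (simp add: emeasure_cell_eq[OF children_D] ennreal_mult mult.commute)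
  finally show ?thesis by simp
qed

end

text \<open>The lower bound is non-strict and refers to the cells of \<open>D\<close>: in this form
  the constant function 1 qualifies with \<open>M = c = 1\<close>, so that the unweighted
  differences of the Hardy space are an instance.\<close>

locale accretive = grid D for D :: "(real ^ 'n) set set" +
  fixes b :: "real ^ 'n \<Rightarrow> complex" and M c :: real
  assumes b_measurable [measurable]: "b \<in> borel_measurable borel"
    and b_bounded: "AE x in lborel. norm (b x) \<le> M"
    and c_pos: "0 < c"
    and b_accretive: "\<And>I. I \<in> D \<Longrightarrow> c * measure lborel I \<le> norm (LINT y:I|lborel. b y)"
begin

abbreviation bint :: "(real ^ 'n) set \<Rightarrow> complex" where
  "bint I \<equiv> LINT y:I|lborel. b y"

abbreviation bmean :: "(real ^ 'n \<Rightarrow> complex) \<Rightarrow> (real ^ 'n) set \<Rightarrow> complex" where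
  "bmean f I \<equiv> (LINT y:I|lborel. f y * b y) / bint I"

lemma b_L2:
  assumes "I \<in> D"
  shows "(\<lambda>x. b x * indicator I x) \<in> L2"
    "(L2_norm (\<lambda>x. b x * indicator I x))\<^sup>2 \<le> M\<^sup>2 * measure lborel I"
  using L2_bounded_indicator[OF b_measurable borel_cell[OF assms] emeasure_cell(2)[OF assms] b_bounded]
  by auto

lemma b_set_integrable:
  assumes "I \<in> D" shows "set_integrable lborel I b"
  by (rule bounded_set_integral(1)[OF b_measurable borel_cell[OF assms] emeasure_cell(2)[OF assms] b_bounded])

lemma bint_le:
  assumes "I \<in> D" shows "norm (bint I) \<le> M * measure lborel I"
  by (rule bounded_set_integral(2)[OF b_measurable borel_cell[OF assms] emeasure_cell(2)[OF assms] b_bounded])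

lemma mult_b_set_integrable:
  assumes "I \<in> D" "f \<in> L2" shows "set_integrable lborel I (\<lambda>x. f x * b x)"
proof -
  have "integrable lborel (\<lambda>x. f x * (b x * indicator I x))"
    by (intro L2_mult_integrable b_L2 assms)
  also have "(\<lambda>x. f x * (b x * indicator I x)) = (\<lambda>x. indicator I x *\<^sub>R (f x * b x))"
    by (auto simp: indicator_def)
  finally show ?thesis unfolding set_integrable_def .
qed

lemma M_pos: "0 < M"
proof -
  obtain I where I: "I \<in> D" using cell_D by blast
  have "c * measure lborel I \<le> M * measure lborel I"
    using bint_le[OF I] b_accretive[OF I] by linarith
  then have "c \<le> M" using measure_cell_pos[OF I] by simp
  then show ?thesis using c_pos by linarith
qed

lemma bint_nonzero: "I \<in> D \<Longrightarrow> bint I \<noteq> 0"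
  using b_accretive[of I] measure_cell_pos[of I] c_pos by (smt (verit) mult_pos_pos norm_zero)

lemma norm_mult_b_integral_le:
  assumes "I \<in> D" "f \<in> L2"
  shows "ennreal ((norm (LINT y:I|lborel. f y * b y))\<^sup>2)
    \<le> ennreal (M\<^sup>2 * measure lborel I) * (\<integral>\<^sup>+x\<in>I. ennreal ((norm (f x))\<^sup>2) \<partial>lborel)"
proof -
  let ?f = "\<lambda>x. f x * indicator I x" and ?b = "\<lambda>x. b x * indicator I x"
  have f: "?f \<in> L2" by (rule L2_indicator[OF assms(2) borel_cell[OF assms(1)]])
  have "(LINT y:I|lborel. f y * b y) = (LINT x|lborel. ?f x * ?b x)"
    unfolding set_lebesgue_integral_def by (intro Bochner_Integration.integral_cong) (auto simp: indicator_def)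
  then have "norm (LINT y:I|lborel. f y * b y) \<le> L2_norm ?f * L2_norm ?b"
    using L2_Cauchy_Schwarz_norm[OF f b_L2(1)[OF assms(1)]] by simp
  then have "(norm (LINT y:I|lborel. f y * b y))\<^sup>2 \<le> (L2_norm ?f * L2_norm ?b)\<^sup>2"
    by (intro power_mono) auto
  also have "\<dots> = (L2_norm ?b)\<^sup>2 * (L2_norm ?f)\<^sup>2" by (simp add: power_mult_distrib)
  also have "\<dots> \<le> (M\<^sup>2 * measure lborel I) * (L2_norm ?f)\<^sup>2"
    by (intro mult_right_mono b_L2 assms) auto
  finally have "ennreal ((norm (LINT y:I|lborel. f y * b y))\<^sup>2) \<le> ennreal ((M\<^sup>2 * measure lborel I) * (L2_norm ?f)\<^sup>2)"
    by (rule ennreal_leI)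
  then show ?thesis
    by (simp add: ennreal_mult L2_norm_indicator[OF assms(2) borel_cell[OF assms(1)]])
qed

text \<open>The Bellman function \<open>|F \<beta>|^2 + 6 M^2 |F|^2\<close> of two martingales of
  plain averages, \<open>F\<close> of \<open>f b\<close> and \<open>\<beta>\<close> of
  \<open>b\<close>.\<close>

definition energy :: "(real ^ 'n \<Rightarrow> complex) \<Rightarrow> (real ^ 'n) set \<Rightarrow> real" where
  "energy f I = (norm ((LINT y:I|lborel. f y * b y) / measure lborel I * (bint I / measure lborel I)))\<^sup>2
     + 6 * M\<^sup>2 * (norm ((LINT y:I|lborel. f y * b y) / measure lborel I))\<^sup>2"

lemma energy_nonneg: "0 \<le> energy f I"
  by (simp add: energy_def)

text \<open>The Bellman inequality at each child, weighted by its measure. \<open>F\<close> and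
  \<open>\<beta>\<close> over \<open>I\<close> are the averages of their values over the children,
  so the linear part sums to zero and the gain of energy remains.\<close>

lemma energy_children:
  assumes I: "I \<in> D" and f: "f \<in> L2"
  shows "(\<Sum>Q\<in>children I. measure lborel Q * (norm (bmean f Q - bmean f I))\<^sup>2)
    \<le> 8 / c ^ 4 * ((\<Sum>Q\<in>children I. measure lborel Q * energy f Q) - measure lborel I * energy f I)"
proof -
  define \<mu> where "\<mu> Q = measure lborel Q" for Q :: "(real ^ 'n) set"
  define F where "F Q = (LINT y:Q|lborel. f y * b y) / \<mu> Q" for Q
  define \<beta> where "\<beta> Q = bint Q / \<mu> Q" for Q
  let ?ch = "children I"
  have pos: "\<mu> Q > 0" if "Q \<in> D" for Q using measure_cell_pos[OF that] by (simp add: \<mu>_def)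
  have mean: "bmean f Q = F Q / \<beta> Q" if "Q \<in> D" for Q
    using pos[OF that] by (simp add: F_def \<beta>_def)
  have en: "energy f Q = (norm (F Q * \<beta> Q))\<^sup>2 + 6 * M\<^sup>2 * (norm (F Q))\<^sup>2" for Q
    by (simp add: energy_def F_def \<beta>_def \<mu>_def)
  have \<beta>c: "c \<le> norm (\<beta> Q)" "norm (\<beta> Q) \<le> M" if "Q \<in> D" for Q
    using b_accretive[OF that] bint_le[OF that] pos[OF that]
    by (auto simp: \<beta>_def \<mu>_def norm_divide field_simps)
  have \<mu>I: "(\<Sum>Q\<in>?ch. \<mu> Q) = \<mu> I" unfolding \<mu>_def by (rule measure_children[OF I, symmetric])
  have sumF: "(\<Sum>Q\<in>?ch. \<mu> Q * (F Q - F I)) = 0"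
  proof -
    have "(\<Sum>Q\<in>?ch. \<mu> Q * (F Q - F I)) = (\<Sum>Q\<in>?ch. LINT y:Q|lborel. f y * b y) - (\<Sum>Q\<in>?ch. complex_of_real (\<mu> Q)) * F I"
      unfolding sum_distrib_right sum_subtractf[symmetric]
      by (intro sum.cong refl) (use pos[OF children_D] in \<open>force simp: F_def algebra_simps\<close>)
    also have "\<dots> = 0"
      using set_integral_children[OF I mult_b_set_integrable[OF I f]] \<mu>I pos[OF I]
      by (simp add: F_def flip: of_real_sum)
    finally show ?thesis .
  qed
  have sum\<beta>: "(\<Sum>Q\<in>?ch. \<mu> Q * (\<beta> Q - \<beta> I)) = 0"
  proof -
    have "(\<Sum>Q\<in>?ch. \<mu> Q * (\<beta> Q - \<beta> I)) = (\<Sum>Q\<in>?ch. bint Q) - (\<Sum>Q\<in>?ch. complex_of_real (\<mu> Q)) * \<beta> I"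
      unfolding sum_distrib_right sum_subtractf[symmetric]
      by (intro sum.cong refl) (use pos[OF children_D] in \<open>force simp: \<beta>_def algebra_simps\<close>)
    also have "\<dots> = 0"
      using set_integral_children[OF I b_set_integrable[OF I]] \<mu>I pos[OF I]
      by (simp add: \<beta>_def flip: of_real_sum)
    finally show ?thesis .
  qed
  \<comment> \<open>Real-linear in the increments of \<open>F\<close> and \<open>\<beta>\<close>, so
    that \<open>sumF\<close> and \<open>sum\<beta>\<close> annihilate its weighted sum.\<close>
  define lin where "lin Q = 2 * Re (cnj (F I * \<beta> I) * (F I * (\<beta> Q - \<beta> I) + \<beta> I * (F Q - F I)))
      + 12 * M\<^sup>2 * Re (cnj (F I) * (F Q - F I))" for Q
  have lin0: "(\<Sum>Q\<in>?ch. \<mu> Q * lin Q) = 0"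
  proof -
    have "(\<Sum>Q\<in>?ch. \<mu> Q * lin Q) = Re (2 * (cnj (F I * \<beta> I) * (F I * (\<Sum>Q\<in>?ch. \<mu> Q * (\<beta> Q - \<beta> I)) + \<beta> I * (\<Sum>Q\<in>?ch. \<mu> Q * (F Q - F I))))
      + complex_of_real (12 * M\<^sup>2) * (cnj (F I) * (\<Sum>Q\<in>?ch. \<mu> Q * (F Q - F I))))"
      unfolding sum_distrib_left sum.distrib[symmetric] Re_sum
      by (intro sum.cong refl) (simp add: lin_def algebra_simps)
    then show ?thesis unfolding sumF sum\<beta> by simp
  qed
  have "(\<Sum>Q\<in>?ch. \<mu> Q * (norm (bmean f Q - bmean f I))\<^sup>2)
     \<le> (\<Sum>Q\<in>?ch. \<mu> Q * (8 / c ^ 4 * (energy f Q - energy f I - lin Q)))"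
  proof (intro sum_mono mult_left_mono)
    fix Q assume Q: "Q \<in> ?ch"
    note QD = children_D[OF Q]
    show "(norm (bmean f Q - bmean f I))\<^sup>2 \<le> 8 / c ^ 4 * (energy f Q - energy f I - lin Q)"
      using quotient_Bellman_step[OF c_pos \<beta>c(1)[OF I] \<beta>c(1)[OF QD] \<beta>c(2)[OF I] \<beta>c(2)[OF QD], of "F Q" "F I"]
      unfolding mean[OF QD] mean[OF I] en lin_def by (simp add: algebra_simps)
  qed (simp add: \<mu>_def)
  also have "\<dots> = 8 / c ^ 4 * ((\<Sum>Q\<in>?ch. \<mu> Q * energy f Q) - (\<Sum>Q\<in>?ch. \<mu> Q) * energy f I - (\<Sum>Q\<in>?ch. \<mu> Q * lin Q))"
    unfolding sum_distrib_right sum_subtractf[symmetric] sum_distrib_left[of "8 / c ^ 4"]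
    by (intro sum.cong refl) (simp only: right_diff_distrib left_diff_distrib mult.assoc mult.left_commute mult.commute)
  finally show ?thesis unfolding lin0 \<mu>I by (simp add: \<mu>_def)
qed

section \<open>Square function bound by telescoping the energy over levels\<close>

lemma diff_cube_step: "I \<in> D \<Longrightarrow> diff_cube D b I f = step_fun I (\<lambda>Q. bmean f Q - bmean f I)"
  by (intro ext) (simp add: diff_cube_eq step_fun_def)

lemma diff_op_eq: "diff_op D b p f x = bmean f (cell (p + 1) x) - bmean f (cell p x)"
  by (simp add: diff_op_def expect_op_eq)

lemma diff_op_measurable: "diff_op D b p f \<in> borel_measurable borel"
proof -
  have "(\<lambda>x. bmean f (cell (p + 1) x) - bmean f (cell p x)) \<in> borel_measurable borel"
    by (intro borel_measurable_diff cell_measurable)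
  then show ?thesis by (simp add: diff_op_eq[abs_def])
qed

text \<open>\<open>energy_children\<close> summed over the partition into cells of level
  \<open>p\<close>. The old energy stands on the left instead of being subtracted, since values in
  \<open>ennreal\<close> may be infinite; in this form the steps telescope by addition.\<close>

lemma nn_integral_diff_op_step:
  assumes f: "f \<in> L2"
  shows "(\<integral>\<^sup>+x. ennreal ((norm (diff_op D b p f x))\<^sup>2) \<partial>lborel)
      + (\<integral>\<^sup>+x. ennreal (8 / c ^ 4 * energy f (cell p x)) \<partial>lborel)
    \<le> (\<integral>\<^sup>+x. ennreal (8 / c ^ 4 * energy f (cell (p + 1) x)) \<partial>lborel)"
proof -
  have [measurable]: "diff_op D b p f \<in> borel_measurable borel" by (rule diff_op_measurable)
  have en_meas [measurable]: "(\<lambda>x. ennreal (8 / c ^ 4 * energy f (cell q x))) \<in> borel_measurable borel" for q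
    by (rule cell_measurable)
  have K: "0 \<le> 8 / c ^ 4" using c_pos by simp
  have "(\<integral>\<^sup>+x. ennreal ((norm (diff_op D b p f x))\<^sup>2) + ennreal (8 / c ^ 4 * energy f (cell p x)) \<partial>lborel)
    \<le> (\<integral>\<^sup>+x. ennreal (8 / c ^ 4 * energy f (cell (p + 1) x)) \<partial>lborel)"
  proof (rule nn_integral_level_mono[where p = p])
    fix I assume Ip: "I \<in> grid_level D p"
    then have I: "I \<in> D" and lev: "level_of I = p" by (auto intro: level_subset level_of_eq)
    note [measurable] = borel_cell[OF I]
    have "(\<integral>\<^sup>+x\<in>I. (ennreal ((norm (diff_op D b p f x))\<^sup>2) + ennreal (8 / c ^ 4 * energy f (cell p x))) \<partial>lborel)
      = (\<integral>\<^sup>+x\<in>I. ennreal ((norm (diff_op D b p f x))\<^sup>2) \<partial>lborel) + (\<integral>\<^sup>+x\<in>I. ennreal (8 / c ^ 4 * energy f (cell p x)) \<partial>lborel)"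
      unfolding distrib_right by (rule nn_integral_add; measurable)
    also have "(\<integral>\<^sup>+x\<in>I. ennreal ((norm (diff_op D b p f x))\<^sup>2) \<partial>lborel)
        = (\<integral>\<^sup>+x\<in>I. ennreal ((norm (bmean f (cell (level_of I + 1) x) - bmean f I))\<^sup>2) \<partial>lborel)"
      by (intro nn_integral_cong) (auto simp: diff_op_eq lev indicator_def cell_eq[OF Ip])
    also have "\<dots> = (\<Sum>Q\<in>children I. ennreal ((norm (bmean f Q - bmean f I))\<^sup>2) * emeasure lborel Q)"
      by (rule nn_integral_cell_children[OF I])
    also have "\<dots> = ennreal (\<Sum>Q\<in>children I. measure lborel Q * (norm (bmean f Q - bmean f I))\<^sup>2)"
      by (subst sum_ennreal[symmetric], simp, intro sum.cong refl)
         (simp add: emeasure_cell_eq[OF children_D] ennreal_mult mult.commute)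
    also have "(\<integral>\<^sup>+x\<in>I. ennreal (8 / c ^ 4 * energy f (cell p x)) \<partial>lborel) = ennreal (8 / c ^ 4 * (measure lborel I * energy f I))"
      unfolding nn_integral_cell_const[OF Ip, of "\<lambda>J. ennreal (8 / c ^ 4 * energy f J)"] emeasure_cell_eq[OF I]
      using K energy_nonneg by (subst ennreal_mult[symmetric]) (auto simp: mult_ac)
    also have "ennreal (\<Sum>Q\<in>children I. measure lborel Q * (norm (bmean f Q - bmean f I))\<^sup>2) + ennreal (8 / c ^ 4 * (measure lborel I * energy f I))
       \<le> ennreal (8 / c ^ 4 * (\<Sum>Q\<in>children I. measure lborel Q * energy f Q))"
    proof -
      have "(\<Sum>Q\<in>children I. measure lborel Q * (norm (bmean f Q - bmean f I))\<^sup>2) + 8 / c ^ 4 * (measure lborel I * energy f I)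
        \<le> 8 / c ^ 4 * (\<Sum>Q\<in>children I. measure lborel Q * energy f Q)"
        using energy_children[OF I f] by (simp add: algebra_simps)
      moreover have "0 \<le> 8 / c ^ 4 * (measure lborel I * energy f I)"
        using K energy_nonneg by simp
      ultimately show ?thesis
        by (subst ennreal_plus[symmetric]) (auto intro!: ennreal_leI sum_nonneg)
    qed
    also have "\<dots> = (\<Sum>Q\<in>children I. ennreal (8 / c ^ 4 * energy f Q) * emeasure lborel Q)"
      unfolding sum_distrib_left using K energy_nonneg
      by (subst sum_ennreal[symmetric], simp, intro sum.cong refl)
         (simp add: emeasure_cell_eq[OF children_D] ennreal_mult[symmetric] mult_ac)
    also have "\<dots> = (\<integral>\<^sup>+x\<in>I. ennreal (8 / c ^ 4 * energy f (cell (p + 1) x)) \<partial>lborel)"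
      unfolding lev[symmetric] by (rule nn_integral_cell_children[OF I, symmetric])
    finally show "(\<integral>\<^sup>+x\<in>I. (ennreal ((norm (diff_op D b p f x))\<^sup>2) + ennreal (8 / c ^ 4 * energy f (cell p x))) \<partial>lborel)
      \<le> (\<integral>\<^sup>+x\<in>I. ennreal (8 / c ^ 4 * energy f (cell (p + 1) x)) \<partial>lborel)" .
  qed measurable
  moreover have "(\<integral>\<^sup>+x. ennreal ((norm (diff_op D b p f x))\<^sup>2) + ennreal (8 / c ^ 4 * energy f (cell p x)) \<partial>lborel)
    = (\<integral>\<^sup>+x. ennreal ((norm (diff_op D b p f x))\<^sup>2) \<partial>lborel) + (\<integral>\<^sup>+x. ennreal (8 / c ^ 4 * energy f (cell p x)) \<partial>lborel)"
    by (rule nn_integral_add; measurable)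
  ultimately show ?thesis by (simp only:)
qed

text \<open>Cauchy--Schwarz gives \<open>|F|^2\<close> at most \<open>M^2\<close> times the mean of
  \<open>|f|^2\<close>, whatever the level. Another \<open>M^2\<close> comes from the energy itself,
  and \<open>c^4\<close> from the Bellman inequality.\<close>

lemma nn_integral_energy_le:
  assumes f: "f \<in> L2"
  shows "(\<integral>\<^sup>+x. ennreal (8 / c ^ 4 * energy f (cell p x)) \<partial>lborel)
    \<le> ennreal (56 * (M / c) ^ 4) * (\<integral>\<^sup>+x. ennreal ((norm (f x))\<^sup>2) \<partial>lborel)"
proof -
  have [measurable]: "f \<in> borel_measurable borel" by (rule L2_measurable[OF f])
  have en_meas [measurable]: "(\<lambda>x. ennreal (8 / c ^ 4 * energy f (cell q x))) \<in> borel_measurable borel" for q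
    by (rule cell_measurable)
  have K: "0 \<le> 8 / c ^ 4" using c_pos by simp
  have "(\<integral>\<^sup>+x. ennreal (8 / c ^ 4 * energy f (cell p x)) \<partial>lborel)
    \<le> (\<integral>\<^sup>+x. ennreal (56 * (M / c) ^ 4) * ennreal ((norm (f x))\<^sup>2) \<partial>lborel)"
  proof (rule nn_integral_level_mono[where p = p])
    fix I assume Ip: "I \<in> grid_level D p"
    then have I: "I \<in> D" by (rule level_subset)
    note [measurable] = borel_cell[OF I]
    define \<mu> where "\<mu> = measure lborel I"
    have \<mu>: "\<mu> > 0" using measure_cell_pos[OF I] by (simp add: \<mu>_def)
    define G where "G = (LINT y:I|lborel. f y * b y)"
    have "norm (bint I / \<mu>) \<le> M" using bint_le[OF I] \<mu> by (simp add: \<mu>_def norm_divide field_simps)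
    then have "(norm (G / \<mu> * (bint I / \<mu>)))\<^sup>2 \<le> (norm (G / \<mu>) * M)\<^sup>2"
      unfolding norm_mult by (intro power_mono mult_left_mono) auto
    \<comment> \<open>7 = 1 + 6 counts the two terms of the energy; times the Bellman factor 8 it
      gives 56.\<close>
    moreover have "X + 6 * m * n \<le> 7 * m * n" if "X \<le> n * m" for X m n :: real
      using that by (simp add: algebra_simps)
    ultimately have "energy f I \<le> 7 * M\<^sup>2 * (norm (G / \<mu>))\<^sup>2"
      unfolding energy_def G_def[symmetric] \<mu>_def[symmetric] power_mult_distrib[of "norm _" M] by blast
    also have "\<dots> = 7 * M\<^sup>2 / \<mu>\<^sup>2 * (norm G)\<^sup>2" using \<mu> by (simp add: norm_divide power_divide)
    finally have en: "energy f I \<le> 7 * M\<^sup>2 / \<mu>\<^sup>2 * (norm G)\<^sup>2" .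
    have "(\<integral>\<^sup>+x\<in>I. ennreal (8 / c ^ 4 * energy f (cell p x)) \<partial>lborel) = ennreal (8 / c ^ 4 * energy f I * \<mu>)"
      unfolding nn_integral_cell_const[OF Ip, of "\<lambda>J. ennreal (8 / c ^ 4 * energy f J)"]
        emeasure_cell_eq[OF I] \<mu>_def[symmetric]
      using K energy_nonneg \<mu> by (subst ennreal_mult[symmetric]) auto
    also have "\<dots> \<le> ennreal (8 / c ^ 4 * (7 * M\<^sup>2 / \<mu>\<^sup>2 * (norm G)\<^sup>2) * \<mu>)"
      using K \<mu> en by (intro ennreal_leI mult_right_mono mult_left_mono) auto
    also have "8 / c ^ 4 * (7 * M\<^sup>2 / \<mu>\<^sup>2 * (norm G)\<^sup>2) * \<mu> = (56 * M\<^sup>2 / (c ^ 4 * \<mu>)) * (norm G)\<^sup>2"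
      using \<mu> c_pos by (simp add: field_simps power2_eq_square)
    also have "ennreal ((56 * M\<^sup>2 / (c ^ 4 * \<mu>)) * (norm G)\<^sup>2) = ennreal (56 * M\<^sup>2 / (c ^ 4 * \<mu>)) * ennreal ((norm G)\<^sup>2)"
      using \<mu> c_pos by (intro ennreal_mult) auto
    also have "\<dots> \<le> ennreal (56 * M\<^sup>2 / (c ^ 4 * \<mu>)) * (ennreal (M\<^sup>2 * \<mu>) * (\<integral>\<^sup>+x\<in>I. ennreal ((norm (f x))\<^sup>2) \<partial>lborel))"
      unfolding G_def \<mu>_def by (intro mult_left_mono norm_mult_b_integral_le I f) auto
    also have "\<dots> = ennreal (56 * M\<^sup>2 / (c ^ 4 * \<mu>) * (M\<^sup>2 * \<mu>)) * (\<integral>\<^sup>+x\<in>I. ennreal ((norm (f x))\<^sup>2) \<partial>lborel)"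
      using \<mu> c_pos by (subst ennreal_mult) (auto simp: mult.assoc)
    also have "56 * M\<^sup>2 / (c ^ 4 * \<mu>) * (M\<^sup>2 * \<mu>) = 56 * (M / c) ^ 4"
      using \<mu> c_pos by (simp add: power_divide power2_eq_square power4_eq_xxxx)
    also have "ennreal (56 * (M / c) ^ 4) * (\<integral>\<^sup>+x\<in>I. ennreal ((norm (f x))\<^sup>2) \<partial>lborel)
      = (\<integral>\<^sup>+x\<in>I. (ennreal (56 * (M / c) ^ 4) * ennreal ((norm (f x))\<^sup>2)) \<partial>lborel)"
      by (subst nn_integral_cmult[symmetric]) (auto simp: mult.assoc)
    finally show "(\<integral>\<^sup>+x\<in>I. ennreal (8 / c ^ 4 * energy f (cell p x)) \<partial>lborel)
      \<le> (\<integral>\<^sup>+x\<in>I. (ennreal (56 * (M / c) ^ 4) * ennreal ((norm (f x))\<^sup>2)) \<partial>lborel)" .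
  qed measurable
  also have "\<dots> = ennreal (56 * (M / c) ^ 4) * (\<integral>\<^sup>+x. ennreal ((norm (f x))\<^sup>2) \<partial>lborel)"
    by (rule nn_integral_cmult) measurable
  finally show ?thesis .
qed

lemma nn_integral_diff_op_levels:
  assumes f: "f \<in> L2"
  shows "(\<Sum>i<N. \<integral>\<^sup>+x. ennreal ((norm (diff_op D b (p + int i) f x))\<^sup>2) \<partial>lborel)
    \<le> ennreal (56 * (M / c) ^ 4) * (\<integral>\<^sup>+x. ennreal ((norm (f x))\<^sup>2) \<partial>lborel)"
proof -
  let ?e = "\<lambda>q. \<integral>\<^sup>+x. ennreal (8 / c ^ 4 * energy f (cell q x)) \<partial>lborel"
  let ?d = "\<lambda>q. \<integral>\<^sup>+x. ennreal ((norm (diff_op D b q f x))\<^sup>2) \<partial>lborel"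
  have "(\<Sum>i<N. ?d (p + int i)) + ?e p \<le> ?e (p + int N)"
  proof (induction N)
    case (Suc N)
    have "(\<Sum>i<Suc N. ?d (p + int i)) + ?e p = ?d (p + int N) + ((\<Sum>i<N. ?d (p + int i)) + ?e p)"
      by (simp add: ac_simps)
    also have "\<dots> \<le> ?d (p + int N) + ?e (p + int N)" by (intro add_left_mono Suc.IH)
    also have "\<dots> \<le> ?e (p + int N + 1)" by (rule nn_integral_diff_op_step[OF f])
    finally show ?case by (simp add: ac_simps)
  qed simp
  then have "(\<Sum>i<N. ?d (p + int i)) \<le> ?e (p + int N)"
    by (rule order_trans[rotated]) simp
  also have "\<dots> \<le> ennreal (56 * (M / c) ^ 4) * (\<integral>\<^sup>+x. ennreal ((norm (f x))\<^sup>2) \<partial>lborel)"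
    by (rule nn_integral_energy_le[OF f])
  finally show ?thesis .
qed

theorem square_function_bound:
  assumes F: "finite F" "F \<subseteq> D" and [measurable]: "f \<in> borel_measurable borel"
  shows "(\<Sum>I\<in>F. \<integral>\<^sup>+x. ennreal ((norm (diff_cube D b I f x))\<^sup>2) \<partial>lborel)
    \<le> ennreal (56 * (M / c) ^ 4) * (\<integral>\<^sup>+x. ennreal ((norm (f x))\<^sup>2) \<partial>lborel)"
proof (cases "f \<in> L2")
  case False
  then have "(\<integral>\<^sup>+x. ennreal ((norm (f x))\<^sup>2) \<partial>lborel) = \<infinity>"
    by (auto simp: L2_iff not_less top_unique)
  \<comment> \<open>Strict positivity matters: \<open>0 * \<infinity>\<close> is 0 in
    \<open>ennreal\<close>.\<close>
  moreover have "56 * (M / c) ^ 4 > 0" using M_pos c_pos by simp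
  ultimately show ?thesis by (simp add: ennreal_mult_top)
next
  case True
  obtain p N where lev: "level_of ` F \<subseteq> (\<lambda>i. p + int i) ` {..<N}"
  proof (cases "F = {}")
    case False
    define p q where "p = Min (level_of ` F)" and "q = Max (level_of ` F)"
    have "p \<le> l \<and> l \<le> q" if "l \<in> level_of ` F" for l using F that by (auto simp: p_def q_def)
    have "level_of ` F \<subseteq> (\<lambda>i. p + int i) ` {..<nat (q - p) + 1}"
    proof
      fix l assume "l \<in> level_of ` F"
      then have "p \<le> l" "l \<le> q" using \<open>\<And>l. l \<in> level_of ` F \<Longrightarrow> p \<le> l \<and> l \<le> q\<close> by auto
      then show "l \<in> (\<lambda>i. p + int i) ` {..<nat (q - p) + 1}"
        by (intro image_eqI[of _ _ "nat (l - p)"]) auto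
    qed
    then show ?thesis by (rule that)
  qed (use that in auto)
  have diff_meas [measurable]: "diff_op D b q f \<in> borel_measurable borel" for q by (rule diff_op_measurable)
  have [measurable]: "diff_cube D b I f \<in> borel_measurable borel" if "I \<in> F" for I
    unfolding diff_cube_step[OF subsetD[OF F(2) that]] by (rule step_fun_measurable)
  have pt: "(\<Sum>I\<in>F. (norm (diff_cube D b I f x))\<^sup>2) \<le> (\<Sum>i<N. (norm (diff_op D b (p + int i) f x))\<^sup>2)" for x
  proof -
    have inj: "inj_on level_of {I\<in>F. x \<in> I}"
    proof (rule inj_onI)
      fix I J assume *: "I \<in> {I\<in>F. x \<in> I}" "J \<in> {I\<in>F. x \<in> I}" "level_of I = level_of J"
      then have "I \<in> D" "J \<in> D" using F by auto
      from level_unique[OF in_level_of[OF this(1)] in_level_of[OF this(2), folded *(3)]] * show "I = J" by auto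
    qed
    have "(\<Sum>I\<in>F. (norm (diff_cube D b I f x))\<^sup>2) = (\<Sum>I\<in>{I\<in>F. x \<in> I}. (norm (diff_op D b (level_of I) f x))\<^sup>2)"
      using F by (intro sum.mono_neutral_cong_right) (auto simp: diff_cube_def)
    also have "\<dots> = (\<Sum>q\<in>level_of ` {I\<in>F. x \<in> I}. (norm (diff_op D b q f x))\<^sup>2)"
      by (simp add: sum.reindex[OF inj])
    also have "\<dots> \<le> (\<Sum>q\<in>(\<lambda>i. p + int i) ` {..<N}. (norm (diff_op D b q f x))\<^sup>2)"
      using lev by (intro sum_mono2) auto
    also have "\<dots> = (\<Sum>i<N. (norm (diff_op D b (p + int i) f x))\<^sup>2)"
      by (subst sum.reindex) (auto simp: inj_on_def)
    finally show ?thesis .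
  qed
  have "(\<Sum>I\<in>F. \<integral>\<^sup>+x. ennreal ((norm (diff_cube D b I f x))\<^sup>2) \<partial>lborel)
    = (\<integral>\<^sup>+x. (\<Sum>I\<in>F. ennreal ((norm (diff_cube D b I f x))\<^sup>2)) \<partial>lborel)"
    by (rule nn_integral_sum[symmetric]) measurable
  also have "\<dots> \<le> (\<integral>\<^sup>+x. (\<Sum>i<N. ennreal ((norm (diff_op D b (p + int i) f x))\<^sup>2)) \<partial>lborel)"
    by (intro nn_integral_mono) (simp add: pt ennreal_leI)
  also have "\<dots> = (\<Sum>i<N. \<integral>\<^sup>+x. ennreal ((norm (diff_op D b (p + int i) f x))\<^sup>2) \<partial>lborel)"
    by (rule nn_integral_sum) measurable
  also have "\<dots> \<le> ennreal (56 * (M / c) ^ 4) * (\<integral>\<^sup>+x. ennreal ((norm (f x))\<^sup>2) \<partial>lborel)"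
    by (rule nn_integral_diff_op_levels[OF True])
  finally show ?thesis .
qed

text \<open>The integral of \<open>b * step_fun I v\<close>, written as a finite sum over children:
  plain mean zero after multiplication by \<open>b\<close>.\<close>

definition cancelling :: "(real ^ 'n) set \<Rightarrow> ((real ^ 'n) set \<Rightarrow> complex) \<Rightarrow> bool" where
  "cancelling I v \<longleftrightarrow> (\<Sum>Q\<in>children I. v Q * bint Q) = 0"

lemma L2_b_step_fun:
  assumes "I \<in> D" shows "(\<lambda>x. b x * step_fun I v x) \<in> L2"
proof -
  have "(\<lambda>x. \<Sum>Q\<in>children I. v Q * (b x * indicator Q x)) \<in> L2"
    by (intro L2_sum L2_scale b_L2 children_D)
  also have "(\<lambda>x. \<Sum>Q\<in>children I. v Q * (b x * indicator Q x)) = (\<lambda>x. b x * step_fun I v x)"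
    by (auto simp: step_fun_def sum_distrib_left mult_ac)
  finally show ?thesis .
qed

text \<open>Dual of the square function bound: pairing \<open>b \<phi>\<close>, \<open>\<phi>\<close> cancelling on \<open>I\<close>, with \<open>h\<close> only sees the
  martingale difference of \<open>h\<close> at \<open>I\<close>.\<close>

theorem dual_square_function_bound:
  assumes F: "finite F" "F \<subseteq> D" and canc: "\<And>I. I \<in> F \<Longrightarrow> cancelling I (v I)"
  shows "(\<integral>\<^sup>+x. ennreal ((norm (b x * (\<Sum>I\<in>F. step_fun I (v I) x)))\<^sup>2) \<partial>lborel)
    \<le> ennreal (56 * (M / c) ^ 4 * M\<^sup>2) * (\<Sum>I\<in>F. \<integral>\<^sup>+x. ennreal ((norm (step_fun I (v I) x))\<^sup>2) \<partial>lborel)"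
proof -
  define A where "A = 56 * (M / c) ^ 4"
  have A: "A > 0" using M_pos c_pos by (simp add: A_def)
  define \<Psi> where "\<Psi> x = (\<Sum>I\<in>F. b x * step_fun I (v I) x)" for x
  have \<Psi>: "\<Psi> \<in> L2" unfolding \<Psi>_def[abs_def] using F by (intro L2_sum L2_b_step_fun) auto
  \<comment> \<open>Pairing \<open>\<Psi>\<close> bilinearly with its conjugate returns its own
    squared norm.\<close>
  define h where "h x = cnj (\<Psi> x)" for x
  have h: "h \<in> L2" unfolding h_def[abs_def] by (rule L2_cnj[OF \<Psi>])
  have [measurable]: "h \<in> borel_measurable borel" by (rule L2_measurable[OF h])
  have hn: "L2_norm h = L2_norm \<Psi>" unfolding h_def[abs_def] by (rule L2_norm_cnj)
  define E1 where "E1 I = (\<Sum>Q\<in>children I. measure lborel Q * (norm (v I Q))\<^sup>2)" for I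
  define E2 where "E2 I = (\<Sum>Q\<in>children I. measure lborel Q * (norm (bmean h Q - bmean h I))\<^sup>2)" for I
  have sqh: "(\<Sum>I\<in>F. E2 I) \<le> A * (L2_norm h)\<^sup>2"
  proof -
    have "ennreal (\<Sum>I\<in>F. E2 I) = (\<Sum>I\<in>F. ennreal (E2 I))"
      by (rule sum_ennreal[symmetric]) (auto simp: E2_def intro!: sum_nonneg)
    also have "\<dots> = (\<Sum>I\<in>F. \<integral>\<^sup>+x. ennreal ((norm (diff_cube D b I h x))\<^sup>2) \<partial>lborel)"
      using F by (intro sum.cong refl) (auto simp: E2_def diff_cube_step nn_integral_step_fun)
    also have "\<dots> \<le> ennreal A * (\<integral>\<^sup>+x. ennreal ((norm (h x))\<^sup>2) \<partial>lborel)"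
      unfolding A_def by (rule square_function_bound[OF F]) measurable
    also have "\<dots> = ennreal (A * (L2_norm h)\<^sup>2)"
      using A by (simp add: L2_nn_integral[OF h] ennreal_mult)
    finally show ?thesis using A by (subst (asm) ennreal_le_iff) auto
  qed
  have pair: "norm (LINT x|lborel. (b x * step_fun I (v I) x) * h x) \<le> A * M\<^sup>2 / 2 * E1 I + 1 / (2 * A) * E2 I"
    if "I \<in> F" for I
  proof -
    have I: "I \<in> D" using that F by auto
    have "(LINT x|lborel. (b x * step_fun I (v I) x) * h x)
      = (LINT x|lborel. (\<Sum>Q\<in>children I. v I Q * (indicator Q x *\<^sub>R (h x * b x))))"
      by (intro Bochner_Integration.integral_cong refl)
         (auto simp: step_fun_def sum_distrib_left sum_distrib_right indicator_def mult_ac intro!: sum.cong)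
    also have "\<dots> = (\<Sum>Q\<in>children I. v I Q * (LINT y:Q|lborel. h y * b y))"
    proof -
      have "integrable lborel (\<lambda>x. v I Q * (indicator Q x *\<^sub>R (h x * b x)))" if "Q \<in> children I" for Q
        using mult_b_set_integrable[OF children_D[OF that] h]
        unfolding set_integrable_def by (rule integrable_mult_right)
      then show ?thesis
        unfolding set_lebesgue_integral_def integral_mult_right_zero[symmetric]
        by (intro Bochner_Integration.integral_sum)
    qed
    also have "\<dots> = (\<Sum>Q\<in>children I. v I Q * bint Q * bmean h Q)"
      using bint_nonzero[OF children_D] by (intro sum.cong refl) auto
    also have "\<dots> = (\<Sum>Q\<in>children I. v I Q * bint Q * (bmean h Q - bmean h I))"
    proof -
      have "(\<Sum>Q\<in>children I. v I Q * bint Q * bmean h I) = 0"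
        unfolding sum_distrib_right[symmetric] canc[OF that, unfolded cancelling_def] by simp
      then show ?thesis by (simp add: right_diff_distrib sum_subtractf)
    qed
    finally have "norm (LINT x|lborel. (b x * step_fun I (v I) x) * h x)
        \<le> (\<Sum>Q\<in>children I. norm (v I Q * bint Q * (bmean h Q - bmean h I)))"
      by (simp only: norm_sum)
    also have "\<dots> \<le> (\<Sum>Q\<in>children I. A * M\<^sup>2 / 2 * (measure lborel Q * (norm (v I Q))\<^sup>2)
        + 1 / (2 * A) * (measure lborel Q * (norm (bmean h Q - bmean h I))\<^sup>2))"
    proof (rule sum_mono)
      fix Q assume Q: "Q \<in> children I"
      have "norm (v I Q * bint Q * (bmean h Q - bmean h I))
          = norm (v I Q) * norm (bmean h Q - bmean h I) * norm (bint Q)"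
        by (simp only: norm_mult mult_ac)
      also have "\<dots> \<le> norm (v I Q) * norm (bmean h Q - bmean h I) * (M * measure lborel Q)"
        by (intro mult_left_mono bint_le children_D[OF Q] mult_nonneg_nonneg norm_ge_zero)
      also have "\<dots> \<le> A * M\<^sup>2 / 2 * (measure lborel Q * (norm (v I Q))\<^sup>2)
        + 1 / (2 * A) * (measure lborel Q * (norm (bmean h Q - bmean h I))\<^sup>2)"
        by (rule weighted_Young[OF A measure_nonneg])
      finally show "norm (v I Q * bint Q * (bmean h Q - bmean h I)) \<le> A * M\<^sup>2 / 2 * (measure lborel Q * (norm (v I Q))\<^sup>2)
        + 1 / (2 * A) * (measure lborel Q * (norm (bmean h Q - bmean h I))\<^sup>2)" .
    qed
    also have "\<dots> = A * M\<^sup>2 / 2 * E1 I + 1 / (2 * A) * E2 I"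
      by (simp add: E1_def E2_def sum.distrib sum_distrib_left)
    finally show ?thesis .
  qed
  have "complex_of_real ((L2_norm \<Psi>)\<^sup>2) = (LINT x|lborel. complex_of_real ((norm (\<Psi> x))\<^sup>2))"
    unfolding L2_norm_power2 by (rule integral_complex_of_real[symmetric])
  also have "\<dots> = (LINT x|lborel. \<Psi> x * h x)"
    unfolding h_def by (intro Bochner_Integration.integral_cong refl) (rule complex_norm_square)
  also have "\<dots> = (LINT x|lborel. (\<Sum>I\<in>F. (b x * step_fun I (v I) x) * h x))"
    by (simp add: \<Psi>_def sum_distrib_right)
  also have "\<dots> = (\<Sum>I\<in>F. LINT x|lborel. (b x * step_fun I (v I) x) * h x)"
    using F by (intro Bochner_Integration.integral_sum L2_mult_integrable h L2_b_step_fun) auto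
  finally have "(L2_norm \<Psi>)\<^sup>2 = norm (\<Sum>I\<in>F. LINT x|lborel. (b x * step_fun I (v I) x) * h x)"
    by (metis norm_of_real abs_power2)
  also have "\<dots> \<le> (\<Sum>I\<in>F. norm (LINT x|lborel. (b x * step_fun I (v I) x) * h x))" by (rule norm_sum)
  also have "\<dots> \<le> (\<Sum>I\<in>F. A * M\<^sup>2 / 2 * E1 I + 1 / (2 * A) * E2 I)" by (intro sum_mono pair)
  also have "\<dots> = A * M\<^sup>2 / 2 * (\<Sum>I\<in>F. E1 I) + 1 / (2 * A) * (\<Sum>I\<in>F. E2 I)"
    by (simp add: sum.distrib sum_distrib_left)
  also have "\<dots> \<le> A * M\<^sup>2 / 2 * (\<Sum>I\<in>F. E1 I) + 1 / (2 * A) * (A * (L2_norm \<Psi>)\<^sup>2)"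
    using sqh A by (intro add_left_mono mult_left_mono) (auto simp: hn)
  also have "1 / (2 * A) * (A * (L2_norm \<Psi>)\<^sup>2) = (L2_norm \<Psi>)\<^sup>2 / 2" using A by simp
  \<comment> \<open>The term with one half is absorbed into the left-hand side; the choice of
    weights in \<open>weighted_Young\<close> was aimed at this.\<close>
  finally have main: "(L2_norm \<Psi>)\<^sup>2 \<le> A * M\<^sup>2 * (\<Sum>I\<in>F. E1 I)" by (simp add: field_simps)
  have "(\<integral>\<^sup>+x. ennreal ((norm (b x * (\<Sum>I\<in>F. step_fun I (v I) x)))\<^sup>2) \<partial>lborel) = ennreal ((L2_norm \<Psi>)\<^sup>2)"
    unfolding L2_nn_integral[OF \<Psi>, symmetric] by (simp add: \<Psi>_def sum_distrib_left)
  also have "\<dots> \<le> ennreal (A * M\<^sup>2 * (\<Sum>I\<in>F. E1 I))" by (rule ennreal_leI[OF main])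
  also have "\<dots> = ennreal (A * M\<^sup>2) * (\<Sum>I\<in>F. ennreal (E1 I))"
    using A by (subst ennreal_mult) (auto simp: E1_def sum_nonneg intro!: sum_nonneg)
  also have "(\<Sum>I\<in>F. ennreal (E1 I)) = (\<Sum>I\<in>F. \<integral>\<^sup>+x. ennreal ((norm (step_fun I (v I) x))\<^sup>2) \<partial>lborel)"
    using F by (intro sum.cong refl) (auto simp: E1_def nn_integral_step_fun)
  finally show ?thesis unfolding A_def .
qed

end

section \<open>Maximal functions\<close>

lemma ennreal_two_mult_le_squares: "2 * (x * y) \<le> x\<^sup>2 + (y::ennreal)\<^sup>2"
proof (cases x)
  case x: (real r)
  show ?thesis
  proof (cases y)
    case y: (real s)
    have "2 * (r * s) \<le> r\<^sup>2 + s\<^sup>2" using sum_squares_bound[of r s] by (simp add: mult.assoc)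
    then have "ennreal (2 * (r * s)) \<le> ennreal (r\<^sup>2 + s\<^sup>2)" by (rule ennreal_leI)
    then show ?thesis using x y by (simp add: ennreal_mult ennreal_power)
  qed (simp add: power2_eq_square)
qed (simp add: power2_eq_square)

text \<open>Bellman inequality behind Doob's maximal inequality, arranged without subtraction: \<open>m\<close> and
  \<open>max m a\<close> are consecutive running maxima, \<open>a\<close> the new average.\<close>

lemma max_square_step:
  fixes m a :: ennreal
  shows "(max m a)\<^sup>2 + 2 * (m * a) \<le> m\<^sup>2 + 2 * (max m a * a)"
proof (cases "a \<le> m")
  case False
  then have "max m a = a" by (intro max_absorb2) simp
  then have "(max m a)\<^sup>2 + 2 * (m * a) \<le> a\<^sup>2 + (m\<^sup>2 + a\<^sup>2)"
    by (simp add: ennreal_two_mult_le_squares)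
  also have "\<dots> = m\<^sup>2 + 2 * (a * a)"
    unfolding power2_eq_square mult_2[of "a * a"] by (simp only: add.left_commute)
  finally show ?thesis using \<open>max m a = a\<close> by simp
qed (simp add: max_absorb1)

section \<open>Doob's maximal inequality along the levels of one grid\<close>

context grid
begin

definition avg :: "(real ^ 'n \<Rightarrow> ennreal) \<Rightarrow> (real ^ 'n) set \<Rightarrow> ennreal" where
  "avg f I = (\<integral>\<^sup>+y\<in>I. f y \<partial>lborel) / emeasure lborel I"

lemma avg_times:
  assumes "I \<in> D" shows "avg f I * emeasure lborel I = (\<integral>\<^sup>+y\<in>I. f y \<partial>lborel)"
proof -
  have "avg f I * emeasure lborel I = (\<integral>\<^sup>+y\<in>I. f y \<partial>lborel) * emeasure lborel I / emeasure lborel I"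
    by (simp add: avg_def ennreal_times_divide mult.commute)
  also have "\<dots> = (\<integral>\<^sup>+y\<in>I. f y \<partial>lborel)"
    using emeasure_cell[OF assms] by (intro ennreal_mult_divide_eq) auto
  finally show ?thesis .
qed

lemma avg_measurable [measurable]: "(\<lambda>x. avg f (cell p x)) \<in> borel_measurable borel"
  by (rule cell_measurable)

lemma cell_coarser: "cell q x = cell q y \<Longrightarrow> p \<le> q \<Longrightarrow> cell p x = cell p y"
proof -
  assume *: "cell q x = cell q y" "p \<le> q"
  have "cell q x \<subseteq> cell p x" by (rule nested[OF cell(1) cell(1) *(2) cell(2) cell(2)])
  then have "y \<in> cell p x" using cell(2)[of y q] * by auto
  then show ?thesis by (rule cell_eq[OF cell(1), symmetric])
qed

text \<open>\<open>u\<close> is constant on the cells of level \<open>q\<close>, and the average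
  over such a cell is recovered from the averages over its children: the martingale property, tested
  against a factor known at level \<open>q\<close>.\<close>

lemma nn_integral_avg_tower:
  assumes [measurable]: "f \<in> borel_measurable borel" "u \<in> borel_measurable borel"
    and u: "\<And>x y. cell q x = cell q y \<Longrightarrow> u x = u y"
  shows "(\<integral>\<^sup>+x. u x * avg f (cell (q + 1) x) \<partial>lborel) = (\<integral>\<^sup>+x. u x * avg f (cell q x) \<partial>lborel)"
proof -
  have eq: "(\<integral>\<^sup>+x\<in>I. (u x * avg f (cell (q + 1) x)) \<partial>lborel) = (\<integral>\<^sup>+x\<in>I. (u x * avg f (cell q x)) \<partial>lborel)"
    if Iq: "I \<in> grid_level D q" for I
  proof -
    have I: "I \<in> D" and lev: "level_of I = q" using Iq by (auto intro: level_subset level_of_eq)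
    note [measurable] = borel_cell[OF I]
    obtain z where z: "z \<in> I" using cell_nonempty[OF I] by blast
    have uI: "u x = u z" if "x \<in> I" for x
      by (rule u) (simp add: cell_eq[OF Iq that] cell_eq[OF Iq z])
    have "(\<integral>\<^sup>+x\<in>I. (u x * avg f (cell (q + 1) x)) \<partial>lborel) = (\<integral>\<^sup>+x. u z * (avg f (cell (q + 1) x) * indicator I x) \<partial>lborel)"
      by (intro nn_integral_cong) (auto simp: indicator_def uI)
    also have "\<dots> = u z * (\<integral>\<^sup>+x\<in>I. avg f (cell (level_of I + 1) x) \<partial>lborel)"
      unfolding lev by (rule nn_integral_cmult) measurable
    also have "(\<integral>\<^sup>+x\<in>I. avg f (cell (level_of I + 1) x) \<partial>lborel) = (\<Sum>Q\<in>children I. avg f Q * emeasure lborel Q)"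
      by (rule nn_integral_cell_children[OF I])
    also have "\<dots> = (\<Sum>Q\<in>children I. \<integral>\<^sup>+y\<in>Q. f y \<partial>lborel)"
      by (intro sum.cong refl avg_times children_D)
    also have "\<dots> = (\<integral>\<^sup>+y\<in>I. f y \<partial>lborel)" by (rule nn_integral_children[OF I, symmetric]) measurable
    also have "\<dots> = avg f I * emeasure lborel I" by (rule avg_times[OF I, symmetric])
    also have "\<dots> = (\<integral>\<^sup>+x\<in>I. avg f (cell q x) \<partial>lborel)"
      by (rule nn_integral_cell_const[OF Iq, symmetric])
    also have "u z * \<dots> = (\<integral>\<^sup>+x. u z * (avg f (cell q x) * indicator I x) \<partial>lborel)"
      by (rule nn_integral_cmult[symmetric]) measurable
    also have "\<dots> = (\<integral>\<^sup>+x\<in>I. (u x * avg f (cell q x)) \<partial>lborel)"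
      by (intro nn_integral_cong) (auto simp: indicator_def uI)
    finally show ?thesis .
  qed
  show ?thesis
    by (rule antisym; rule nn_integral_level_mono[where p = q]) (simp_all add: eq avg_measurable)
qed

text \<open>Jensen's inequality on each cell, from \<open>2 a f \<le> a^2 + f^2\<close> with
  \<open>a\<close> the average: after integration the left side is twice the \<open>a^2\<close>
  term, and one copy cancels when it is finite.\<close>

lemma nn_integral_avg_square_le:
  assumes [measurable]: "f \<in> borel_measurable borel"
  shows "(\<integral>\<^sup>+x. (avg f (cell q x))\<^sup>2 \<partial>lborel) \<le> (\<integral>\<^sup>+x. (f x)\<^sup>2 \<partial>lborel)"
proof (rule nn_integral_level_mono[where p = q])
  fix I assume Iq: "I \<in> grid_level D q"
  then have I: "I \<in> D" by (rule level_subset)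
  note [measurable] = borel_cell[OF I]
  define a where "a = avg f I"
  have int: "(\<integral>\<^sup>+x\<in>I. (avg f (cell q x))\<^sup>2 \<partial>lborel) = a\<^sup>2 * emeasure lborel I"
    unfolding a_def by (rule nn_integral_cell_const[OF Iq, of "\<lambda>J. (avg f J)\<^sup>2"])
  show "(\<integral>\<^sup>+x\<in>I. (avg f (cell q x))\<^sup>2 \<partial>lborel) \<le> (\<integral>\<^sup>+x\<in>I. (f x)\<^sup>2 \<partial>lborel)"
  proof (cases "a = \<infinity>")
    case False
    have "2 * (a\<^sup>2 * emeasure lborel I) = 2 * a * (\<integral>\<^sup>+x\<in>I. f x \<partial>lborel)"
      unfolding avg_times[OF I, symmetric] a_def by (simp add: power2_eq_square mult_ac)
    also have "\<dots> = (\<integral>\<^sup>+x. 2 * a * (f x * indicator I x) \<partial>lborel)"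
      by (rule nn_integral_cmult[symmetric]) measurable
    also have "\<dots> \<le> (\<integral>\<^sup>+x. a\<^sup>2 * indicator I x + (f x)\<^sup>2 * indicator I x \<partial>lborel)"
      using ennreal_two_mult_le_squares[of a]
      by (intro nn_integral_mono) (auto simp: indicator_def mult.assoc)
    also have "\<dots> = a\<^sup>2 * emeasure lborel I + (\<integral>\<^sup>+x\<in>I. (f x)\<^sup>2 \<partial>lborel)"
      by (subst nn_integral_add) (auto simp: nn_integral_cmult)
    finally have "a\<^sup>2 * emeasure lborel I + a\<^sup>2 * emeasure lborel I
        \<le> a\<^sup>2 * emeasure lborel I + (\<integral>\<^sup>+x\<in>I. (f x)\<^sup>2 \<partial>lborel)" by (simp only: mult_2)
    moreover have "a\<^sup>2 * emeasure lborel I \<noteq> \<infinity>"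
      using False emeasure_cell[OF I] by (auto simp: power2_eq_square ennreal_mult_eq_top_iff)
    ultimately show ?thesis unfolding int by (simp add: ennreal_add_left_cancel_le)
  next
    \<comment> \<open>An infinite average cannot be cancelled; instead
      \<open>f \<le> 1 + f^2\<close> and the finite measure of \<open>I\<close> force the integral
      of \<open>f^2\<close> over \<open>I\<close> to be infinite.\<close>
    case True
    have "\<infinity> = (\<integral>\<^sup>+x\<in>I. f x \<partial>lborel)"
      using avg_times[OF I, of f] True emeasure_cell[OF I]
      by (simp add: a_def ennreal_top_mult zero_less_iff_neq_zero)
    also have "\<dots> \<le> (\<integral>\<^sup>+x. 1\<^sup>2 * indicator I x + (f x)\<^sup>2 * indicator I x \<partial>lborel)"
    proof (intro nn_integral_mono)
      fix x
      have "1 * f x \<le> 2 * (1 * f x)" by (rule order_trans[OF _ mult_right_mono[of 1 2]]) auto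
      also have "\<dots> \<le> 1\<^sup>2 + (f x)\<^sup>2" by (rule ennreal_two_mult_le_squares)
      finally show "f x * indicator I x \<le> 1\<^sup>2 * indicator I x + (f x)\<^sup>2 * indicator I x"
        by (auto simp: indicator_def)
    qed
    also have "\<dots> = emeasure lborel I + (\<integral>\<^sup>+x\<in>I. (f x)\<^sup>2 \<partial>lborel)"
      by (subst nn_integral_add) auto
    finally have "(\<integral>\<^sup>+x\<in>I. (f x)\<^sup>2 \<partial>lborel) = \<infinity>"
      using emeasure_cell[OF I] by (auto simp: top_unique)
    then show ?thesis by simp
  qed
qed measurable

text \<open>Dyadic maximal function truncated to the levels from \<open>p\<close> to
  \<open>p + k\<close>, written as a running maximum so that Doob's inequality can be proved by
  induction on \<open>k\<close>.\<close>

primrec maxfun :: "(real ^ 'n \<Rightarrow> ennreal) \<Rightarrow> int \<Rightarrow> nat \<Rightarrow> real ^ 'n \<Rightarrow> ennreal" where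
  "maxfun f p 0 x = avg f (cell p x)"
| "maxfun f p (Suc k) x = max (maxfun f p k x) (avg f (cell (p + int (Suc k)) x))"

lemma maxfun_measurable [measurable]: "maxfun f p k \<in> borel_measurable borel"
  by (induction k) (simp_all add: avg_measurable borel_measurable_max cong: measurable_cong)

lemma maxfun_cell: "cell (p + int k) x = cell (p + int k) y \<Longrightarrow> maxfun f p k x = maxfun f p k y"
proof (induction k)
  case (Suc k)
  then have "cell (p + int k) x = cell (p + int k) y" using cell_coarser[OF Suc.prems, of "p + int k"] by simp
  with Suc show ?case by simp
qed simp

lemma avg_le_maxfun:
  assumes "I \<in> grid_level D (p + int j)" "j \<le> k" "x \<in> I"
  shows "avg f I \<le> maxfun f p k x"
  using assms(2)
proof (induction rule: dec_induct)
  case base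
  have "avg f (cell (p + int j) x) \<le> maxfun f p j x" by (cases j) auto
  then show ?case by (simp add: cell_eq[OF assms(1,3)])
next
  case (step k)
  then show ?case by (auto intro: max.coboundedI1)
qed

text \<open>The integral \<open>X\<close> of the squared running maximum is at most twice the
  integral of its product with the last average. Young's inequality turns this into
  \<open>2 X \<le> X + 4 Y\<close>, where \<open>Y\<close> is the integral of the squared last
  average; the constant is independent of \<open>p\<close> and \<open>k\<close>.\<close>

theorem maximal_bound:
  assumes f [measurable]: "f \<in> borel_measurable borel"
  shows "(\<integral>\<^sup>+x. (maxfun f p k x)\<^sup>2 \<partial>lborel) \<le> 4 * (\<integral>\<^sup>+x. (f x)\<^sup>2 \<partial>lborel)"
proof (cases "(\<integral>\<^sup>+x. (f x)\<^sup>2 \<partial>lborel) = \<infinity>")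
  case True
  then show ?thesis by (simp add: ennreal_mult_top)
next
  case False
  let ?A = "\<lambda>k x. avg f (cell (p + int k) x)" and ?M = "maxfun f p"
  \<comment> \<open>Finiteness is secured first, because the argument cancels such integrals from
    both sides.\<close>
  have Afin: "(\<integral>\<^sup>+x. (?A k x)\<^sup>2 \<partial>lborel) < \<infinity>" for k
    using nn_integral_avg_square_le[OF f, of "p + int k"] False by (auto simp: less_top top_unique)
  have Mfin: "(\<integral>\<^sup>+x. (?M k x)\<^sup>2 \<partial>lborel) < \<infinity>" for k
  proof (induction k)
    case 0
    then show ?case using Afin[of 0] by simp
  next
    case (Suc k)
    have "(\<integral>\<^sup>+x. (?M (Suc k) x)\<^sup>2 \<partial>lborel) \<le> (\<integral>\<^sup>+x. (?M k x)\<^sup>2 + (?A (Suc k) x)\<^sup>2 \<partial>lborel)"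
      by (intro nn_integral_mono) (auto simp: max_def)
    also have "\<dots> = (\<integral>\<^sup>+x. (?M k x)\<^sup>2 \<partial>lborel) + (\<integral>\<^sup>+x. (?A (Suc k) x)\<^sup>2 \<partial>lborel)"
      by (rule nn_integral_add; measurable)
    also have "\<dots> < \<infinity>" using Suc Afin[of "Suc k"] by simp
    finally show ?case .
  qed
  have MAfin: "(\<integral>\<^sup>+x. ?M k x * ?A k x \<partial>lborel) < \<infinity>" for k
  proof -
    have "(\<integral>\<^sup>+x. ?M k x * ?A k x \<partial>lborel) \<le> (\<integral>\<^sup>+x. (?M k x)\<^sup>2 + (?A k x)\<^sup>2 \<partial>lborel)"
    proof (intro nn_integral_mono)
      fix x
      have "1 * (?M k x * ?A k x) \<le> 2 * (?M k x * ?A k x)" by (intro mult_right_mono) auto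
      also have "\<dots> \<le> (?M k x)\<^sup>2 + (?A k x)\<^sup>2" by (rule ennreal_two_mult_le_squares)
      finally show "?M k x * ?A k x \<le> (?M k x)\<^sup>2 + (?A k x)\<^sup>2" by simp
    qed
    also have "\<dots> = (\<integral>\<^sup>+x. (?M k x)\<^sup>2 \<partial>lborel) + (\<integral>\<^sup>+x. (?A k x)\<^sup>2 \<partial>lborel)"
      by (rule nn_integral_add; measurable)
    also have "\<dots> < \<infinity>" using Mfin[of k] Afin[of k] by simp
    finally show ?thesis .
  qed
  \<comment> \<open>Only the average at the finest level appears on the right, so a single
    application of Young's inequality finishes the proof.\<close>
  have doob: "(\<integral>\<^sup>+x. (?M k x)\<^sup>2 \<partial>lborel) \<le> 2 * (\<integral>\<^sup>+x. ?M k x * ?A k x \<partial>lborel)" for k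
  proof (induction k)
    case 0
    have "1 * (\<integral>\<^sup>+x. (avg f (cell p x))\<^sup>2 \<partial>lborel) \<le> 2 * (\<integral>\<^sup>+x. (avg f (cell p x))\<^sup>2 \<partial>lborel)"
      by (intro mult_right_mono) auto
    then show ?case by (simp add: power2_eq_square)
  next
    case (Suc k)
    have suc: "p + int (Suc k) = p + int k + 1" by simp
    \<comment> \<open>\<open>?M k\<close> is constant on cells of level \<open>p + int k\<close>, so
      against it the newest average may be replaced by the previous one; the resulting term cancels
      the bound of the induction hypothesis.\<close>
    have tower: "(\<integral>\<^sup>+x. ?M k x * ?A (Suc k) x \<partial>lborel) = (\<integral>\<^sup>+x. ?M k x * ?A k x \<partial>lborel)"
      unfolding suc by (rule nn_integral_avg_tower[OF f maxfun_measurable maxfun_cell])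
    have "(\<integral>\<^sup>+x. (?M (Suc k) x)\<^sup>2 \<partial>lborel) + 2 * (\<integral>\<^sup>+x. ?M k x * ?A (Suc k) x \<partial>lborel)
       = (\<integral>\<^sup>+x. (?M (Suc k) x)\<^sup>2 + 2 * (?M k x * ?A (Suc k) x) \<partial>lborel)"
    proof -
      have "2 * (\<integral>\<^sup>+x. ?M k x * ?A (Suc k) x \<partial>lborel) = (\<integral>\<^sup>+x. 2 * (?M k x * ?A (Suc k) x) \<partial>lborel)"
        by (rule nn_integral_cmult[symmetric]; measurable)
      then show ?thesis by (simp only:) (rule nn_integral_add[symmetric]; measurable)
    qed
    also have "\<dots> \<le> (\<integral>\<^sup>+x. (?M k x)\<^sup>2 + 2 * (?M (Suc k) x * ?A (Suc k) x) \<partial>lborel)"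
      by (intro nn_integral_mono) (simp only: maxfun.simps max_square_step)
    also have "\<dots> = (\<integral>\<^sup>+x. (?M k x)\<^sup>2 \<partial>lborel) + (\<integral>\<^sup>+x. 2 * (?M (Suc k) x * ?A (Suc k) x) \<partial>lborel)"
      by (rule nn_integral_add; measurable)
    also have "(\<integral>\<^sup>+x. 2 * (?M (Suc k) x * ?A (Suc k) x) \<partial>lborel) = 2 * (\<integral>\<^sup>+x. ?M (Suc k) x * ?A (Suc k) x \<partial>lborel)"
      by (rule nn_integral_cmult; measurable)
    also have "(\<integral>\<^sup>+x. (?M k x)\<^sup>2 \<partial>lborel) + 2 * (\<integral>\<^sup>+x. ?M (Suc k) x * ?A (Suc k) x \<partial>lborel)
       \<le> 2 * (\<integral>\<^sup>+x. ?M k x * ?A k x \<partial>lborel) + 2 * (\<integral>\<^sup>+x. ?M (Suc k) x * ?A (Suc k) x \<partial>lborel)"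
      by (intro add_right_mono Suc.IH)
    finally have "2 * (\<integral>\<^sup>+x. ?M k x * ?A k x \<partial>lborel) + (\<integral>\<^sup>+x. (?M (Suc k) x)\<^sup>2 \<partial>lborel)
       \<le> 2 * (\<integral>\<^sup>+x. ?M k x * ?A k x \<partial>lborel) + 2 * (\<integral>\<^sup>+x. ?M (Suc k) x * ?A (Suc k) x \<partial>lborel)"
      unfolding tower by (simp only: add.commute)
    moreover have "2 * (\<integral>\<^sup>+x. ?M k x * ?A k x \<partial>lborel) \<noteq> \<infinity>"
      using MAfin[of k] by (simp add: ennreal_mult_eq_top_iff less_top)
    ultimately show ?case by (simp only: ennreal_add_left_cancel_le) blast
  qed
  let ?X = "\<integral>\<^sup>+x. (?M k x)\<^sup>2 \<partial>lborel" and ?Y = "\<integral>\<^sup>+x. (?A k x)\<^sup>2 \<partial>lborel"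
  have "?X + ?X = 2 * ?X" by (simp add: mult_2)
  also have "\<dots> \<le> 2 * (2 * (\<integral>\<^sup>+x. ?M k x * ?A k x \<partial>lborel))" by (intro mult_left_mono doob) simp
  also have "\<dots> = (\<integral>\<^sup>+x. 2 * (?M k x * (2 * ?A k x)) \<partial>lborel)"
    by (subst nn_integral_cmult[symmetric], measurable, subst nn_integral_cmult[symmetric], measurable)
       (simp add: mult_ac)
  also have "\<dots> \<le> (\<integral>\<^sup>+x. (?M k x)\<^sup>2 + (2 * ?A k x)\<^sup>2 \<partial>lborel)"
    by (intro nn_integral_mono ennreal_two_mult_le_squares)
  also have "\<dots> = ?X + (\<integral>\<^sup>+x. (2 * ?A k x)\<^sup>2 \<partial>lborel)"
    by (rule nn_integral_add; measurable)
  also have "(\<integral>\<^sup>+x. (2 * ?A k x)\<^sup>2 \<partial>lborel) = (\<integral>\<^sup>+x. 4 * (?A k x)\<^sup>2 \<partial>lborel)"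
    by (simp add: power_mult_distrib)
  also have "\<dots> = 4 * ?Y" by (rule nn_integral_cmult; measurable)
  finally have "?X \<le> 4 * ?Y" using Mfin[of k] by (simp only: ennreal_add_left_cancel_le) auto
  also have "\<dots> \<le> 4 * (\<integral>\<^sup>+x. (f x)\<^sup>2 \<partial>lborel)"
    by (intro mult_left_mono nn_integral_avg_square_le) auto
  finally show ?thesis .
qed

section \<open>Joint measurability, iterated integrals and the strong maximal function\<close>

lemma cell_measurable_count_space: "cell p \<in> measurable borel (count_space (grid_level D p))"
  unfolding measurable_count_space_eq_countable[OF countable_level]
proof (intro conjI ballI)
  show "cell p \<in> space borel \<rightarrow> grid_level D p" using cell(1) by auto
  fix I assume I: "I \<in> grid_level D p"
  have "cell p -` {I} = I" using cell(2)[of _ p] cell_eq[OF I] by auto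
  then show "cell p -` {I} \<inter> space borel \<in> sets borel" using borel_cell[OF level_subset[OF I]] by simp
qed

text \<open>In the iteration the function being averaged itself depends on the point. Splitting by
  the countably many possible cells leaves averages over a fixed cell, which are measurable in the
  parameter.\<close>

lemma maxfun_joint_measurable:
  assumes u: "case_prod u \<in> borel_measurable (M \<Otimes>\<^sub>M lborel)" and v: "v \<in> measurable M borel"
  shows "(\<lambda>x. maxfun (u x) p k (v x)) \<in> borel_measurable M"
proof -
  have avg: "(\<lambda>x. avg (u x) (cell q (v x))) \<in> borel_measurable M" for q
  proof (rule measurable_compose_countable'[where I = "grid_level D q"])
    fix I assume "I \<in> grid_level D q"
    note [measurable] = borel_cell[OF level_subset[OF this]] u
    show "(\<lambda>x. avg (u x) I) \<in> borel_measurable M" unfolding avg_def by measurable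
  qed (use countable_level measurable_compose[OF v cell_measurable_count_space] in auto)
  show ?thesis by (induction k) (auto intro: avg borel_measurable_max)
qed

end

lemma nn_integral_lborel_iterated:
  assumes [measurable]: "u \<in> borel_measurable borel"
  shows "(\<integral>\<^sup>+x. u x \<partial>(lborel :: ('a::euclidean_space \<times> 'b::euclidean_space) measure)) = (\<integral>\<^sup>+x\<^sub>1. \<integral>\<^sup>+x\<^sub>2. u (x\<^sub>1, x\<^sub>2) \<partial>lborel \<partial>lborel)"
    "(\<integral>\<^sup>+x. u x \<partial>(lborel :: ('a \<times> 'b) measure)) = (\<integral>\<^sup>+x\<^sub>2. \<integral>\<^sup>+x\<^sub>1. u (x\<^sub>1, x\<^sub>2) \<partial>lborel \<partial>lborel)"
proof -
  have u: "u \<in> borel_measurable (lborel \<Otimes>\<^sub>M lborel)" unfolding lborel_prod by simp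
  show "(\<integral>\<^sup>+x. u x \<partial>lborel) = (\<integral>\<^sup>+x\<^sub>1. \<integral>\<^sup>+x\<^sub>2. u (x\<^sub>1, x\<^sub>2) \<partial>lborel \<partial>lborel)"
    using lborel.nn_integral_fst[OF u] by (simp add: lborel_prod)
  show "(\<integral>\<^sup>+x. u x \<partial>lborel) = (\<integral>\<^sup>+x\<^sub>2. \<integral>\<^sup>+x\<^sub>1. u (x\<^sub>1, x\<^sub>2) \<partial>lborel \<partial>lborel)"
    using lborel_pair.nn_integral_snd[OF u] by (simp add: lborel_prod)
qed

lemma sets_borel_Times [measurable]:
  assumes "A \<in> sets borel" "B \<in> sets borel"
  shows "A \<times> B \<in> sets (borel :: ('a::second_countable_topology \<times> 'b::second_countable_topology) measure)"
  using assms unfolding borel_prod[symmetric] by (rule pair_measureI)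

lemma emeasure_lborel_Times:
  assumes "A \<in> sets borel" "B \<in> sets borel"
  shows "emeasure (lborel :: ('a::euclidean_space \<times> 'b::euclidean_space) measure) (A \<times> B) = emeasure lborel A * emeasure lborel B"
  unfolding lborel_prod[symmetric] using assms by (intro lborel.emeasure_pair_measure_Times) auto

lemma measure_lborel_Times:
  assumes "A \<in> sets borel" "B \<in> sets borel"
  shows "measure (lborel :: ('a::euclidean_space \<times> 'b::euclidean_space) measure) (A \<times> B) = measure lborel A * measure lborel B"
  unfolding measure_def emeasure_lborel_Times[OF assms] by (rule enn2real_mult)

locale bigrid = D: grid D + E: grid E for D :: "(real ^ 'n) set set" and E :: "(real ^ 'm) set set"
begin

lemma rect_borel: "K \<in> D \<Longrightarrow> V \<in> E \<Longrightarrow> K \<times> V \<in> sets borel"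
  by (intro sets_borel_Times D.borel_cell E.borel_cell)

lemma emeasure_rect: "K \<in> D \<Longrightarrow> V \<in> E \<Longrightarrow> emeasure lborel (K \<times> V) = emeasure lborel K * emeasure lborel V"
  by (intro emeasure_lborel_Times D.borel_cell E.borel_cell)

text \<open>One-parameter maximal functions in the second and then in the first variable, over the
  finitely many levels met by \<open>F\<close>; each contributes a factor 4. \<open>H\<close>
  depends on \<open>F\<close>, but the constant 16 does not.\<close>

lemma strong_maximal:
  assumes F: "finite F" "F \<subseteq> D \<times> E" and f [measurable]: "f \<in> borel_measurable borel"
  obtains H :: "(real ^ 'n) \<times> (real ^ 'm) \<Rightarrow> ennreal"
  where "H \<in> borel_measurable borel"
    "\<And>K V x. (K, V) \<in> F \<Longrightarrow> x \<in> K \<times> V \<Longrightarrow>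
      (\<integral>\<^sup>+y\<in>K \<times> V. f y \<partial>lborel) \<le> H x * emeasure lborel (K \<times> V)"
    "(\<integral>\<^sup>+x. (H x)\<^sup>2 \<partial>lborel) \<le> 16 * (\<integral>\<^sup>+x. (f x)\<^sup>2 \<partial>lborel)"
proof -
  have levels: "\<exists>p k. l ` F \<subseteq> (\<lambda>j. p + int j) ` {..k}" for l :: "(real ^ 'n) set \<times> (real ^ 'm) set \<Rightarrow> int"
  proof (cases "F = {}")
    case False
    define p q where "p = Min (l ` F)" and "q = Max (l ` F)"
    have *: "p \<le> i \<and> i \<le> q" if "i \<in> l ` F" for i using F that by (auto simp: p_def q_def)
    have "l ` F \<subseteq> (\<lambda>j. p + int j) ` {..nat (q - p)}"
    proof
      fix i assume "i \<in> l ` F"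
      with * have "p \<le> i" "i \<le> q" by auto
      then show "i \<in> (\<lambda>j. p + int j) ` {..nat (q - p)}"
        by (intro image_eqI[of _ _ "nat (i - p)"]) auto
    qed
    then show ?thesis by blast
  qed simp
  obtain p k where pk: "(\<lambda>R. level_of (fst R)) ` F \<subseteq> (\<lambda>j. p + int j) ` {..k}" using levels by blast
  obtain q l where ql: "(\<lambda>R. level_of (snd R)) ` F \<subseteq> (\<lambda>j. q + int j) ` {..l}" using levels by blast
  have [measurable]: "f \<in> borel_measurable (borel \<Otimes>\<^sub>M borel)" using f by (simp add: borel_prod)
  define g where "g x = E.maxfun (\<lambda>y. f (fst x, y)) q l (snd x)" for x
  have g [measurable]: "g \<in> borel_measurable borel"
    unfolding g_def[abs_def] borel_prod[symmetric] by (rule E.maxfun_joint_measurable) measurable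
  have [measurable]: "g \<in> borel_measurable (borel \<Otimes>\<^sub>M borel)" using g by (simp add: borel_prod)
  define H where "H x = D.maxfun (\<lambda>y. g (y, snd x)) p k (fst x)" for x
  show ?thesis
  proof (rule that)
    show H [measurable]: "H \<in> borel_measurable borel"
      unfolding H_def[abs_def] borel_prod[symmetric] by (rule D.maxfun_joint_measurable) measurable
    fix K V and x :: "(real ^ 'n) \<times> (real ^ 'm)" assume KV: "(K, V) \<in> F" "x \<in> K \<times> V"
    then have K: "K \<in> D" and V: "V \<in> E" using F by auto
    note [measurable] = D.borel_cell[OF K] E.borel_cell[OF V]
    obtain j where j: "level_of K = p + int j" "j \<le> k" using pk KV(1) by force
    obtain i where i: "level_of V = q + int i" "i \<le> l" using ql KV(1) by force
    \<comment> \<open>The inner integral is controlled by \<open>g\<close> at the fixed height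
      \<open>snd x\<close> for every first coordinate, so that \<open>g\<close> can then be averaged
      over \<open>K\<close>.\<close>
    have gV: "(\<integral>\<^sup>+y\<^sub>2\<in>V. f (y\<^sub>1, y\<^sub>2) \<partial>lborel) \<le> g (y\<^sub>1, snd x) * emeasure lborel V" for y\<^sub>1
    proof -
      have "E.avg (\<lambda>y. f (y\<^sub>1, y)) V \<le> g (y\<^sub>1, snd x)"
        unfolding g_def fst_conv snd_conv
        by (rule E.avg_le_maxfun[OF E.in_level_of[OF V, unfolded i(1)] i(2)]) (use KV in auto)
      then show ?thesis unfolding E.avg_times[OF V, symmetric] by (rule mult_right_mono) simp
    qed
    have HK: "D.avg (\<lambda>y. g (y, snd x)) K \<le> H x"
      unfolding H_def
      by (rule D.avg_le_maxfun[OF D.in_level_of[OF K, unfolded j(1)] j(2)]) (use KV in auto)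
    have "(\<integral>\<^sup>+y\<in>K \<times> V. f y \<partial>lborel) = (\<integral>\<^sup>+y\<^sub>1. \<integral>\<^sup>+y\<^sub>2. f (y\<^sub>1, y\<^sub>2) * indicator (K \<times> V) (y\<^sub>1, y\<^sub>2) \<partial>lborel \<partial>lborel)"
      by (rule nn_integral_lborel_iterated(1)) (use rect_borel[OF K V] in measurable)
    also have "\<dots> = (\<integral>\<^sup>+y\<^sub>1\<in>K. (\<integral>\<^sup>+y\<^sub>2\<in>V. f (y\<^sub>1, y\<^sub>2) \<partial>lborel) \<partial>lborel)"
      by (intro nn_integral_cong) (auto simp: indicator_def)
    also have "\<dots> \<le> (\<integral>\<^sup>+y\<^sub>1\<in>K. (g (y\<^sub>1, snd x) * emeasure lborel V) \<partial>lborel)"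
      by (intro nn_integral_mono mult_right_mono gV) simp
    also have "\<dots> = (\<integral>\<^sup>+y\<^sub>1. emeasure lborel V * (g (y\<^sub>1, snd x) * indicator K y\<^sub>1) \<partial>lborel)"
      by (simp only: mult_ac)
    also have "\<dots> = emeasure lborel V * (\<integral>\<^sup>+y\<^sub>1\<in>K. g (y\<^sub>1, snd x) \<partial>lborel)"
      by (rule nn_integral_cmult) measurable
    also have "\<dots> = emeasure lborel V * (D.avg (\<lambda>y. g (y, snd x)) K * emeasure lborel K)"
      by (simp only: D.avg_times[OF K])
    also have "\<dots> \<le> emeasure lborel V * (H x * emeasure lborel K)"
      by (intro mult_left_mono mult_right_mono HK) auto
    finally show "(\<integral>\<^sup>+y\<in>K \<times> V. f y \<partial>lborel) \<le> H x * emeasure lborel (K \<times> V)"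
      by (simp add: emeasure_rect[OF K V] mult_ac)
  next
    have [measurable]: "H \<in> borel_measurable borel"
      unfolding H_def[abs_def] borel_prod[symmetric] by (rule D.maxfun_joint_measurable) measurable
    have "(\<integral>\<^sup>+x. (H x)\<^sup>2 \<partial>lborel) = (\<integral>\<^sup>+x\<^sub>2. \<integral>\<^sup>+x\<^sub>1. (H (x\<^sub>1, x\<^sub>2))\<^sup>2 \<partial>lborel \<partial>lborel)"
      by (rule nn_integral_lborel_iterated(2)) measurable
    also have "\<dots> \<le> (\<integral>\<^sup>+x\<^sub>2. 4 * (\<integral>\<^sup>+x\<^sub>1. (g (x\<^sub>1, x\<^sub>2))\<^sup>2 \<partial>lborel) \<partial>lborel)"
      unfolding H_def fst_conv snd_conv by (intro nn_integral_mono D.maximal_bound) measurable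
    also have "\<dots> = 4 * (\<integral>\<^sup>+x\<^sub>2. \<integral>\<^sup>+x\<^sub>1. (g (x\<^sub>1, x\<^sub>2))\<^sup>2 \<partial>lborel \<partial>lborel)"
      by (rule nn_integral_cmult) measurable
    also have "(\<integral>\<^sup>+x\<^sub>2. \<integral>\<^sup>+x\<^sub>1. (g (x\<^sub>1, x\<^sub>2))\<^sup>2 \<partial>lborel \<partial>lborel) = (\<integral>\<^sup>+x\<^sub>1. \<integral>\<^sup>+x\<^sub>2. (g (x\<^sub>1, x\<^sub>2))\<^sup>2 \<partial>lborel \<partial>lborel)"
      using nn_integral_lborel_iterated[of "\<lambda>x. (g x)\<^sup>2"] by simp
    also have "4 * \<dots> \<le> 4 * (\<integral>\<^sup>+x\<^sub>1. 4 * (\<integral>\<^sup>+x\<^sub>2. (f (x\<^sub>1, x\<^sub>2))\<^sup>2 \<partial>lborel) \<partial>lborel)"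
      unfolding g_def fst_conv snd_conv
      by (intro mult_left_mono nn_integral_mono E.maximal_bound) measurable
    also have "(\<integral>\<^sup>+x\<^sub>1. 4 * (\<integral>\<^sup>+x\<^sub>2. (f (x\<^sub>1, x\<^sub>2))\<^sup>2 \<partial>lborel) \<partial>lborel) = 4 * (\<integral>\<^sup>+x\<^sub>1. \<integral>\<^sup>+x\<^sub>2. (f (x\<^sub>1, x\<^sub>2))\<^sup>2 \<partial>lborel \<partial>lborel)"
      by (rule nn_integral_cmult) measurable
    also have "(\<integral>\<^sup>+x\<^sub>1. \<integral>\<^sup>+x\<^sub>2. (f (x\<^sub>1, x\<^sub>2))\<^sup>2 \<partial>lborel \<partial>lborel) = (\<integral>\<^sup>+x. (f x)\<^sup>2 \<partial>lborel)"
      by (rule nn_integral_lborel_iterated(1)[symmetric]) measurable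
    finally show "(\<integral>\<^sup>+x. (H x)\<^sup>2 \<partial>lborel) \<le> 16 * (\<integral>\<^sup>+x. (f x)\<^sup>2 \<partial>lborel)"
      by (simp add: mult.assoc[symmetric])
  qed
qed

end

section \<open>Two-parameter square functions\<close>

lemma set_integral_Times:
  fixes u :: "'a::euclidean_space \<times> 'b::euclidean_space \<Rightarrow> complex"
  assumes u: "set_integrable lborel (A \<times> B) u"
  shows "(LINT x:A \<times> B|lborel. u x) = (LINT x\<^sub>1:A|lborel. LINT x\<^sub>2:B|lborel. u (x\<^sub>1, x\<^sub>2))"
    "set_integrable lborel A (\<lambda>x\<^sub>1. LINT x\<^sub>2:B|lborel. u (x\<^sub>1, x\<^sub>2))"
proof -
  let ?u = "\<lambda>x. indicator (A \<times> B) x *\<^sub>R u x"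
  have u': "integrable (lborel \<Otimes>\<^sub>M lborel) ?u"
    using u unfolding set_integrable_def lborel_prod .
  have eq: "(LINT x\<^sub>2|lborel. ?u (x\<^sub>1, x\<^sub>2)) = indicator A x\<^sub>1 *\<^sub>R (LINT x\<^sub>2:B|lborel. u (x\<^sub>1, x\<^sub>2))" for x\<^sub>1
    unfolding set_lebesgue_integral_def by (cases "x\<^sub>1 \<in> A") (auto simp: indicator_def)
  show "(LINT x:A \<times> B|lborel. u x) = (LINT x\<^sub>1:A|lborel. LINT x\<^sub>2:B|lborel. u (x\<^sub>1, x\<^sub>2))"
    using lborel_pair.integral_fst'[OF u'] unfolding eq lborel_prod
    by (simp add: set_lebesgue_integral_def)
  show "set_integrable lborel A (\<lambda>x\<^sub>1. LINT x\<^sub>2:B|lborel. u (x\<^sub>1, x\<^sub>2))"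
    using lborel_pair.integrable_fst'[OF u'] unfolding eq set_integrable_def .
qed

lemma tensor_measurable:
  assumes [measurable]: "b\<^sub>1 \<in> borel_measurable borel" "b\<^sub>2 \<in> borel_measurable borel"
  shows "(b\<^sub>1 \<otimes>\<^sub>t b\<^sub>2) \<in> borel_measurable (borel :: ('a::second_countable_topology \<times> 'b::second_countable_topology) measure)"
  unfolding tensor_def borel_prod[symmetric] by measurable

lemma set_integral_tensor:
  fixes b\<^sub>1 :: "'a::euclidean_space \<Rightarrow> complex" and b\<^sub>2 :: "'b::euclidean_space \<Rightarrow> complex"
  assumes [measurable]: "b\<^sub>1 \<in> borel_measurable borel" "b\<^sub>2 \<in> borel_measurable borel" "A \<in> sets borel" "B \<in> sets borel"
    and i: "set_integrable lborel A b\<^sub>1" "set_integrable lborel B b\<^sub>2"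
  shows "set_integrable lborel (A \<times> B) (b\<^sub>1 \<otimes>\<^sub>t b\<^sub>2)"
    "(LINT x:A \<times> B|lborel. (b\<^sub>1 \<otimes>\<^sub>t b\<^sub>2) x) = (LINT x:A|lborel. b\<^sub>1 x) * (LINT x:B|lborel. b\<^sub>2 x)"
proof -
  have [measurable]: "(b\<^sub>1 \<otimes>\<^sub>t b\<^sub>2) \<in> borel_measurable borel" by (rule tensor_measurable) measurable
  show int: "set_integrable lborel (A \<times> B) (b\<^sub>1 \<otimes>\<^sub>t b\<^sub>2)"
    unfolding set_integrable_def
  proof (rule integrableI_bounded)
    have "(\<integral>\<^sup>+x. ennreal (norm (indicator (A \<times> B) x *\<^sub>R (b\<^sub>1 \<otimes>\<^sub>t b\<^sub>2) x)) \<partial>lborel)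
      = (\<integral>\<^sup>+x\<^sub>1. \<integral>\<^sup>+x\<^sub>2. ennreal (norm (indicator (A \<times> B) (x\<^sub>1, x\<^sub>2) *\<^sub>R (b\<^sub>1 \<otimes>\<^sub>t b\<^sub>2) (x\<^sub>1, x\<^sub>2))) \<partial>lborel \<partial>lborel)"
      by (rule nn_integral_lborel_iterated) measurable
    also have "\<dots> = (\<integral>\<^sup>+x\<^sub>1. \<integral>\<^sup>+x\<^sub>2. ennreal (norm (indicator A x\<^sub>1 *\<^sub>R b\<^sub>1 x\<^sub>1)) * ennreal (norm (indicator B x\<^sub>2 *\<^sub>R b\<^sub>2 x\<^sub>2)) \<partial>lborel \<partial>lborel)"
      by (intro nn_integral_cong) (auto simp: tensor_def indicator_def norm_mult ennreal_mult)
    also have "\<dots> = (\<integral>\<^sup>+x\<^sub>1. ennreal (norm (indicator A x\<^sub>1 *\<^sub>R b\<^sub>1 x\<^sub>1)) * (\<integral>\<^sup>+x\<^sub>2. ennreal (norm (indicator B x\<^sub>2 *\<^sub>R b\<^sub>2 x\<^sub>2)) \<partial>lborel) \<partial>lborel)"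
      by (intro nn_integral_cong nn_integral_cmult) measurable
    also have "\<dots> = (\<integral>\<^sup>+x\<^sub>1. ennreal (norm (indicator A x\<^sub>1 *\<^sub>R b\<^sub>1 x\<^sub>1)) \<partial>lborel) * (\<integral>\<^sup>+x\<^sub>2. ennreal (norm (indicator B x\<^sub>2 *\<^sub>R b\<^sub>2 x\<^sub>2)) \<partial>lborel)"
      by (rule nn_integral_multc) measurable
    also have "\<dots> < \<infinity>"
      using i unfolding set_integrable_def integrable_iff_bounded
      by (auto simp: ennreal_mult_less_top)
    finally show "(\<integral>\<^sup>+x. ennreal (norm (indicator (A \<times> B) x *\<^sub>R (b\<^sub>1 \<otimes>\<^sub>t b\<^sub>2) x)) \<partial>lborel) < \<infinity>" .
  qed measurable
  show "(LINT x:A \<times> B|lborel. (b\<^sub>1 \<otimes>\<^sub>t b\<^sub>2) x) = (LINT x:A|lborel. b\<^sub>1 x) * (LINT x:B|lborel. b\<^sub>2 x)"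
    unfolding set_integral_Times[OF int] by (simp add: tensor_def)
qed

lemma set_integral_sum_of:
  fixes h :: "'i \<Rightarrow> 'a \<Rightarrow> 'b::{banach, second_countable_topology}"
  assumes "\<And>j. j \<in> X \<Longrightarrow> set_integrable M A (h j)"
  shows "(LINT x:A|M. \<Sum>j\<in>X. h j x) = (\<Sum>j\<in>X. LINT x:A|M. h j x)"
  using assms unfolding set_lebesgue_integral_def set_integrable_def scaleR_sum_right
  by (rule Bochner_Integration.integral_sum)

lemma finite_subset_Times:
  assumes "finite F" "F \<subseteq> A \<times> B"
  obtains F1 F2 where "finite F1" "F1 \<subseteq> A" "finite F2" "F2 \<subseteq> B" "F \<subseteq> F1 \<times> F2"
proof (rule that[of "fst ` F" "snd ` F"])
  show "fst ` F \<subseteq> A" "snd ` F \<subseteq> B" using assms(2) by auto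
  show "F \<subseteq> fst ` F \<times> snd ` F" by (auto simp: image_iff) force+
qed (use assms in auto)

locale biaccretive = D: accretive D b\<^sub>1 M\<^sub>1 c\<^sub>1 + E: accretive E b\<^sub>2 M\<^sub>2 c\<^sub>2
  for D :: "(real ^ 'n) set set" and E :: "(real ^ 'm) set set"
    and b\<^sub>1 :: "real ^ 'n \<Rightarrow> complex" and b\<^sub>2 :: "real ^ 'm \<Rightarrow> complex" and M\<^sub>1 M\<^sub>2 c\<^sub>1 c\<^sub>2 :: real
begin

sublocale bigrid D E by unfold_locales

abbreviation b :: "(real ^ 'n) \<times> (real ^ 'm) \<Rightarrow> complex" where "b \<equiv> b\<^sub>1 \<otimes>\<^sub>t b\<^sub>2"

lemma b_measurable [measurable]: "b \<in> borel_measurable borel"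
  by (intro tensor_measurable D.b_measurable E.b_measurable)

lemma b_bounded: "AE x in lborel. norm (b x) \<le> M\<^sub>1 * M\<^sub>2"
proof -
  have "AE x in lborel \<Otimes>\<^sub>M lborel. norm (b x) \<le> M\<^sub>1 * M\<^sub>2"
  proof (rule lborel_pair.AE_pair_measure)
    have "AE x\<^sub>1 in lborel. AE x\<^sub>2 in lborel. norm (b (x\<^sub>1, x\<^sub>2)) \<le> M\<^sub>1 * M\<^sub>2"
      using D.b_bounded
    proof eventually_elim
      fix x\<^sub>1 assume x\<^sub>1: "norm (b\<^sub>1 x\<^sub>1) \<le> M\<^sub>1"
      show "AE x\<^sub>2 in lborel. norm (b (x\<^sub>1, x\<^sub>2)) \<le> M\<^sub>1 * M\<^sub>2"
        using E.b_bounded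
        by eventually_elim (use x\<^sub>1 D.M_pos in \<open>auto simp: tensor_def norm_mult intro!: mult_mono\<close>)
    qed
    then show "AE x in lborel. AE y in lborel. norm (b (x, y)) \<le> M\<^sub>1 * M\<^sub>2" .
    have [measurable]: "b \<in> borel_measurable (lborel \<Otimes>\<^sub>M lborel)" unfolding lborel_prod by simp
    show "{x \<in> space (lborel \<Otimes>\<^sub>M lborel). norm (b x) \<le> M\<^sub>1 * M\<^sub>2} \<in> sets (lborel \<Otimes>\<^sub>M lborel)"
      by measurable
  qed
  then show ?thesis unfolding lborel_prod .
qed

lemma emeasure_rect_finite: "K \<in> D \<Longrightarrow> V \<in> E \<Longrightarrow> emeasure lborel (K \<times> V) < \<infinity>"
  using D.emeasure_cell(2)[of K] E.emeasure_cell(2)[of V] by (simp add: emeasure_rect ennreal_mult_less_top)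

lemma b_rect_L2: "K \<in> D \<Longrightarrow> V \<in> E \<Longrightarrow> (\<lambda>x. b x * indicator (K \<times> V) x) \<in> L2"
  by (intro L2_bounded_indicator[OF b_measurable rect_borel emeasure_rect_finite b_bounded])

definition rint :: "((real ^ 'n) \<times> (real ^ 'm) \<Rightarrow> complex) \<Rightarrow> (real ^ 'n) set \<Rightarrow> (real ^ 'm) set \<Rightarrow> complex" where
  "rint g K V = (LINT x:K \<times> V|lborel. g x * b x)"

lemma mult_b_rect_integrable:
  assumes "K \<in> D" "V \<in> E" "g \<in> L2" shows "set_integrable lborel (K \<times> V) (\<lambda>x. g x * b x)"
proof -
  have "integrable lborel (\<lambda>x. g x * (b x * indicator (K \<times> V) x))"
    by (intro L2_mult_integrable b_rect_L2 assms)
  also have "(\<lambda>x. g x * (b x * indicator (K \<times> V) x)) = (\<lambda>x. indicator (K \<times> V) x *\<^sub>R (g x * b x))"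
    by (auto simp: indicator_def)
  finally show ?thesis unfolding set_integrable_def .
qed

lemma rint_children:
  assumes K: "K \<in> D" and V: "V \<in> E" and g: "g \<in> L2"
  shows "(\<Sum>I\<in>D.children K. rint g I V) = rint g K V" "(\<Sum>J\<in>E.children V. rint g K J) = rint g K V"
proof -
  have "(LINT x:(\<Union>I\<in>D.children K. I \<times> V)|lborel. g x * b x) = (\<Sum>I\<in>D.children K. rint g I V)"
    unfolding rint_def
    by (rule set_integral_finite_Union)
       (use D.finite_children[OF K] D.disjoint_family_children[of K] D.children_D rect_borel[OF _ V] mult_b_rect_integrable[OF _ V g]
         in \<open>auto simp: disjoint_family_on_def\<close>)
  moreover have "(\<Union>I\<in>D.children K. I \<times> V) = K \<times> V" using D.Union_children[OF K] by blast
  ultimately show "(\<Sum>I\<in>D.children K. rint g I V) = rint g K V" by (simp add: rint_def)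
  have "(LINT x:(\<Union>J\<in>E.children V. K \<times> J)|lborel. g x * b x) = (\<Sum>J\<in>E.children V. rint g K J)"
    unfolding rint_def
    by (rule set_integral_finite_Union)
       (use E.finite_children[OF V] E.disjoint_family_children[of V] E.children_D rect_borel[OF K] mult_b_rect_integrable[OF K _ g]
         in \<open>auto simp: disjoint_family_on_def\<close>)
  moreover have "(\<Union>J\<in>E.children V. K \<times> J) = K \<times> V" using E.Union_children[OF V] by blast
  ultimately show "(\<Sum>J\<in>E.children V. rint g K J) = rint g K V" by (simp add: rint_def)
qed

text \<open>By Fubini the denominator is the integral of \<open>b\<close> over the rectangle; the
  product form lets the two variables be treated separately.\<close>

definition rmean :: "((real ^ 'n) \<times> (real ^ 'm) \<Rightarrow> complex) \<Rightarrow> (real ^ 'n) set \<Rightarrow> (real ^ 'm) set \<Rightarrow> complex" where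
  "rmean g I J = rint g I J / (D.bint I * E.bint J)"

text \<open>Mixed second difference of the means: the value of the two-parameter martingale
  difference on a rectangle of children.\<close>

definition coef :: "((real ^ 'n) \<times> (real ^ 'm) \<Rightarrow> complex) \<Rightarrow> (real ^ 'n) set \<Rightarrow> (real ^ 'm) set
    \<Rightarrow> (real ^ 'n) set \<Rightarrow> (real ^ 'm) set \<Rightarrow> complex" where
  "coef g K V I J = rmean g I J - rmean g K J - rmean g I V + rmean g K V"

definition bistep :: "(real ^ 'n) set \<Rightarrow> (real ^ 'm) set \<Rightarrow> ((real ^ 'n) set \<Rightarrow> (real ^ 'm) set \<Rightarrow> complex)
    \<Rightarrow> (real ^ 'n) \<times> (real ^ 'm) \<Rightarrow> complex" where
  "bistep K V v x = (\<Sum>I\<in>D.children K. \<Sum>J\<in>E.children V. v I J * indicator I (fst x) * indicator J (snd x))"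

text \<open>Cancellation in each variable separately, for every child in the other one, and not
  merely over the whole rectangle. The support of the unweighted square function will rest on this
  stronger form.\<close>

definition bicancelling :: "(real ^ 'n) set \<Rightarrow> (real ^ 'm) set \<Rightarrow> ((real ^ 'n) set \<Rightarrow> (real ^ 'm) set \<Rightarrow> complex) \<Rightarrow> bool" where
  "bicancelling K V v \<longleftrightarrow> (\<forall>J\<in>E.children V. D.cancelling K (\<lambda>I. v I J)) \<and> (\<forall>I\<in>D.children K. E.cancelling V (v I))"

lemma bmean_section:
  assumes I: "I \<in> D" and J: "J \<in> E" and g: "g \<in> L2"
  shows "set_integrable lborel I (\<lambda>y. E.bmean (\<lambda>z. g (y, z)) J * b\<^sub>1 y)"
    "(LINT y:I|lborel. E.bmean (\<lambda>z. g (y, z)) J * b\<^sub>1 y) = rint g I J / E.bint J"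
proof -
  have eq: "E.bmean (\<lambda>z. g (y, z)) J * b\<^sub>1 y = (LINT z:J|lborel. g (y, z) * b (y, z)) / E.bint J" for y
  proof -
    have "(LINT z:J|lborel. g (y, z) * b (y, z)) = (LINT z:J|lborel. (g (y, z) * b\<^sub>2 z) * b\<^sub>1 y)"
      by (simp add: tensor_def mult_ac)
    then show ?thesis by simp
  qed
  note int = mult_b_rect_integrable[OF I J g]
  show "set_integrable lborel I (\<lambda>y. E.bmean (\<lambda>z. g (y, z)) J * b\<^sub>1 y)"
    unfolding eq by (intro set_integrable_divide set_integral_Times(2)[OF int])
  show "(LINT y:I|lborel. E.bmean (\<lambda>z. g (y, z)) J * b\<^sub>1 y) = rint g I J / E.bint J"
    unfolding eq rint_def set_integral_Times(1)[OF int] by (rule set_integral_divide_zero)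
qed

text \<open>Two applications of the one-variable formula; Fubini identifies the iterated means with
  \<open>rmean\<close>, and \<open>g \<in> L2\<close> supplies integrability of \<open>g b\<close>
  on rectangles.\<close>

theorem diff_rect_eq:
  assumes K: "K \<in> D" and V: "V \<in> E" and g: "g \<in> L2"
  shows "diff_rect D E b\<^sub>1 b\<^sub>2 K V g = bistep K V (coef g K V)"
proof
  fix x :: "(real ^ 'n) \<times> (real ^ 'm)"
  obtain x\<^sub>1 x\<^sub>2 where x: "x = (x\<^sub>1, x\<^sub>2)" by (cases x)
  let ?m = "\<lambda>y J. E.bmean (\<lambda>z. g (y, z)) J"
  \<comment> \<open>The section, at height \<open>x\<^sub>2\<close>, of the difference already taken
    in the second variable.\<close>
  define \<phi> where "\<phi> y = (\<Sum>J\<in>E.children V. (?m y J - ?m y V) * indicator J x\<^sub>2)" for y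
  have int: "(LINT y:I|lborel. \<phi> y * b\<^sub>1 y) / D.bint I
      = (\<Sum>J\<in>E.children V. (rmean g I J - rmean g I V) * indicator J x\<^sub>2)" if I: "I \<in> D" for I
  proof -
    have t: "set_integrable lborel I (\<lambda>y. (?m y J * b\<^sub>1 y - ?m y V * b\<^sub>1 y) * indicator J x\<^sub>2)"
      if "J \<in> E.children V" for J
      by (intro set_integrable_mult_left set_integral_diff(1) bmean_section I V E.children_D[OF that] g)
    have "(LINT y:I|lborel. \<phi> y * b\<^sub>1 y)
      = (LINT y:I|lborel. (\<Sum>J\<in>E.children V. (?m y J * b\<^sub>1 y - ?m y V * b\<^sub>1 y) * indicator J x\<^sub>2))"
    proof -
      have "((p - q) * i) * r = (p * r - q * r) * i" for p q r i :: complex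
        by (simp add: algebra_simps)
      then show ?thesis unfolding \<phi>_def sum_distrib_right by (simp only:)
    qed
    also have "\<dots> = (\<Sum>J\<in>E.children V. LINT y:I|lborel. (?m y J * b\<^sub>1 y - ?m y V * b\<^sub>1 y) * indicator J x\<^sub>2)"
      by (rule set_integral_sum_of[OF t])
    also have "\<dots> = (\<Sum>J\<in>E.children V. (rint g I J / E.bint J - rint g I V / E.bint V) * indicator J x\<^sub>2)"
    proof (rule sum.cong[OF refl])
      fix J assume J: "J \<in> E.children V"
      note JE = E.children_D[OF J]
      have "(LINT y:I|lborel. ?m y J * b\<^sub>1 y - ?m y V * b\<^sub>1 y) = rint g I J / E.bint J - rint g I V / E.bint V"
        unfolding bmean_section(2)[OF I JE g, symmetric] bmean_section(2)[OF I V g, symmetric]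
        by (rule set_integral_diff(2)[OF bmean_section(1)[OF I JE g] bmean_section(1)[OF I V g]])
      then show "(LINT y:I|lborel. (?m y J * b\<^sub>1 y - ?m y V * b\<^sub>1 y) * indicator J x\<^sub>2)
         = (rint g I J / E.bint J - rint g I V / E.bint V) * indicator J x\<^sub>2"
        by simp
    qed
    finally have "(LINT y:I|lborel. \<phi> y * b\<^sub>1 y)
      = (\<Sum>J\<in>E.children V. (rint g I J / E.bint J - rint g I V / E.bint V) * indicator J x\<^sub>2)" .
    moreover have "(p / e - q / f) * i / d = (p / (d * e) - q / (d * f)) * i" for p q e f i d :: complex
    proof -
      have "(p / e - q / f) * i / d = (p / e - q / f) / d * i" by simp
      then show ?thesis by (simp only: diff_divide_distrib divide_divide_eq_left mult.commute[of d])
    qed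
    ultimately show ?thesis by (simp only: rmean_def sum_divide_distrib)
  qed
  have "diff_rect D E b\<^sub>1 b\<^sub>2 K V g x = diff_cube D b\<^sub>1 K \<phi> x\<^sub>1"
    unfolding diff_rect_def in_fst_def in_snd_def x \<phi>_def by (simp add: E.diff_cube_eq[OF V])
  also have "\<dots> = (\<Sum>I\<in>D.children K.
      ((\<Sum>J\<in>E.children V. (rmean g I J - rmean g I V) * indicator J x\<^sub>2)
        - (\<Sum>J\<in>E.children V. (rmean g K J - rmean g K V) * indicator J x\<^sub>2)) * indicator I x\<^sub>1)"
    unfolding D.diff_cube_eq[OF K] by (intro sum.cong refl) (simp add: int K D.children_D)
  also have "\<dots> = bistep K V (coef g K V) x"
    unfolding bistep_def coef_def x sum_subtractf[symmetric] sum_distrib_right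
    by (intro sum.cong refl) (simp add: algebra_simps)
  finally show "diff_rect D E b\<^sub>1 b\<^sub>2 K V g x = bistep K V (coef g K V) x" .
qed

text \<open>\<open>rmean g K J\<close> is the average of the \<open>rmean g I J\<close> with complex
  weights \<open>D.bint I\<close>, and likewise in the second variable; differences from the parent
  therefore sum to zero against these weights.\<close>

lemma bicancelling_coef:
  assumes K: "K \<in> D" and V: "V \<in> E" and g: "g \<in> L2"
  shows "bicancelling K V (coef g K V)"
proof -
  have 1: "(\<Sum>I\<in>D.children K. (rmean g I J - rmean g K J) * D.bint I) = 0" if J: "J \<in> E" for J
  proof -
    have "(\<Sum>I\<in>D.children K. (rmean g I J - rmean g K J) * D.bint I)
       = (\<Sum>I\<in>D.children K. rint g I J) / E.bint J - rmean g K J * (\<Sum>I\<in>D.children K. D.bint I)"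
      unfolding left_diff_distrib sum_subtractf sum_distrib_left sum_divide_distrib
      by (intro arg_cong2[of _ _ _ _ "(-)"] sum.cong refl)
         (use D.bint_nonzero[OF D.children_D] in \<open>auto simp: rmean_def\<close>)
    also have "\<dots> = 0"
      using D.bint_nonzero[OF K] D.set_integral_children[OF K D.b_set_integrable[OF K]]
      by (simp add: rint_children(1)[OF K J g] rmean_def)
    finally show ?thesis .
  qed
  have 2: "(\<Sum>J\<in>E.children V. (rmean g I J - rmean g I V) * E.bint J) = 0" if I: "I \<in> D" for I
  proof -
    have "(\<Sum>J\<in>E.children V. (rmean g I J - rmean g I V) * E.bint J)
       = (\<Sum>J\<in>E.children V. rint g I J) / D.bint I - rmean g I V * (\<Sum>J\<in>E.children V. E.bint J)"
      unfolding left_diff_distrib sum_subtractf sum_distrib_left sum_divide_distrib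
      by (intro arg_cong2[of _ _ _ _ "(-)"] sum.cong refl)
         (use E.bint_nonzero[OF E.children_D] in \<open>auto simp: rmean_def\<close>)
    also have "\<dots> = 0"
      using E.bint_nonzero[OF V] E.set_integral_children[OF V E.b_set_integrable[OF V]]
      by (simp add: rint_children(2)[OF I V g] rmean_def)
    finally show ?thesis .
  qed
  show ?thesis
    unfolding bicancelling_def D.cancelling_def E.cancelling_def
  proof (intro conjI ballI)
    fix J assume J: "J \<in> E.children V"
    have "(\<Sum>I\<in>D.children K. coef g K V I J * D.bint I)
      = (\<Sum>I\<in>D.children K. (rmean g I J - rmean g K J) * D.bint I) - (\<Sum>I\<in>D.children K. (rmean g I V - rmean g K V) * D.bint I)"
      unfolding sum_subtractf[symmetric] by (intro sum.cong refl) (simp add: coef_def algebra_simps)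
    then show "(\<Sum>I\<in>D.children K. coef g K V I J * D.bint I) = 0"
      using 1[OF E.children_D[OF J]] 1[OF V] by simp
  next
    fix I assume I: "I \<in> D.children K"
    have "(\<Sum>J\<in>E.children V. coef g K V I J * E.bint J)
      = (\<Sum>J\<in>E.children V. (rmean g I J - rmean g I V) * E.bint J) - (\<Sum>J\<in>E.children V. (rmean g K J - rmean g K V) * E.bint J)"
      unfolding sum_subtractf[symmetric] by (intro sum.cong refl) (simp add: coef_def algebra_simps)
    then show "(\<Sum>J\<in>E.children V. coef g K V I J * E.bint J) = 0"
      using 2[OF D.children_D[OF I]] 2[OF K] by simp
  qed
qed

lemma bistep_measurable [measurable]: "bistep K V v \<in> borel_measurable borel"
proof -
  have [measurable]: "I \<in> sets borel" if "I \<in> D.children K" for I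
    using that by (intro D.borel_cell D.children_D)
  have [measurable]: "J \<in> sets borel" if "J \<in> E.children V" for J
    using that by (intro E.borel_cell E.children_D)
  show ?thesis unfolding bistep_def[abs_def] borel_prod[symmetric] by measurable
qed

lemma bistep_sections:
  "bistep K V v (x\<^sub>1, x\<^sub>2) = D.step_fun K (\<lambda>I. \<Sum>J\<in>E.children V. v I J * indicator J x\<^sub>2) x\<^sub>1"
  "bistep K V v (x\<^sub>1, x\<^sub>2) = E.step_fun V (\<lambda>J. \<Sum>I\<in>D.children K. v I J * indicator I x\<^sub>1) x\<^sub>2"
proof -
  show "bistep K V v (x\<^sub>1, x\<^sub>2) = D.step_fun K (\<lambda>I. \<Sum>J\<in>E.children V. v I J * indicator J x\<^sub>2) x\<^sub>1"
    unfolding bistep_def D.step_fun_def sum_distrib_right fst_conv snd_conv by (simp add: mult_ac)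
  show "bistep K V v (x\<^sub>1, x\<^sub>2) = E.step_fun V (\<lambda>J. \<Sum>I\<in>D.children K. v I J * indicator I x\<^sub>1) x\<^sub>2"
    unfolding bistep_def E.step_fun_def sum_distrib_right fst_conv snd_conv by (subst sum.swap) simp
qed

lemma bistep_eq_0: "x \<notin> K \<times> V \<Longrightarrow> bistep K V v x = 0"
  unfolding bistep_def using D.children_subset[of _ K] E.children_subset[of _ V]
  by (intro sum.neutral ballI) (cases x, auto simp: indicator_def)

lemma bistep_add: "bistep K V v x + bistep K V v' x = bistep K V (\<lambda>I J. v I J + v' I J) x"
  by (simp add: bistep_def sum.distrib[symmetric] algebra_simps)

lemma bistep_scale: "c * bistep K V v x = bistep K V (\<lambda>I J. c * v I J) x"
  by (simp add: bistep_def sum_distrib_left mult_ac)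

lemma bicancelling_scale: "bicancelling K V v \<Longrightarrow> bicancelling K V (\<lambda>I J. c * v I J)"
  unfolding bicancelling_def D.cancelling_def E.cancelling_def
  by (simp add: mult.assoc sum_distrib_left[symmetric])

definition A\<^sub>S :: real where "A\<^sub>S = (56 * (M\<^sub>1 / c\<^sub>1) ^ 4) * (56 * (M\<^sub>2 / c\<^sub>2) ^ 4)"

lemma A\<^sub>S_pos: "0 < A\<^sub>S"
  unfolding A\<^sub>S_def using D.M_pos E.M_pos D.c_pos E.c_pos by simp

text \<open>With the second coordinate frozen, the one-parameter bound removes the differences in
  the first variable and leaves \<open>G V\<close>; with the first one frozen, it removes the
  differences that form \<open>G V\<close>. The terms are nonnegative, so \<open>F\<close> may be
  enlarged to a product set as the iteration requires.\<close>

theorem bi_square_function_bound: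
  assumes F: "finite F" "F \<subseteq> D \<times> E" and g [measurable]: "g \<in> borel_measurable borel"
  shows "(\<Sum>(K, V)\<in>F. \<integral>\<^sup>+x. ennreal ((norm (diff_rect D E b\<^sub>1 b\<^sub>2 K V g x))\<^sup>2) \<partial>lborel)
    \<le> ennreal A\<^sub>S * (\<integral>\<^sup>+x. ennreal ((norm (g x))\<^sup>2) \<partial>lborel)"
proof -
  obtain F1 F2 where F12: "finite F1" "F1 \<subseteq> D" "finite F2" "F2 \<subseteq> E" "F \<subseteq> F1 \<times> F2"
    by (rule finite_subset_Times[OF F])
  have [measurable]: "g \<in> borel_measurable (borel \<Otimes>\<^sub>M borel)" using g by (simp add: borel_prod)
  define G where "G V x = diff_cube E b\<^sub>2 V (\<lambda>z. g (fst x, z)) (snd x)" for V x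
  have G [measurable]: "G V \<in> borel_measurable borel" if V: "V \<in> E" for V
  proof -
    have [measurable]: "J \<in> sets borel" if "J \<in> E.children V" for J
      using that by (intro E.borel_cell E.children_D)
    have [measurable]: "V \<in> sets borel" by (rule E.borel_cell[OF V])
    show ?thesis
      unfolding G_def[abs_def] E.diff_cube_eq[OF V] set_lebesgue_integral_def borel_prod[symmetric] by measurable
  qed
  have dG: "diff_rect D E b\<^sub>1 b\<^sub>2 K V g (x\<^sub>1, x\<^sub>2) = diff_cube D b\<^sub>1 K (\<lambda>y. G V (y, x\<^sub>2)) x\<^sub>1" for K V x\<^sub>1 x\<^sub>2
    by (simp add: diff_rect_def in_fst_def in_snd_def G_def)
  have dr [measurable]: "diff_rect D E b\<^sub>1 b\<^sub>2 K V g \<in> borel_measurable borel" if K: "K \<in> D" and V: "V \<in> E" for K V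
  proof -
    have [measurable]: "I \<in> sets borel" if "I \<in> D.children K" for I
      using that by (intro D.borel_cell D.children_D)
    have [measurable]: "K \<in> sets borel" by (rule D.borel_cell[OF K])
    have [measurable]: "G V \<in> borel_measurable (borel \<Otimes>\<^sub>M borel)" using G[OF V] by (simp add: borel_prod)
    have eq: "diff_rect D E b\<^sub>1 b\<^sub>2 K V g = (\<lambda>x. diff_cube D b\<^sub>1 K (\<lambda>y. G V (y, snd x)) (fst x))"
      by (auto simp: dG)
    show ?thesis
      unfolding eq D.diff_cube_eq[OF K] set_lebesgue_integral_def borel_prod[symmetric] by measurable
  qed
  let ?n = "\<lambda>u. ennreal ((norm (u :: complex))\<^sup>2)"
  have "(\<Sum>(K, V)\<in>F. \<integral>\<^sup>+x. ?n (diff_rect D E b\<^sub>1 b\<^sub>2 K V g x) \<partial>lborel)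
    \<le> (\<Sum>(K, V)\<in>F1 \<times> F2. \<integral>\<^sup>+x. ?n (diff_rect D E b\<^sub>1 b\<^sub>2 K V g x) \<partial>lborel)"
    by (rule sum_mono2) (use F12 in auto)
  also have "\<dots> = (\<Sum>V\<in>F2. \<Sum>K\<in>F1. \<integral>\<^sup>+x. ?n (diff_rect D E b\<^sub>1 b\<^sub>2 K V g x) \<partial>lborel)"
    by (subst sum.cartesian_product[symmetric], rule sum.swap)
  also have "\<dots> \<le> (\<Sum>V\<in>F2. ennreal (56 * (M\<^sub>1 / c\<^sub>1) ^ 4) * (\<integral>\<^sup>+x. ?n (G V x) \<partial>lborel))"
  proof (rule sum_mono)
    fix V assume "V \<in> F2"
    then have V: "V \<in> E" using F12 by auto
    have [measurable]: "G V \<in> borel_measurable borel" "G V \<in> borel_measurable (borel \<Otimes>\<^sub>M borel)"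
      using G[OF V] by (auto simp: borel_prod)
    have [measurable]: "diff_rect D E b\<^sub>1 b\<^sub>2 K V g \<in> borel_measurable (borel \<Otimes>\<^sub>M borel)" if "K \<in> F1" for K
      using dr[OF _ V, of K] that F12 by (auto simp: borel_prod)
    have "(\<Sum>K\<in>F1. \<integral>\<^sup>+x. ?n (diff_rect D E b\<^sub>1 b\<^sub>2 K V g x) \<partial>lborel)
      = (\<Sum>K\<in>F1. \<integral>\<^sup>+x\<^sub>2. \<integral>\<^sup>+x\<^sub>1. ?n (diff_rect D E b\<^sub>1 b\<^sub>2 K V g (x\<^sub>1, x\<^sub>2)) \<partial>lborel \<partial>lborel)"
      using F12 V by (intro sum.cong refl nn_integral_lborel_iterated(2)) (auto intro!: measurable_compose[OF dr])
    also have "\<dots> = (\<integral>\<^sup>+x\<^sub>2. (\<Sum>K\<in>F1. \<integral>\<^sup>+x\<^sub>1. ?n (diff_rect D E b\<^sub>1 b\<^sub>2 K V g (x\<^sub>1, x\<^sub>2)) \<partial>lborel) \<partial>lborel)"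
      by (rule nn_integral_sum[symmetric]) measurable
    also have "\<dots> \<le> (\<integral>\<^sup>+x\<^sub>2. ennreal (56 * (M\<^sub>1 / c\<^sub>1) ^ 4) * (\<integral>\<^sup>+x\<^sub>1. ?n (G V (x\<^sub>1, x\<^sub>2)) \<partial>lborel) \<partial>lborel)"
      unfolding dG by (intro nn_integral_mono D.square_function_bound F12) measurable
    also have "\<dots> = ennreal (56 * (M\<^sub>1 / c\<^sub>1) ^ 4) * (\<integral>\<^sup>+x\<^sub>2. \<integral>\<^sup>+x\<^sub>1. ?n (G V (x\<^sub>1, x\<^sub>2)) \<partial>lborel \<partial>lborel)"
      by (rule nn_integral_cmult) measurable
    also have "(\<integral>\<^sup>+x\<^sub>2. \<integral>\<^sup>+x\<^sub>1. ?n (G V (x\<^sub>1, x\<^sub>2)) \<partial>lborel \<partial>lborel) = (\<integral>\<^sup>+x. ?n (G V x) \<partial>lborel)"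
      by (rule nn_integral_lborel_iterated(2)[symmetric]) measurable
    finally show "(\<Sum>K\<in>F1. \<integral>\<^sup>+x. ?n (diff_rect D E b\<^sub>1 b\<^sub>2 K V g x) \<partial>lborel)
      \<le> ennreal (56 * (M\<^sub>1 / c\<^sub>1) ^ 4) * (\<integral>\<^sup>+x. ?n (G V x) \<partial>lborel)" .
  qed
  also have "\<dots> = ennreal (56 * (M\<^sub>1 / c\<^sub>1) ^ 4) * (\<Sum>V\<in>F2. \<integral>\<^sup>+x. ?n (G V x) \<partial>lborel)"
    by (rule sum_distrib_left[symmetric])
  also have "(\<Sum>V\<in>F2. \<integral>\<^sup>+x. ?n (G V x) \<partial>lborel) \<le> ennreal (56 * (M\<^sub>2 / c\<^sub>2) ^ 4) * (\<integral>\<^sup>+x. ?n (g x) \<partial>lborel)"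
  proof -
    have [measurable]: "G V \<in> borel_measurable (borel \<Otimes>\<^sub>M borel)" if "V \<in> F2" for V
      using G[of V] that F12 by (auto simp: borel_prod)
    have "(\<Sum>V\<in>F2. \<integral>\<^sup>+x. ?n (G V x) \<partial>lborel) = (\<Sum>V\<in>F2. \<integral>\<^sup>+x\<^sub>1. \<integral>\<^sup>+x\<^sub>2. ?n (G V (x\<^sub>1, x\<^sub>2)) \<partial>lborel \<partial>lborel)"
      using F12 by (intro sum.cong refl nn_integral_lborel_iterated(1)) (auto intro!: measurable_compose[OF G])
    also have "\<dots> = (\<integral>\<^sup>+x\<^sub>1. (\<Sum>V\<in>F2. \<integral>\<^sup>+x\<^sub>2. ?n (G V (x\<^sub>1, x\<^sub>2)) \<partial>lborel) \<partial>lborel)"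
      by (rule nn_integral_sum[symmetric]) measurable
    also have "\<dots> \<le> (\<integral>\<^sup>+x\<^sub>1. ennreal (56 * (M\<^sub>2 / c\<^sub>2) ^ 4) * (\<integral>\<^sup>+x\<^sub>2. ?n (g (x\<^sub>1, x\<^sub>2)) \<partial>lborel) \<partial>lborel)"
      unfolding G_def fst_conv snd_conv by (intro nn_integral_mono E.square_function_bound F12) measurable
    also have "\<dots> = ennreal (56 * (M\<^sub>2 / c\<^sub>2) ^ 4) * (\<integral>\<^sup>+x\<^sub>1. \<integral>\<^sup>+x\<^sub>2. ?n (g (x\<^sub>1, x\<^sub>2)) \<partial>lborel \<partial>lborel)"
      by (rule nn_integral_cmult) measurable
    also have "(\<integral>\<^sup>+x\<^sub>1. \<integral>\<^sup>+x\<^sub>2. ?n (g (x\<^sub>1, x\<^sub>2)) \<partial>lborel \<partial>lborel) = (\<integral>\<^sup>+x. ?n (g x) \<partial>lborel)"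
      by (rule nn_integral_lborel_iterated(1)[symmetric]) measurable
    finally show ?thesis .
  qed
  also have "ennreal (56 * (M\<^sub>1 / c\<^sub>1) ^ 4) * (ennreal (56 * (M\<^sub>2 / c\<^sub>2) ^ 4) * (\<integral>\<^sup>+x. ?n (g x) \<partial>lborel))
      = ennreal A\<^sub>S * (\<integral>\<^sup>+x. ?n (g x) \<partial>lborel)"
    unfolding A\<^sub>S_def by (subst ennreal_mult) (simp_all add: mult.assoc)
  finally show ?thesis by (simp add: mult_left_mono)
qed

end

section \<open>Dual bound and cancellation on rectangles\<close>

context biaccretive
begin

lemma b_bistep_L2:
  assumes "K \<in> D" "V \<in> E" shows "(\<lambda>x. b x * bistep K V v x) \<in> L2"
proof -
  have "(\<lambda>x. \<Sum>I\<in>D.children K. \<Sum>J\<in>E.children V. v I J * (b x * indicator (I \<times> J) x)) \<in> L2"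
    by (intro L2_sum L2_scale b_rect_L2 D.children_D E.children_D)
  also have "(\<lambda>x. \<Sum>I\<in>D.children K. \<Sum>J\<in>E.children V. v I J * (b x * indicator (I \<times> J) x)) = (\<lambda>x. b x * bistep K V v x)"
    unfolding bistep_def sum_distrib_left by (auto simp: indicator_times mult_ac)
  finally show ?thesis .
qed

definition A\<^sub>d :: real where
  "A\<^sub>d = (56 * (M\<^sub>1 / c\<^sub>1) ^ 4 * M\<^sub>1\<^sup>2) * (56 * (M\<^sub>2 / c\<^sub>2) ^ 4 * M\<^sub>2\<^sup>2)"

lemma A\<^sub>d_pos: "0 < A\<^sub>d"
  unfolding A\<^sub>d_def using D.M_pos E.M_pos D.c_pos E.c_pos by simp

text \<open>The dual form of the same iteration: for fixed \<open>x\<^sub>1\<close> the inner sum,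
  including its factor \<open>b\<^sub>1\<close>, is a step function of \<open>x\<^sub>2\<close> with
  cancelling coefficients, so the one-parameter dual bound applies in each variable in turn.\<close>

theorem bi_dual_bound:
  assumes F: "finite F" "F \<subseteq> D \<times> E" and canc: "\<And>K V. (K, V) \<in> F \<Longrightarrow> bicancelling K V (v K V)"
  shows "(\<integral>\<^sup>+x. ennreal ((norm (\<Sum>(K, V)\<in>F. b x * bistep K V (v K V) x))\<^sup>2) \<partial>lborel)
    \<le> ennreal A\<^sub>d * (\<Sum>(K, V)\<in>F. \<integral>\<^sup>+x. ennreal ((norm (bistep K V (v K V) x))\<^sup>2) \<partial>lborel)"
proof -
  obtain F1 F2 where F12: "finite F1" "F1 \<subseteq> D" "finite F2" "F2 \<subseteq> E" "F \<subseteq> F1 \<times> F2"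
    by (rule finite_subset_Times[OF F])
  \<comment> \<open>The terms are not nonnegative here, so the passage to a product set is made with
    zero coefficients outside \<open>F\<close>, which are trivially cancelling.\<close>
  define v' where "v' K V = (if (K, V) \<in> F then v K V else (\<lambda>_ _. 0))" for K V
  have c1: "D.cancelling K (\<lambda>I. v' K V I J)" if "J \<in> E.children V" for K V J
    using canc[of K V] that by (auto simp: v'_def bicancelling_def D.cancelling_def)
  have c2: "E.cancelling V (v' K V I)" if "I \<in> D.children K" for K V I
    using canc[of K V] that by (auto simp: v'_def bicancelling_def E.cancelling_def)
  let ?n = "\<lambda>u. ennreal ((norm (u :: complex))\<^sup>2)"
  let ?\<phi> = "\<lambda>K V. bistep K V (v' K V)"
  have \<phi>0: "?\<phi> K V x = 0" if "(K, V) \<notin> F" for K V x using that by (simp add: v'_def bistep_def)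
  have [measurable]: "bistep K V w \<in> borel_measurable (borel \<Otimes>\<^sub>M borel)" for K V w
    using bistep_measurable[of K V w] by (simp add: borel_prod)
  note [measurable] = D.b_measurable E.b_measurable
  have sum_eq: "(\<Sum>(K, V)\<in>F. b x * bistep K V (v K V) x) = b\<^sub>2 (snd x) * (\<Sum>V\<in>F2. b\<^sub>1 (fst x) * (\<Sum>K\<in>F1. ?\<phi> K V x))" for x
  proof -
    have "(\<Sum>(K, V)\<in>F. b x * bistep K V (v K V) x) = (\<Sum>(K, V)\<in>F. b x * ?\<phi> K V x)"
      by (intro sum.cong) (auto simp: v'_def)
    also have "\<dots> = (\<Sum>(K, V)\<in>F1 \<times> F2. b x * ?\<phi> K V x)"
    proof (rule sum.mono_neutral_left)
      show "\<forall>P\<in>F1 \<times> F2 - F. (case P of (K, V) \<Rightarrow> b x * ?\<phi> K V x) = 0"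
        by (intro ballI) (simp add: split_beta \<phi>0)
    qed (use F12 in auto)
    also have "\<dots> = (\<Sum>V\<in>F2. \<Sum>K\<in>F1. b x * ?\<phi> K V x)"
      by (subst sum.cartesian_product[symmetric], rule sum.swap)
    also have "\<dots> = b\<^sub>2 (snd x) * (\<Sum>V\<in>F2. b\<^sub>1 (fst x) * (\<Sum>K\<in>F1. ?\<phi> K V x))"
      by (simp add: sum_distrib_left tensor_def split_beta mult_ac)
    finally show ?thesis .
  qed
  define w where "w x\<^sub>1 V J = b\<^sub>1 x\<^sub>1 * (\<Sum>K\<in>F1. \<Sum>I\<in>D.children K. v' K V I J * indicator I x\<^sub>1)" for x\<^sub>1 V J
  have w_step: "b\<^sub>1 x\<^sub>1 * (\<Sum>K\<in>F1. ?\<phi> K V (x\<^sub>1, x\<^sub>2)) = E.step_fun V (w x\<^sub>1 V) x\<^sub>2" for x\<^sub>1 x\<^sub>2 V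
    unfolding w_def E.step_fun_def bistep_sections(2) sum_distrib_left sum_distrib_right
    by (subst sum.swap) (simp add: mult_ac)
  have w_canc: "E.cancelling V (w x\<^sub>1 V)" for x\<^sub>1 V
  proof -
    have "(\<Sum>J\<in>E.children V. w x\<^sub>1 V J * E.bint J)
      = b\<^sub>1 x\<^sub>1 * (\<Sum>K\<in>F1. \<Sum>I\<in>D.children K. indicator I x\<^sub>1 * (\<Sum>J\<in>E.children V. v' K V I J * E.bint J))"
      unfolding w_def sum_distrib_left sum_distrib_right
      by (subst sum.swap, intro sum.cong refl, subst sum.swap) (simp add: mult_ac)
    also have "\<dots> = 0"
      using c2 unfolding E.cancelling_def by simp
    finally show ?thesis unfolding E.cancelling_def .
  qed
  have "(\<integral>\<^sup>+x. ?n (\<Sum>(K, V)\<in>F. b x * bistep K V (v K V) x) \<partial>lborel)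
    = (\<integral>\<^sup>+x\<^sub>1. \<integral>\<^sup>+x\<^sub>2. ?n (b\<^sub>2 x\<^sub>2 * (\<Sum>V\<in>F2. E.step_fun V (w x\<^sub>1 V) x\<^sub>2)) \<partial>lborel \<partial>lborel)"
    unfolding sum_eq
    by (subst nn_integral_lborel_iterated(1)) (simp_all add: w_step borel_prod[symmetric])
  also have "\<dots> \<le> (\<integral>\<^sup>+x\<^sub>1. ennreal (56 * (M\<^sub>2 / c\<^sub>2) ^ 4 * M\<^sub>2\<^sup>2) * (\<Sum>V\<in>F2. \<integral>\<^sup>+x\<^sub>2. ?n (E.step_fun V (w x\<^sub>1 V) x\<^sub>2) \<partial>lborel) \<partial>lborel)"
    by (intro nn_integral_mono E.dual_square_function_bound F12 w_canc)
  also have "\<dots> = ennreal (56 * (M\<^sub>2 / c\<^sub>2) ^ 4 * M\<^sub>2\<^sup>2) * (\<integral>\<^sup>+x\<^sub>1. (\<Sum>V\<in>F2. \<integral>\<^sup>+x\<^sub>2. ?n (E.step_fun V (w x\<^sub>1 V) x\<^sub>2) \<partial>lborel) \<partial>lborel)"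
    unfolding w_step[symmetric] by (rule nn_integral_cmult) measurable
  also have "(\<integral>\<^sup>+x\<^sub>1. (\<Sum>V\<in>F2. \<integral>\<^sup>+x\<^sub>2. ?n (E.step_fun V (w x\<^sub>1 V) x\<^sub>2) \<partial>lborel) \<partial>lborel)
     = (\<Sum>V\<in>F2. \<integral>\<^sup>+x\<^sub>1. \<integral>\<^sup>+x\<^sub>2. ?n (b\<^sub>1 x\<^sub>1 * (\<Sum>K\<in>F1. ?\<phi> K V (x\<^sub>1, x\<^sub>2))) \<partial>lborel \<partial>lborel)"
    unfolding w_step[symmetric] by (rule nn_integral_sum) measurable
  also have "\<dots> \<le> (\<Sum>V\<in>F2. ennreal (56 * (M\<^sub>1 / c\<^sub>1) ^ 4 * M\<^sub>1\<^sup>2) * (\<Sum>K\<in>F1. \<integral>\<^sup>+x. ?n (?\<phi> K V x) \<partial>lborel))"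
  proof (rule sum_mono)
    fix V assume "V \<in> F2"
    have "(\<integral>\<^sup>+x\<^sub>1. \<integral>\<^sup>+x\<^sub>2. ?n (b\<^sub>1 x\<^sub>1 * (\<Sum>K\<in>F1. ?\<phi> K V (x\<^sub>1, x\<^sub>2))) \<partial>lborel \<partial>lborel)
      = (\<integral>\<^sup>+x\<^sub>2. \<integral>\<^sup>+x\<^sub>1. ?n (b\<^sub>1 x\<^sub>1 * (\<Sum>K\<in>F1. ?\<phi> K V (x\<^sub>1, x\<^sub>2))) \<partial>lborel \<partial>lborel)"
      using nn_integral_lborel_iterated[of "\<lambda>x. ?n (b\<^sub>1 (fst x) * (\<Sum>K\<in>F1. ?\<phi> K V x))"]
      by (simp add: borel_prod[symmetric])
    also have "\<dots> \<le> (\<integral>\<^sup>+x\<^sub>2. ennreal (56 * (M\<^sub>1 / c\<^sub>1) ^ 4 * M\<^sub>1\<^sup>2) * (\<Sum>K\<in>F1. \<integral>\<^sup>+x\<^sub>1. ?n (?\<phi> K V (x\<^sub>1, x\<^sub>2)) \<partial>lborel) \<partial>lborel)"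
      unfolding bistep_sections(1)
    proof (intro nn_integral_mono D.dual_square_function_bound F12)
      fix x\<^sub>2 K
      have "(\<Sum>I\<in>D.children K. (\<Sum>J\<in>E.children V. v' K V I J * indicator J x\<^sub>2) * D.bint I)
        = (\<Sum>J\<in>E.children V. indicator J x\<^sub>2 * (\<Sum>I\<in>D.children K. v' K V I J * D.bint I))"
        unfolding sum_distrib_left sum_distrib_right by (subst sum.swap) (simp add: mult_ac)
      also have "\<dots> = 0" using c1 unfolding D.cancelling_def by simp
      finally show "D.cancelling K (\<lambda>I. \<Sum>J\<in>E.children V. v' K V I J * indicator J x\<^sub>2)"
        unfolding D.cancelling_def .
    qed
    also have "\<dots> = ennreal (56 * (M\<^sub>1 / c\<^sub>1) ^ 4 * M\<^sub>1\<^sup>2) * (\<integral>\<^sup>+x\<^sub>2. (\<Sum>K\<in>F1. \<integral>\<^sup>+x\<^sub>1. ?n (?\<phi> K V (x\<^sub>1, x\<^sub>2)) \<partial>lborel) \<partial>lborel)"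
      by (rule nn_integral_cmult) measurable
    also have "(\<integral>\<^sup>+x\<^sub>2. (\<Sum>K\<in>F1. \<integral>\<^sup>+x\<^sub>1. ?n (?\<phi> K V (x\<^sub>1, x\<^sub>2)) \<partial>lborel) \<partial>lborel)
      = (\<Sum>K\<in>F1. \<integral>\<^sup>+x\<^sub>2. \<integral>\<^sup>+x\<^sub>1. ?n (?\<phi> K V (x\<^sub>1, x\<^sub>2)) \<partial>lborel \<partial>lborel)"
      by (rule nn_integral_sum) measurable
    also have "\<dots> = (\<Sum>K\<in>F1. \<integral>\<^sup>+x. ?n (?\<phi> K V x) \<partial>lborel)"
      by (intro sum.cong refl nn_integral_lborel_iterated(2)[symmetric]) measurable
    finally show "(\<integral>\<^sup>+x\<^sub>1. \<integral>\<^sup>+x\<^sub>2. ?n (b\<^sub>1 x\<^sub>1 * (\<Sum>K\<in>F1. ?\<phi> K V (x\<^sub>1, x\<^sub>2))) \<partial>lborel \<partial>lborel)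
      \<le> ennreal (56 * (M\<^sub>1 / c\<^sub>1) ^ 4 * M\<^sub>1\<^sup>2) * (\<Sum>K\<in>F1. \<integral>\<^sup>+x. ?n (?\<phi> K V x) \<partial>lborel)" .
  qed
  also have "\<dots> = ennreal (56 * (M\<^sub>1 / c\<^sub>1) ^ 4 * M\<^sub>1\<^sup>2) * (\<Sum>V\<in>F2. \<Sum>K\<in>F1. \<integral>\<^sup>+x. ?n (?\<phi> K V x) \<partial>lborel)"
    by (rule sum_distrib_left[symmetric])
  also have "(\<Sum>V\<in>F2. \<Sum>K\<in>F1. \<integral>\<^sup>+x. ?n (?\<phi> K V x) \<partial>lborel) = (\<Sum>(K, V)\<in>F1 \<times> F2. \<integral>\<^sup>+x. ?n (?\<phi> K V x) \<partial>lborel)"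
    by (subst sum.cartesian_product[symmetric], rule sum.swap)
  also have "\<dots> = (\<Sum>(K, V)\<in>F. \<integral>\<^sup>+x. ?n (?\<phi> K V x) \<partial>lborel)"
  proof (rule sum.mono_neutral_right)
    show "\<forall>P\<in>F1 \<times> F2 - F. (case P of (K, V) \<Rightarrow> \<integral>\<^sup>+x. ?n (?\<phi> K V x) \<partial>lborel) = 0"
      by (intro ballI) (simp add: split_beta \<phi>0)
  qed (use F12 in auto)
  also have "\<dots> = (\<Sum>(K, V)\<in>F. \<integral>\<^sup>+x. ?n (bistep K V (v K V) x) \<partial>lborel)"
    by (intro sum.cong) (auto simp: v'_def)
  also have "ennreal (56 * (M\<^sub>2 / c\<^sub>2) ^ 4 * M\<^sub>2\<^sup>2) * (ennreal (56 * (M\<^sub>1 / c\<^sub>1) ^ 4 * M\<^sub>1\<^sup>2) * (\<Sum>(K, V)\<in>F. \<integral>\<^sup>+x. ?n (bistep K V (v K V) x) \<partial>lborel))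
    = ennreal A\<^sub>d * (\<Sum>(K, V)\<in>F. \<integral>\<^sup>+x. ?n (bistep K V (v K V) x) \<partial>lborel)"
    unfolding A\<^sub>d_def by (subst ennreal_mult) (simp_all add: mult_ac)
  finally show ?thesis by (simp add: mult_left_mono)
qed

text \<open>In a coordinate in which \<open>x\<close> leaves \<open>K \<times> V\<close>, the cell
  of \<open>A \<times> B\<close> is not contained in that of \<open>K \<times> V\<close>. By
  nestedness it misses that cell or contains it, and in the second case cancellation in this
  variable alone kills the integral.\<close>

lemma b_bistep_set_integral_eq_0:
  assumes K: "K \<in> D" and V: "V \<in> E" and A: "A \<in> D" and B: "B \<in> E"
    and canc: "bicancelling K V v" and x: "x \<in> A \<times> B" "x \<notin> K \<times> V"
  shows "(LINT y:A \<times> B|lborel. b y * bistep K V v y) = 0"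
proof -
  \<comment> \<open>In the decisive variable the factor \<open>p\<close> or \<open>q\<close> is
    either zero or the full integral over the child; in the other variable a partial overlap may
    occur but is never evaluated.\<close>
  define p where "p I = (LINT y:A \<inter> I|lborel. b\<^sub>1 y)" for I
  define q where "q J = (LINT y:B \<inter> J|lborel. b\<^sub>2 y)" for J
  note [measurable] = D.b_measurable E.b_measurable D.borel_cell[OF A] E.borel_cell[OF B]
  have pq: "set_integrable lborel ((A \<inter> I) \<times> (B \<inter> J)) b \<and> (LINT y:(A \<inter> I) \<times> (B \<inter> J)|lborel. b y) = p I * q J"
    if I: "I \<in> D.children K" and J: "J \<in> E.children V" for I J
  proof -
    note [measurable] = D.borel_cell[OF D.children_D[OF I]] E.borel_cell[OF E.children_D[OF J]]
    have 1: "set_integrable lborel (A \<inter> I) b\<^sub>1"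
      by (rule set_integrable_subset[OF D.b_set_integrable[OF A]]) auto
    have 2: "set_integrable lborel (B \<inter> J) b\<^sub>2"
      by (rule set_integrable_subset[OF E.b_set_integrable[OF B]]) auto
    show ?thesis unfolding p_def q_def by (intro conjI set_integral_tensor 1 2) measurable
  qed
  have pt: "indicator (A \<times> B) y *\<^sub>R (b y * bistep K V v y)
    = (\<Sum>I\<in>D.children K. \<Sum>J\<in>E.children V. v I J * (indicator ((A \<inter> I) \<times> (B \<inter> J)) y *\<^sub>R b y))" for y
    unfolding bistep_def sum_distrib_left scaleR_sum_right
    by (intro sum.cong refl) (auto simp: indicator_def mem_Times_iff)
  have "(LINT y:A \<times> B|lborel. b y * bistep K V v y)
    = (\<Sum>I\<in>D.children K. \<Sum>J\<in>E.children V. v I J * (p I * q J))"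
  proof -
    let ?t = "\<lambda>I J y. v I J * (indicator ((A \<inter> I) \<times> (B \<inter> J)) y *\<^sub>R b y)"
    have t: "(LINT y|lborel. ?t I J y) = v I J * (p I * q J)" "integrable lborel (?t I J)"
      if "I \<in> D.children K" "J \<in> E.children V" for I J
    proof -
      show "(LINT y|lborel. ?t I J y) = v I J * (p I * q J)"
        using pq[OF that] unfolding set_lebesgue_integral_def by (simp only: integral_mult_right_zero)
      show "integrable lborel (?t I J)"
        using pq[OF that] unfolding set_integrable_def by (intro integrable_mult_right) blast
    qed
    have "(LINT y:A \<times> B|lborel. b y * bistep K V v y)
      = (LINT y|lborel. (\<Sum>I\<in>D.children K. \<Sum>J\<in>E.children V. ?t I J y))"
      unfolding set_lebesgue_integral_def pt ..
    also have "\<dots> = (\<Sum>I\<in>D.children K. LINT y|lborel. (\<Sum>J\<in>E.children V. ?t I J y))"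
      by (intro Bochner_Integration.integral_sum Bochner_Integration.integrable_sum t)
    also have "\<dots> = (\<Sum>I\<in>D.children K. \<Sum>J\<in>E.children V. LINT y|lborel. ?t I J y)"
      by (intro sum.cong refl Bochner_Integration.integral_sum t)
    also have "\<dots> = (\<Sum>I\<in>D.children K. \<Sum>J\<in>E.children V. v I J * (p I * q J))"
      by (intro sum.cong refl t)
    finally show ?thesis .
  qed
  also have "\<dots> = 0"
  proof -
    obtain x\<^sub>1 x\<^sub>2 where x12: "x = (x\<^sub>1, x\<^sub>2)" by (cases x)
    from x consider "x\<^sub>1 \<in> A" "x\<^sub>1 \<notin> K" | "x\<^sub>2 \<in> B" "x\<^sub>2 \<notin> V" by (auto simp: x12)
    then show ?thesis
    proof cases
      case 1
      then consider "K \<subseteq> A" | "A \<inter> K = {}" using D.subset_or_disjoint[OF A K] by blast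
      then show ?thesis
      proof cases
        case 1
        then have "p I = D.bint I" if "I \<in> D.children K" for I
          using D.children_subset[OF that] by (auto simp: p_def Int_absorb1)
        then have "(\<Sum>I\<in>D.children K. v I J * (p I * q J)) = (\<Sum>I\<in>D.children K. v I J * D.bint I) * q J" for J
          by (simp add: sum_distrib_right mult.assoc)
        then have "(\<Sum>I\<in>D.children K. v I J * (p I * q J)) = 0" if "J \<in> E.children V" for J
          using canc that by (simp add: bicancelling_def D.cancelling_def)
        then show ?thesis by (subst sum.swap) simp
      next
        case 2
        then have "p I = 0" if "I \<in> D.children K" for I
        proof -
          have "A \<inter> I = {}" using 2 D.children_subset[OF that] by blast
          then show ?thesis by (simp add: p_def set_lebesgue_integral_def)
        qed
        then show ?thesis by simp
      qed
    next
      case 2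
      then consider "V \<subseteq> B" | "B \<inter> V = {}" using E.subset_or_disjoint[OF B V] by blast
      then show ?thesis
      proof cases
        case 1
        then have "q J = E.bint J" if "J \<in> E.children V" for J
          using E.children_subset[OF that] by (auto simp: q_def Int_absorb1)
        then have "(\<Sum>J\<in>E.children V. v I J * (p I * q J)) = p I * (\<Sum>J\<in>E.children V. v I J * E.bint J)" for I
          by (simp add: sum_distrib_left mult_ac)
        then have "(\<Sum>J\<in>E.children V. v I J * (p I * q J)) = 0" if "I \<in> D.children K" for I
          using canc that by (simp add: bicancelling_def E.cancelling_def)
        then show ?thesis by simp
      next
        case 2
        then have "q J = 0" if "J \<in> E.children V" for J
        proof -
          have "B \<inter> J = {}" using 2 E.children_subset[OF that] by blast
          then show ?thesis by (simp add: q_def set_lebesgue_integral_def)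
        qed
        then show ?thesis by simp
      qed
    qed
  qed
  finally show ?thesis .
qed

end

section \<open>Membership in dyadic product Hardy space\<close>

text \<open>A countable exhaustion makes measurability of the infinite sum visible. The formula
  covers divergent families too: \<open>enn2real \<infinity> = 0\<close> agrees with the default
  value of \<open>infsum\<close>.\<close>

lemma infsum_exhaustion:
  fixes f :: "'i \<Rightarrow> real"
  assumes nonneg: "\<And>i. i \<in> A \<Longrightarrow> 0 \<le> f i"
    and F: "\<And>n. finite (F n)" "incseq F" "(\<Union>n. F n) = A"
  shows "infsum f A = enn2real (SUP n. ennreal (sum f (F n)))"
    "(SUP n. ennreal (sum f (F n))) < \<infinity> \<Longrightarrow> f summable_on A"
proof -
  have sub: "F n \<subseteq> A" for n using F(3) by auto
  have nn: "0 \<le> sum f (F n)" for n by (intro sum_nonneg nonneg) (use sub in auto)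
  have mono: "sum f G \<le> sum f (F n)" if "G \<subseteq> F n" for G n
    by (rule sum_mono2[OF F(1) that]) (use nonneg subsetD[OF sub] in blast)
  have cover: "\<exists>n. G \<subseteq> F n" if "finite G" "G \<subseteq> A" for G
    using that
  proof (induction G rule: finite_induct)
    case (insert i G)
    then obtain n m where "G \<subseteq> F n" "i \<in> F m" using F(3) by auto
    then have "insert i G \<subseteq> F (max n m)"
      using incseqD[OF F(2), of n "max n m"] incseqD[OF F(2), of m "max n m"] by auto
    then show ?case by blast
  qed simp
  show summ: "f summable_on A" if fin: "(SUP n. ennreal (sum f (F n))) < \<infinity>"
  proof (rule nonneg_bdd_above_summable_on[OF nonneg])
    let ?s = "SUP n. ennreal (sum f (F n))"
    have "sum f G \<le> enn2real ?s" if G: "G \<subseteq> A" "finite G" for G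
    proof -
      obtain n where n: "G \<subseteq> F n" using cover[OF G(2,1)] by blast
      have "sum f G \<le> sum f (F n)" by (rule mono[OF n])
      also have "\<dots> \<le> enn2real ?s"
      proof -
        have "ennreal (sum f (F n)) \<le> ?s" by (rule SUP_upper) simp
        then have "enn2real (ennreal (sum f (F n))) \<le> enn2real ?s"
          by (rule enn2real_mono) (use fin in simp)
        then show ?thesis using nn[of n] by simp
      qed
      finally show ?thesis .
    qed
    then show "bdd_above (sum f ` {G. G \<subseteq> A \<and> finite G})" by (intro bdd_aboveI) auto
  qed auto
  show "infsum f A = enn2real (SUP n. ennreal (sum f (F n)))"
  proof (cases "f summable_on A")
    case True
    have "ennreal (infsum f A) = (SUP G\<in>{G. finite G \<and> G \<subseteq> A}. ennreal (sum f G))"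
      using True nonneg by (rule infsum_nonneg_is_SUPREMUM_ennreal)
    also have "\<dots> = (SUP n. ennreal (sum f (F n)))"
    proof (rule antisym)
      show "(SUP G\<in>{G. finite G \<and> G \<subseteq> A}. ennreal (sum f G)) \<le> (SUP n. ennreal (sum f (F n)))"
      proof (rule SUP_least)
        fix G assume "G \<in> {G. finite G \<and> G \<subseteq> A}"
        then obtain n where n: "G \<subseteq> F n" using cover[of G] by blast
        show "ennreal (sum f G) \<le> (SUP n. ennreal (sum f (F n)))"
          by (rule SUP_upper2[of n]) (simp_all add: ennreal_leI mono[OF n])
      qed
      show "(SUP n. ennreal (sum f (F n))) \<le> (SUP G\<in>{G. finite G \<and> G \<subseteq> A}. ennreal (sum f G))"
        by (rule SUP_least, rule SUP_upper) (use F(1) sub in auto)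
    qed
    finally have "enn2real (ennreal (infsum f A)) = enn2real (SUP n. ennreal (sum f (F n)))" by (rule arg_cong)
    then show ?thesis using infsum_nonneg[of A f, OF nonneg] by simp
  next
    case False
    then have "\<not> (SUP n. ennreal (sum f (F n))) < \<infinity>" using summ by blast
    then have "(SUP n. ennreal (sum f (F n))) = \<infinity>"
      unfolding infinity_ennreal_def less_top[symmetric] by simp
    then show ?thesis unfolding infsum_not_exists[OF False] by (simp only:) simp
  qed
qed

text \<open>This makes the unweighted differences the case \<open>b = 1\<close>, so that the adapted
  square function bound also serves the Hardy space.\<close>

lemma (in grid) unit_accretive: "accretive D (\<lambda>_. 1) 1 1"
proof
  fix I assume I: "I \<in> D"
  have "integrable lborel (indicator I :: real ^ 'n \<Rightarrow> real)"
    using borel_cell[OF I] emeasure_cell[OF I] by (simp add: less_top)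
  then have "(LINT y:I|lborel. (1::complex)) = (LINT y|lborel. indicator I y) *\<^sub>R 1"
    unfolding set_lebesgue_integral_def by (intro integral_scaleR_left)
  then show "1 * measure lborel I \<le> norm (LINT y:I|lborel. (1::complex))"
    using borel_cell[OF I] by simp
qed auto

context bigrid
begin

lemma unit_biaccretive: "biaccretive D E (\<lambda>_. 1) (\<lambda>_. 1) 1 1 1 1"
  unfolding biaccretive_def using D.unit_accretive E.unit_accretive by blast

text \<open>The square function is bounded in \<open>L2\<close> and lives on \<open>S\<close>, so
  Cauchy--Schwarz against the indicator of \<open>S\<close> bounds its integral; the same pairing
  makes \<open>\<Psi>\<close> itself integrable.\<close>

lemma H1_of_L2:
  assumes \<Psi>: "\<Psi> \<in> L2" and S: "S \<in> sets borel" "emeasure lborel S < \<infinity>"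
    and \<Psi>0: "\<And>x. x \<notin> S \<Longrightarrow> \<Psi> x = 0"
    and \<Delta>0: "\<And>K V x. K \<in> D \<Longrightarrow> V \<in> E \<Longrightarrow> x \<notin> S \<Longrightarrow> diff_rect D E (\<lambda>_. 1) (\<lambda>_. 1) K V \<Psi> x = 0"
  shows "\<Psi> \<in> H1 D E" "H1_norm D E \<Psi> \<le> 56 * L2_norm \<Psi> * sqrt (measure lborel S)"
proof -
  interpret u: biaccretive D E "\<lambda>_. 1" "\<lambda>_. 1" 1 1 1 1 by (rule unit_biaccretive)
  have [measurable]: "\<Psi> \<in> borel_measurable borel" by (rule L2_measurable[OF \<Psi>])
  define R where "R = D \<times> E"
  have "D \<noteq> {}" "E \<noteq> {}" using D.cell_D E.cell_D by blast+
  then have R: "countable R" "R \<noteq> {}" unfolding R_def using D.countable_D E.countable_D by auto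
  \<comment> \<open>Increasing finite sets along an enumeration of the rectangles; repetitions in it
    disappear in the images.\<close>
  define F where "F n = from_nat_into R ` {..n}" for n :: nat
  have F: "finite (F n)" "incseq F" "(\<Union>n. F n) = R" "F n \<subseteq> R" for n
  proof -
    show "incseq F" by (auto simp: F_def incseq_def)
    have "(\<Union>n. F n) = range (from_nat_into R)" by (auto simp: F_def)
    then show "(\<Union>n. F n) = R" using range_from_nat_into[OF R(2,1)] by simp
    then show "F n \<subseteq> R" by auto
  qed (simp add: F_def)
  define \<delta> where "\<delta> P x = (norm (diff_rect D E (\<lambda>_. 1) (\<lambda>_. 1) (fst P) (snd P) \<Psi> x))\<^sup>2" for P x
  have \<delta> [measurable]: "\<delta> P \<in> borel_measurable borel" if "P \<in> R" for P
    using that u.diff_rect_eq[OF _ _ \<Psi>] by (auto simp: \<delta>_def[abs_def] R_def)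
  define s where "s x = (SUP n. ennreal (\<Sum>P\<in>F n. \<delta> P x))" for x
  have sum_meas [measurable]: "(\<lambda>x. \<Sum>P\<in>F n. \<delta> P x) \<in> borel_measurable borel" for n
    using F(4)[of n] by (intro borel_measurable_sum \<delta>) auto
  have s [measurable]: "s \<in> borel_measurable borel" unfolding s_def[abs_def] by measurable
  have ints: "(\<integral>\<^sup>+x. s x \<partial>lborel) \<le> ennreal ((56 * L2_norm \<Psi>)\<^sup>2)"
  proof -
    have "(\<integral>\<^sup>+x. s x \<partial>lborel) = (SUP n. \<integral>\<^sup>+x. ennreal (\<Sum>P\<in>F n. \<delta> P x) \<partial>lborel)"
      unfolding s_def
    proof (rule nn_integral_monotone_convergence_SUP)
      show "incseq (\<lambda>n x. ennreal (\<Sum>P\<in>F n. \<delta> P x))"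
        using F(1) incseqD[OF F(2)]
        by (intro incseq_SucI le_funI ennreal_leI sum_mono2) (auto simp: \<delta>_def incseq_def dest: incseqD[OF F(2), of _ "Suc _"])
    qed measurable
    also have "\<dots> \<le> ennreal ((56 * L2_norm \<Psi>)\<^sup>2)"
    proof (rule SUP_least)
      fix n
      have "(\<integral>\<^sup>+x. ennreal (\<Sum>P\<in>F n. \<delta> P x) \<partial>lborel) = (\<integral>\<^sup>+x. (\<Sum>P\<in>F n. ennreal (\<delta> P x)) \<partial>lborel)"
        by (intro nn_integral_cong sum_ennreal[symmetric]) (simp add: \<delta>_def)
      also have "\<dots> = (\<Sum>P\<in>F n. \<integral>\<^sup>+x. ennreal (\<delta> P x) \<partial>lborel)"
        using F(4)[of n] by (intro nn_integral_sum) (auto intro!: measurable_compose[OF \<delta>])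
      also have "\<dots> = (\<Sum>(K, V)\<in>F n. \<integral>\<^sup>+x. ennreal ((norm (diff_rect D E (\<lambda>_. 1) (\<lambda>_. 1) K V \<Psi> x))\<^sup>2) \<partial>lborel)"
        by (simp add: \<delta>_def split_beta)
      also have "\<dots> \<le> ennreal u.A\<^sub>S * (\<integral>\<^sup>+x. ennreal ((norm (\<Psi> x))\<^sup>2) \<partial>lborel)"
        using F(1)[of n] F(4)[of n] by (intro u.bi_square_function_bound) (auto simp: R_def)
      \<comment> \<open>For unit weights \<open>A\<^sub>S\<close> equals
        \<open>56^2\<close>.\<close>
      also have "\<dots> = ennreal ((56 * L2_norm \<Psi>)\<^sup>2)"
        unfolding L2_nn_integral[OF \<Psi>] u.A\<^sub>S_def
        by (subst ennreal_mult[symmetric]) (simp_all add: power_mult_distrib)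
      finally show "(\<integral>\<^sup>+x. ennreal (\<Sum>P\<in>F n. \<delta> P x) \<partial>lborel) \<le> ennreal ((56 * L2_norm \<Psi>)\<^sup>2)" .
    qed
    finally show ?thesis .
  qed
  have summ: "AE x in lborel. (\<lambda>(K, V). (norm (diff_rect D E (\<lambda>_. 1) (\<lambda>_. 1) K V \<Psi> x))\<^sup>2) summable_on D \<times> E"
  proof -
    have "(\<integral>\<^sup>+x. s x \<partial>lborel) \<noteq> \<infinity>" using ints by (auto simp: top_unique)
    then have "AE x in lborel. s x \<noteq> \<infinity>" by (intro nn_integral_PInf_AE) auto
    then show ?thesis
    proof eventually_elim
      fix x assume "s x \<noteq> \<infinity>"
      then have "s x < \<infinity>" by (simp add: less_top)
      then have "(\<lambda>P. \<delta> P x) summable_on R"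
        unfolding s_def by (intro infsum_exhaustion(2)[OF _ F(1,2,3)]) (simp_all add: \<delta>_def)
      then show "(\<lambda>(K, V). (norm (diff_rect D E (\<lambda>_. 1) (\<lambda>_. 1) K V \<Psi> x))\<^sup>2) summable_on D \<times> E"
        by (simp add: \<delta>_def R_def case_prod_unfold)
    qed
  qed
  have sq: "square_fun D E \<Psi> x = sqrt (enn2real (s x))" for x
    using infsum_exhaustion(1)[of R "\<lambda>P. \<delta> P x", OF _ F(1,2,3)]
    by (simp add: square_fun_def s_def \<delta>_def R_def case_prod_unfold)
  have sq_meas [measurable]: "square_fun D E \<Psi> \<in> borel_measurable borel"
    unfolding sq[abs_def] by measurable
  have sq0: "square_fun D E \<Psi> x = 0" if "x \<notin> S" for x
  proof -
    have "\<delta> P x = 0" if "P \<in> R" for P using \<Delta>0[OF _ _ \<open>x \<notin> S\<close>] that by (auto simp: \<delta>_def R_def)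
    then have "(\<Sum>P\<in>F n. \<delta> P x) = 0" for n using F(4)[of n] by (intro sum.neutral ballI) blast
    then have "s x = 0" by (simp add: s_def)
    then show ?thesis by (simp add: sq)
  qed
  have sq_nonneg: "0 \<le> square_fun D E \<Psi> x" for x by (simp add: sq)
  \<comment> \<open>\<open>L2\<close> consists of complex functions, hence this complex copy of the
    square function.\<close>
  define T where "T x = complex_of_real (square_fun D E \<Psi> x)" for x
  have [measurable]: "T \<in> borel_measurable borel" unfolding T_def[abs_def] by measurable
  have Tint: "(\<integral>\<^sup>+x. ennreal ((norm (T x))\<^sup>2) \<partial>lborel) \<le> ennreal ((56 * L2_norm \<Psi>)\<^sup>2)"
  proof (rule order_trans[OF nn_integral_mono ints])
    fix x show "ennreal ((norm (T x))\<^sup>2) \<le> s x"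
      by (cases "s x") (auto simp: T_def sq)
  qed
  have T: "T \<in> L2" by (rule L2_I[OF _ le_less_trans[OF Tint]]) auto
  have TL: "L2_norm T \<le> 56 * L2_norm \<Psi>"
    using Tint unfolding L2_nn_integral[OF T]
    by (subst (asm) ennreal_le_iff) (auto intro: power2_le_imp_le)
  let ?S = "\<lambda>x. 1 * indicator S x :: complex"
  have S_L2: "?S \<in> L2" "(L2_norm ?S)\<^sup>2 \<le> 1\<^sup>2 * measure lborel S"
    by (rule L2_bounded_indicator[where M = 1, OF borel_measurable_const S], simp)+
  have SL: "L2_norm ?S \<le> sqrt (measure lborel S)"
    using S_L2(2) by (simp add: real_le_rsqrt)
  have T1: "integrable lborel (\<lambda>x. T x * ?S x)" by (rule L2_mult_integrable[OF T S_L2(1)])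
  have TS: "norm (T x * ?S x) = square_fun D E \<Psi> x" for x
    using sq0[of x] sq_nonneg[of x] by (auto simp: T_def indicator_def)
  have sq_int: "integrable lborel (square_fun D E \<Psi>)"
    using integrable_norm[OF T1] unfolding TS .
  have "integrable lborel (\<lambda>x. \<Psi> x * ?S x)" by (rule L2_mult_integrable[OF \<Psi> S_L2(1)])
  also have "(\<lambda>x. \<Psi> x * ?S x) = \<Psi>"
  proof
    fix x show "\<Psi> x * ?S x = \<Psi> x" by (cases "x \<in> S") (simp_all add: \<Psi>0)
  qed
  finally show "\<Psi> \<in> H1 D E" using summ sq_int by (simp add: H1_def)
  have "H1_norm D E \<Psi> = (LINT x|lborel. norm (T x * ?S x))" unfolding H1_norm_def TS ..
  also have "\<dots> \<le> L2_norm T * L2_norm ?S" by (rule L2_Cauchy_Schwarz[OF T S_L2(1)])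
  also have "\<dots> \<le> (56 * L2_norm \<Psi>) * sqrt (measure lborel S)"
    by (intro mult_mono TL SL) auto
  finally show "H1_norm D E \<Psi> \<le> 56 * L2_norm \<Psi> * sqrt (measure lborel S)" .
qed

end

section \<open>Finite sums of adapted differences as elements of the Hardy space\<close>

context biaccretive
begin

lemma bistep_L2:
  assumes "K \<in> D" "V \<in> E" shows "bistep K V v \<in> L2"
proof -
  have "(\<lambda>x. \<Sum>I\<in>D.children K. \<Sum>J\<in>E.children V. v I J * (1 * indicator (I \<times> J) x)) \<in> L2"
    by (intro L2_sum L2_scale L2_bounded_indicator[where M = 1] rect_borel emeasure_rect_finite D.children_D E.children_D) auto
  also have "(\<lambda>x. \<Sum>I\<in>D.children K. \<Sum>J\<in>E.children V. v I J * (1 * indicator (I \<times> J) x)) = bistep K V v"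
    unfolding bistep_def[abs_def] by (auto simp: indicator_times mult_ac)
  finally show ?thesis .
qed

text \<open>At a point outside the union, the integral of the sum over every dyadic rectangle
  through that point vanishes. Hence the function and its unweighted square function are supported
  on the union, and the dual bound supplies the norm in \<open>L2\<close>.\<close>

lemma atom_H1:
  assumes F: "finite F" "F \<subseteq> D \<times> E" and canc: "\<And>K V. (K, V) \<in> F \<Longrightarrow> bicancelling K V (v K V)"
  shows "(\<lambda>x. \<Sum>(K, V)\<in>F. b x * bistep K V (v K V) x) \<in> H1 D E"
    "H1_norm D E (\<lambda>x. \<Sum>(K, V)\<in>F. b x * bistep K V (v K V) x)
      \<le> 56 * sqrt (A\<^sub>d * (\<Sum>(K, V)\<in>F. (L2_norm (bistep K V (v K V)))\<^sup>2)) * sqrt (measure lborel (\<Union>(K, V)\<in>F. K \<times> V))"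
proof -
  interpret u: biaccretive D E "\<lambda>_. 1" "\<lambda>_. 1" 1 1 1 1 by (rule unit_biaccretive)
  define \<Psi> where "\<Psi> x = (\<Sum>(K, V)\<in>F. b x * bistep K V (v K V) x)" for x
  define S where "S = (\<Union>(K, V)\<in>F. K \<times> V)"
  define e where "e = (\<Sum>(K, V)\<in>F. (L2_norm (bistep K V (v K V)))\<^sup>2)"
  have FD: "K \<in> D" "V \<in> E" if "(K, V) \<in> F" for K V using that F by auto
  have terms: "(\<lambda>x. case P of (K, V) \<Rightarrow> b x * bistep K V (v K V) x) \<in> L2" if "P \<in> F" for P
    using that b_bistep_L2[OF FD] by (cases P) auto
  have \<Psi>: "\<Psi> \<in> L2" unfolding \<Psi>_def[abs_def] by (rule L2_sum[OF terms])
  have S: "S \<in> sets borel" unfolding S_def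
    using F by (intro sets.finite_UN) (auto intro: rect_borel)
  have Sfin: "emeasure lborel S < \<infinity>"
  proof -
    have "emeasure lborel S \<le> (\<Sum>P\<in>F. emeasure lborel (case P of (K, V) \<Rightarrow> K \<times> V))"
      unfolding S_def using F by (intro emeasure_subadditive_finite) (auto intro: rect_borel)
    also have "\<dots> = (\<Sum>P\<in>F. ennreal (measure lborel (case P of (K, V) \<Rightarrow> K \<times> V)))"
    proof (intro sum.cong refl emeasure_eq_ennreal_measure)
      fix P assume P: "P \<in> F"
      obtain K V where KV: "P = (K, V)" by (cases P)
      show "emeasure lborel (case P of (K, V) \<Rightarrow> K \<times> V) \<noteq> top"
        using emeasure_rect_finite[of K V] FD[of K V] P by (simp add: KV less_top)
    qed
    also have "\<dots> = ennreal (\<Sum>P\<in>F. measure lborel (case P of (K, V) \<Rightarrow> K \<times> V))"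
      by (rule sum_ennreal) simp
    finally show ?thesis by (rule le_less_trans) simp
  qed
  have \<Psi>0: "\<Psi> x = 0" if "x \<notin> S" for x
    unfolding \<Psi>_def
  proof (rule sum.neutral, intro ballI)
    fix P assume P: "P \<in> F"
    have "x \<notin> fst P \<times> snd P"
    proof
      assume "x \<in> fst P \<times> snd P"
      then have "x \<in> S" unfolding S_def by (intro UN_I[OF P]) (simp add: case_prod_unfold)
      with that show False by simp
    qed
    then show "(case P of (K, V) \<Rightarrow> b x * bistep K V (v K V) x) = 0"
      by (simp add: split_beta bistep_eq_0)
  qed
  have r0: "u.rint \<Psi> A B = 0" if "A \<in> D" "B \<in> E" "x \<in> A \<times> B" "x \<notin> S" for A B x
  proof -
    have "u.rint \<Psi> A B = (LINT y:A \<times> B|lborel. (\<Sum>P\<in>F. (case P of (K, V) \<Rightarrow> b y * bistep K V (v K V) y) * u.b y))"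
      unfolding u.rint_def \<Psi>_def sum_distrib_right ..
    also have "\<dots> = (\<Sum>P\<in>F. LINT y:A \<times> B|lborel. (case P of (K, V) \<Rightarrow> b y * bistep K V (v K V) y) * u.b y)"
      by (intro set_integral_sum_of u.mult_b_rect_integrable that terms)
    also have "\<dots> = 0"
    proof (rule sum.neutral, intro ballI)
      fix P assume P: "P \<in> F"
      obtain K V where KV: "P = (K, V)" by (cases P)
      have "x \<notin> K \<times> V"
      proof
        assume "x \<in> K \<times> V"
        then have "x \<in> S" unfolding S_def by (intro UN_I[OF P]) (simp add: KV)
        with that(4) show False by simp
      qed
      then have "(LINT y:A \<times> B|lborel. b y * bistep K V (v K V) y) = 0"
        using P KV by (intro b_bistep_set_integral_eq_0[OF FD that(1,2) canc that(3)]) auto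
      then show "(LINT y:A \<times> B|lborel. (case P of (K, V) \<Rightarrow> b y * bistep K V (v K V) y) * u.b y) = 0"
        by (simp add: KV tensor_def)
    qed
    finally show ?thesis .
  qed
  have \<Delta>0: "diff_rect D E (\<lambda>_. 1) (\<lambda>_. 1) K V \<Psi> x = 0" if "K \<in> D" "V \<in> E" "x \<notin> S" for K V x
    unfolding u.diff_rect_eq[OF that(1,2) \<Psi>] u.bistep_def
  proof (intro sum.neutral ballI)
    fix I J assume I: "I \<in> D.children K" and J: "J \<in> E.children V"
    show "u.coef \<Psi> K V I J * indicator I (fst x) * indicator J (snd x) = 0"
    proof (cases "fst x \<in> I \<and> snd x \<in> J")
      case True
      \<comment> \<open>All four rectangles entering \<open>u.coef\<close> contain \<open>x\<close>,
        so each of the four integrals vanishes.\<close>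
      then have "x \<in> I \<times> J" "x \<in> K \<times> J" "x \<in> I \<times> V" "x \<in> K \<times> V"
        using D.children_subset[OF I] E.children_subset[OF J] by (auto simp: mem_Times_iff)
      then show ?thesis
        using r0 that D.children_D[OF I] E.children_D[OF J] by (simp add: u.coef_def u.rmean_def)
    qed auto
  qed
  have eq: "(\<lambda>x. \<Sum>(K, V)\<in>F. b x * bistep K V (v K V) x) = \<Psi>" by (rule ext) (simp only: \<Psi>_def)
  note H1 = H1_of_L2[OF \<Psi> S Sfin \<Psi>0 \<Delta>0]
  show "(\<lambda>x. \<Sum>(K, V)\<in>F. b x * bistep K V (v K V) x) \<in> H1 D E" unfolding eq by (rule H1(1))
  have "ennreal ((L2_norm \<Psi>)\<^sup>2) \<le> ennreal A\<^sub>d * (\<Sum>(K, V)\<in>F. \<integral>\<^sup>+x. ennreal ((norm (bistep K V (v K V) x))\<^sup>2) \<partial>lborel)"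
    unfolding L2_nn_integral[OF \<Psi>, symmetric] unfolding \<Psi>_def by (rule bi_dual_bound[OF F canc])
  also have "(\<Sum>(K, V)\<in>F. \<integral>\<^sup>+x. ennreal ((norm (bistep K V (v K V) x))\<^sup>2) \<partial>lborel)
    = (\<Sum>P\<in>F. ennreal (case P of (K, V) \<Rightarrow> (L2_norm (bistep K V (v K V)))\<^sup>2))"
    using FD by (intro sum.cong refl) (auto simp: L2_nn_integral[OF bistep_L2])
  also have "\<dots> = ennreal e" unfolding e_def by (rule sum_ennreal) auto
  also have "ennreal A\<^sub>d * ennreal e = ennreal (A\<^sub>d * e)"
    using A\<^sub>d_pos by (intro ennreal_mult[symmetric]) (auto simp: e_def intro!: sum_nonneg)
  finally have "(L2_norm \<Psi>)\<^sup>2 \<le> A\<^sub>d * e"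
    using A\<^sub>d_pos by (subst (asm) ennreal_le_iff) (auto simp: e_def intro!: sum_nonneg mult_nonneg_nonneg)
  then have "L2_norm \<Psi> \<le> sqrt (A\<^sub>d * e)" by (rule real_le_rsqrt)
  then have "56 * L2_norm \<Psi> * sqrt (measure lborel S) \<le> 56 * sqrt (A\<^sub>d * e) * sqrt (measure lborel S)"
    by (intro mult_right_mono mult_left_mono) auto
  with H1(2) show "H1_norm D E (\<lambda>x. \<Sum>(K, V)\<in>F. b x * bistep K V (v K V) x)
      \<le> 56 * sqrt (A\<^sub>d * (\<Sum>(K, V)\<in>F. (L2_norm (bistep K V (v K V)))\<^sup>2)) * sqrt (measure lborel (\<Union>(K, V)\<in>F. K \<times> V))"
    unfolding eq e_def[symmetric] S_def[symmetric] by linarith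
qed

lemma single_atom_H1:
  assumes "K \<in> D" "V \<in> E" "bicancelling K V v"
  shows "(\<lambda>x. b x * bistep K V v x) \<in> H1 D E"
    "H1_norm D E (\<lambda>x. b x * bistep K V v x) \<le> 56 * sqrt (A\<^sub>d * (L2_norm (bistep K V v))\<^sup>2) * sqrt (measure lborel (K \<times> V))"
  using atom_H1[of "{(K, V)}" "\<lambda>_ _. v"] assms by auto

lemma coef_add:
  assumes "K \<in> D" "V \<in> E" "I \<in> D" "J \<in> E" "g \<in> L2" "h \<in> L2"
  shows "coef (\<lambda>x. g x + h x) K V I J = coef g K V I J + coef h K V I J"
proof -
  have "rint (\<lambda>x. g x + h x) A B = rint g A B + rint h A B" if "A \<in> D" "B \<in> E" for A B
    unfolding rint_def distrib_right
    by (intro set_integral_add mult_b_rect_integrable that assms)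
  then show ?thesis using assms by (simp add: coef_def rmean_def add_divide_distrib)
qed

lemma coef_scale: "coef (\<lambda>x. c * g x) K V I J = c * coef g K V I J"
proof -
  have "rint (\<lambda>x. c * g x) A B = c * rint g A B" for A B
    unfolding rint_def mult.assoc set_lebesgue_integral_def mult_scaleR_right[symmetric]
    by (rule integral_mult_right_zero)
  then show ?thesis by (simp add: coef_def rmean_def algebra_simps)
qed

end

section \<open>The paraproduct\<close>

text \<open>\<open>A\<close> stands for any admissible bound of the functional; the
  \<open>BMO\<close> norm is inserted at the end.\<close>

locale paraproduct = biaccretive D E b\<^sub>1 b\<^sub>2 M\<^sub>1 M\<^sub>2 c\<^sub>1 c\<^sub>2
  for D :: "(real ^ 'n) set set" and E :: "(real ^ 'm) set set"
    and b\<^sub>1 :: "real ^ 'n \<Rightarrow> complex" and b\<^sub>2 :: "real ^ 'm \<Rightarrow> complex" and M\<^sub>1 M\<^sub>2 c\<^sub>1 c\<^sub>2 :: real +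
  fixes a :: "((real ^ 'n) \<times> (real ^ 'm) \<Rightarrow> complex) \<Rightarrow> complex" and A :: real
  assumes a_BMO: "a \<in> BMO D E"
    and A_nonneg: "0 \<le> A"
    and a_bound: "\<And>\<phi>. \<phi> \<in> H1 D E \<Longrightarrow> norm (a \<phi>) \<le> A * H1_norm D E \<phi>"
begin

lemma a_add: "\<phi> \<in> H1 D E \<Longrightarrow> \<psi> \<in> H1 D E \<Longrightarrow> a (\<lambda>x. \<phi> x + \<psi> x) = a \<phi> + a \<psi>"
  using a_BMO unfolding BMO_def by blast

lemma a_scale: "\<phi> \<in> H1 D E \<Longrightarrow> a (\<lambda>x. c * \<phi> x) = c * a \<phi>"
  using a_BMO unfolding BMO_def by blast

text \<open>Additivity of \<open>a\<close> is available only inside \<open>H1\<close>, so the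
  induction relies on every partial sum belonging to that space.\<close>

lemma a_atom_sum:
  assumes F: "finite F" "F \<subseteq> D \<times> E" and canc: "\<And>K V. (K, V) \<in> F \<Longrightarrow> bicancelling K V (v K V)"
  shows "a (\<lambda>x. \<Sum>(K, V)\<in>F. b x * bistep K V (v K V) x) = (\<Sum>(K, V)\<in>F. a (\<lambda>x. b x * bistep K V (v K V) x))"
  using assms
proof (induction F rule: finite_induct)
  case empty
  \<comment> \<open>The zero function enters the Hardy space as the empty sum; homogeneity with
    factor 0 then gives the value zero.\<close>
  have "(\<lambda>x. 0) \<in> H1 D E" using atom_H1(1)[of "{}"] by simp
  from a_scale[OF this, of 0] show ?case by simp
next
  case (insert P F)
  obtain K V where P: "P = (K, V)" by (cases P)
  have 1: "(\<lambda>x. b x * bistep K V (v K V) x) \<in> H1 D E"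
    using insert.prems by (intro single_atom_H1) (auto simp: P)
  have 2: "(\<lambda>x. \<Sum>(K, V)\<in>F. b x * bistep K V (v K V) x) \<in> H1 D E"
    using insert by (intro atom_H1(1)) auto
  have "a (\<lambda>x. \<Sum>(K, V)\<in>insert P F. b x * bistep K V (v K V) x)
     = a (\<lambda>x. b x * bistep K V (v K V) x + (\<Sum>(K, V)\<in>F. b x * bistep K V (v K V) x))"
    using insert.hyps by (simp add: P)
  also have "\<dots> = a (\<lambda>x. b x * bistep K V (v K V) x) + (\<Sum>(K, V)\<in>F. a (\<lambda>x. b x * bistep K V (v K V) x))"
    using a_add[OF 1 2] insert by auto
  finally show ?case using insert.hyps by (simp add: P)
qed

abbreviation T :: "(real ^ 'n) set \<Rightarrow> (real ^ 'm) set \<Rightarrow> ((real ^ 'n) \<times> (real ^ 'm) \<Rightarrow> complex) \<Rightarrow> complex" where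
  "T K V g \<equiv> mult_diff_rect D E b\<^sub>1 b\<^sub>2 a K V g"

lemma T_eq:
  "K \<in> D \<Longrightarrow> V \<in> E \<Longrightarrow> g \<in> L2 \<Longrightarrow> T K V g = a (\<lambda>x. b x * bistep K V (coef g K V) x)"
  by (simp add: mult_diff_rect_def diff_rect_eq)

lemma T_add:
  assumes "K \<in> D" "V \<in> E" "g \<in> L2" "h \<in> L2"
  shows "T K V (\<lambda>x. g x + h x) = T K V g + T K V h"
proof -
  have "b x * bistep K V (coef (\<lambda>x. g x + h x) K V) x = b x * bistep K V (coef g K V) x + b x * bistep K V (coef h K V) x" for x
    unfolding distrib_left[symmetric] bistep_add
    using assms by (simp add: bistep_def coef_add D.children_D E.children_D cong: sum.cong)
  then show ?thesis
    using assms a_add[OF single_atom_H1(1) single_atom_H1(1), OF assms(1,2) bicancelling_coef[OF assms(1,2,3)] assms(1,2) bicancelling_coef[OF assms(1,2,4)]]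
    by (simp add: T_eq L2_add)
qed

lemma T_scale:
  assumes "K \<in> D" "V \<in> E" "g \<in> L2"
  shows "T K V (\<lambda>x. c * g x) = c * T K V g"
proof -
  have eq: "b x * bistep K V (coef (\<lambda>x. c * g x) K V) x = c * (b x * bistep K V (coef g K V) x)" for x
    unfolding mult.left_commute[of c] bistep_scale by (simp add: coef_scale[abs_def])
  show ?thesis
    unfolding T_eq[OF assms(1,2) L2_scale[OF assms(3)]] T_eq[OF assms] eq
    by (rule a_scale[OF single_atom_H1(1)[OF assms(1,2) bicancelling_coef[OF assms]]])
qed

definition dn :: "((real ^ 'n) \<times> (real ^ 'm) \<Rightarrow> complex) \<Rightarrow> (real ^ 'n) set \<times> (real ^ 'm) set \<Rightarrow> real" where
  "dn g P = L2_norm (bistep (fst P) (snd P) (coef g (fst P) (snd P)))"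

text \<open>Carleson coefficient of the rectangle, relative to the fixed \<open>g\<close>; it is 0
  by convention when the denominator vanishes.\<close>

definition \<nu> :: "((real ^ 'n) \<times> (real ^ 'm) \<Rightarrow> complex) \<Rightarrow> (real ^ 'n) set \<times> (real ^ 'm) set \<Rightarrow> real" where
  "\<nu> g P = norm (T (fst P) (snd P) g) / dn g P"

lemma \<nu>_nonneg: "0 \<le> \<nu> g P"
  by (simp add: \<nu>_def dn_def)

text \<open>When the difference of \<open>g\<close> has norm zero, the \<open>H1\<close> bound for
  this single rectangle forces the functional to vanish as well, so the conventional value of the
  quotient loses nothing.\<close>

lemma T_eq_\<nu>_dn:
  assumes "P \<in> D \<times> E" "g \<in> L2"
  shows "norm (T (fst P) (snd P) g) = \<nu> g P * dn g P"
proof (cases "dn g P = 0")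
  case True
  have P: "fst P \<in> D" "snd P \<in> E" using assms by auto
  have "norm (T (fst P) (snd P) g) \<le> A * H1_norm D E (\<lambda>x. b x * bistep (fst P) (snd P) (coef g (fst P) (snd P)) x)"
    unfolding T_eq[OF P assms(2)] by (intro a_bound single_atom_H1(1) P bicancelling_coef assms)
  also have "\<dots> \<le> A * (56 * sqrt (A\<^sub>d * (dn g P)\<^sup>2) * sqrt (measure lborel (fst P \<times> snd P)))"
    unfolding dn_def by (intro mult_left_mono single_atom_H1(2) P bicancelling_coef assms A_nonneg)
  finally show ?thesis using True by simp
qed (simp add: \<nu>_def)

text \<open>The coefficients \<open>s P\<close> are chosen such that \<open>a\<close> applied to the test function is the left-hand
  side itself.\<close>

lemma carleson:
  assumes F: "finite F" "F \<subseteq> D \<times> E" and g: "g \<in> L2"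
  shows "(\<Sum>P\<in>F. (\<nu> g P)\<^sup>2) \<le> (56 * A)\<^sup>2 * A\<^sub>d * measure lborel (\<Union>P\<in>F. fst P \<times> snd P)"
proof -
  define N where "N = (\<Sum>P\<in>F. (\<nu> g P)\<^sup>2)"
  have N0: "N \<ge> 0" unfolding N_def by (intro sum_nonneg) auto
  \<comment> \<open>The phase aligns the values of \<open>a\<close>. The factor
    \<open>\<nu> g P / dn g P\<close> makes the rescaled difference have norm at most
    \<open>\<nu> g P\<close>, so that the same sum \<open>N\<close> reappears on the right, under a
    square root.\<close>
  define s where "s P = cnj (sgn (T (fst P) (snd P) g)) * complex_of_real (\<nu> g P / dn g P)" for P
  have sT: "s P * T (fst P) (snd P) g = complex_of_real ((\<nu> g P)\<^sup>2)" for P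
  proof -
    have "cnj (sgn z) * z = complex_of_real (norm z)" for z :: complex
    proof (cases "z = 0")
      case False
      have "cnj (sgn z) * z = (z * cnj z) / complex_of_real (norm z)"
        by (simp add: sgn_eq mult.commute)
      then show ?thesis using False by (simp add: complex_norm_square[symmetric] power2_eq_square)
    qed simp
    then have "s P * T (fst P) (snd P) g = complex_of_real (norm (T (fst P) (snd P) g) * (\<nu> g P / dn g P))"
      unfolding s_def by (simp add: mult_ac)
    also have "norm (T (fst P) (snd P) g) * (\<nu> g P / dn g P) = (\<nu> g P)\<^sup>2"
      by (simp add: \<nu>_def power2_eq_square)
    finally show ?thesis .
  qed
  define v where "v K V = (\<lambda>I J. s (K, V) * coef g K V I J)" for K V
  have canc: "bicancelling K V (v K V)" if "(K, V) \<in> F" for K V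
    unfolding v_def using that F by (intro bicancelling_scale bicancelling_coef g) auto
  have step: "bistep K V (v K V) = (\<lambda>x. s (K, V) * bistep K V (coef g K V) x)" for K V
    unfolding v_def by (simp add: bistep_scale fun_eq_iff)
  have norm_step: "(L2_norm (bistep K V (v K V)))\<^sup>2 \<le> (\<nu> g (K, V))\<^sup>2" for K V
  proof -
    have q: "0 \<le> \<nu> g (K, V) / dn g (K, V)" using \<nu>_nonneg[of g "(K, V)"] by (simp add: dn_def)
    have "norm (s (K, V)) = norm (sgn (T K V g)) * (\<nu> g (K, V) / dn g (K, V))"
      unfolding s_def norm_mult complex_mod_cnj norm_of_real abs_of_nonneg[OF q] by simp
    also have "\<dots> \<le> 1 * (\<nu> g (K, V) / dn g (K, V))"
      by (intro mult_right_mono q) (simp add: norm_sgn)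
    finally have "norm (s (K, V)) \<le> \<nu> g (K, V) / dn g (K, V)" by simp
    then have "L2_norm (bistep K V (v K V)) \<le> \<nu> g (K, V) / dn g (K, V) * dn g (K, V)"
      unfolding step L2_norm_scale by (intro mult_mono) (simp_all add: dn_def \<nu>_nonneg)
    also have "\<dots> \<le> \<nu> g (K, V)" using \<nu>_nonneg[of g "(K, V)"] by simp
    finally show ?thesis by (intro power_mono) auto
  qed
  have "complex_of_real N = (\<Sum>(K, V)\<in>F. s (K, V) * T K V g)"
    using sT by (simp add: N_def split_beta)
  also have "\<dots> = (\<Sum>(K, V)\<in>F. a (\<lambda>x. b x * bistep K V (v K V) x))"
  proof (intro sum.cong refl, clarify)
    fix K V assume "(K, V) \<in> F"
    then have KV: "K \<in> D" "V \<in> E" using F by auto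
    have "a (\<lambda>x. s (K, V) * (b x * bistep K V (coef g K V) x)) = s (K, V) * a (\<lambda>x. b x * bistep K V (coef g K V) x)"
      by (intro a_scale single_atom_H1 KV bicancelling_coef g)
    then show "s (K, V) * T K V g = a (\<lambda>x. b x * bistep K V (v K V) x)"
      by (simp add: T_eq KV g step mult_ac)
  qed
  also have "\<dots> = a (\<lambda>x. \<Sum>(K, V)\<in>F. b x * bistep K V (v K V) x)"
    by (rule a_atom_sum[OF F canc, symmetric])
  finally have "N = norm (a (\<lambda>x. \<Sum>(K, V)\<in>F. b x * bistep K V (v K V) x))"
    using N0 by (metis abs_of_nonneg norm_of_real)
  also have "\<dots> \<le> A * H1_norm D E (\<lambda>x. \<Sum>(K, V)\<in>F. b x * bistep K V (v K V) x)"
    by (intro a_bound atom_H1 F canc)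
  also have "\<dots> \<le> A * (56 * sqrt (A\<^sub>d * (\<Sum>(K, V)\<in>F. (L2_norm (bistep K V (v K V)))\<^sup>2)) * sqrt (measure lborel (\<Union>(K, V)\<in>F. K \<times> V)))"
    by (intro mult_left_mono atom_H1(2) F canc A_nonneg)
  also have "\<dots> \<le> A * (56 * sqrt (A\<^sub>d * N) * sqrt (measure lborel (\<Union>(K, V)\<in>F. K \<times> V)))"
  proof (intro mult_left_mono mult_right_mono real_sqrt_le_mono A_nonneg)
    show "(\<Sum>(K, V)\<in>F. (L2_norm (bistep K V (v K V)))\<^sup>2) \<le> N"
      unfolding N_def by (intro sum_mono) (use norm_step in auto)
  qed (use A\<^sub>d_pos in auto)
  finally have le: "N \<le> 56 * A * sqrt A\<^sub>d * sqrt N * sqrt (measure lborel (\<Union>(K, V)\<in>F. K \<times> V))"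
    by (simp add: real_sqrt_mult mult_ac)
  define U where "U = measure lborel (\<Union>(K, V)\<in>F. K \<times> V)"
  have U: "U \<ge> 0" by (simp add: U_def)
  \<comment> \<open>\<open>N\<close> is bounded by a multiple of \<open>sqrt N\<close>; dividing by
    \<open>sqrt N\<close> and squaring gives a bound linear in the measure.\<close>
  have "N \<le> (56 * A)\<^sup>2 * A\<^sub>d * U"
  proof (cases "N = 0")
    case False
    have "sqrt N * sqrt N \<le> (56 * A * sqrt A\<^sub>d * sqrt U) * sqrt N"
      using le N0 by (simp add: U_def mult_ac)
    then have "sqrt N \<le> 56 * A * sqrt A\<^sub>d * sqrt U"
      using False N0 by (subst (asm) mult_le_cancel_right) auto
    then have "(sqrt N)\<^sup>2 \<le> (56 * A * sqrt A\<^sub>d * sqrt U)\<^sup>2" using N0 by (intro power_mono) auto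
    then show ?thesis using N0 U A\<^sub>d_pos by (simp add: power_mult_distrib)
  next
    case True
    then show ?thesis using U A\<^sub>d_pos by simp
  qed
  then show ?thesis by (simp add: N_def U_def case_prod_unfold)
qed

end

section \<open>The bilinear estimate for finite sets of rectangles\<close>

lemma Linfty_bounded_nonneg:
  fixes b :: "'a::euclidean_space \<Rightarrow> complex"
  assumes "Linfty_bounded B b" shows "0 \<le> B"
proof (rule ccontr)
  assume B: "\<not> 0 \<le> B"
  have "AE x in lborel. norm (b x) \<le> B" using assms by (simp add: Linfty_bounded_def)
  then have "AE x in (lborel :: 'a measure). False"
  proof eventually_elim
    fix x assume "norm (b x) \<le> B"
    then show False using B norm_ge_zero[of "b x"] by linarith
  qed
  then show False by (simp add: eventually_False ae_filter_eq_bot_iff)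
qed

context bigrid
begin

text \<open>Accretivity on the rectangle bounds the denominator below by \<open>c'\<close> times its
  measure, and the supremum bound controls the numerator; \<open>H\<close> stands for a bound of the
  plain mean of \<open>|f|\<close>.\<close>

lemma rect_mean_le:
  assumes b': "Linfty_bounded B' b'" "pseudo_accretive c' b'" and f: "f \<in> L2"
    and K: "K \<in> D" and V: "V \<in> E"
    and H: "(\<integral>\<^sup>+y\<in>K \<times> V. ennreal (norm (f y)) \<partial>lborel) \<le> H * emeasure lborel (K \<times> V)"
  shows "ennreal (norm (rect_mean b' K V f)) \<le> ennreal (B' / c') * H"
proof -
  have c': "c' > 0" using b' by (simp add: pseudo_accretive_def)
  have B': "B' \<ge> 0" by (rule Linfty_bounded_nonneg[OF b'(1)])
  have [measurable]: "b' \<in> borel_measurable borel" and bdd: "AE x in lborel. norm (b' x) \<le> B'"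
    using b' by (auto simp: Linfty_bounded_def)
  have [measurable]: "f \<in> borel_measurable borel" by (rule L2_measurable[OF f])
  have KV [measurable]: "K \<times> V \<in> sets borel" by (rule rect_borel[OF K V])
  define m where "m = measure lborel (K \<times> V)"
  have m: "m = measure lborel K * measure lborel V"
    unfolding m_def by (intro measure_lborel_Times D.borel_cell E.borel_cell K V)
  have m_pos: "m > 0" unfolding m by (intro mult_pos_pos D.measure_cell_pos E.measure_cell_pos K V)
  have em: "emeasure lborel (K \<times> V) = ennreal m"
    unfolding m emeasure_rect[OF K V] D.emeasure_cell_eq[OF K] E.emeasure_cell_eq[OF V]
    by (simp add: ennreal_mult)
  obtain u l v s where cubes: "l > 0" "K = cube u l" "s > 0" "V = cube v s"
    using D.cell_is_cube[OF K] E.cell_is_cube[OF V] by metis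
  have den: "norm (LINT x:K \<times> V|lborel. b' x) / m > c'"
    using b'(2) cubes unfolding pseudo_accretive_def m_def by blast
  then have den: "c' * m < norm (LINT x:K \<times> V|lborel. b' x)" using m_pos by (simp add: pos_less_divide_eq)
  let ?N = "LINT x:K \<times> V|lborel. f x * b' x"
  have int: "integrable lborel (\<lambda>x. indicator (K \<times> V) x *\<^sub>R (f x * b' x))"
  proof -
    have "integrable lborel (\<lambda>x. f x * (b' x * indicator (K \<times> V) x))"
      by (intro L2_mult_integrable f L2_bounded_indicator[OF _ KV _ bdd]) (simp_all add: em)
    also have "(\<lambda>x. f x * (b' x * indicator (K \<times> V) x)) = (\<lambda>x. indicator (K \<times> V) x *\<^sub>R (f x * b' x))"
      by (auto simp: indicator_def)
    finally show ?thesis .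
  qed
  have "ennreal (norm ?N) \<le> (\<integral>\<^sup>+x. ennreal (norm (indicator (K \<times> V) x *\<^sub>R (f x * b' x))) \<partial>lborel)"
    unfolding set_lebesgue_integral_def by (rule integral_norm_bound_ennreal[OF int])
  also have "\<dots> \<le> (\<integral>\<^sup>+x. ennreal B' * (ennreal (norm (f x)) * indicator (K \<times> V) x) \<partial>lborel)"
  proof (rule nn_integral_mono_AE)
    show "AE x in lborel. ennreal (norm (indicator (K \<times> V) x *\<^sub>R (f x * b' x)))
        \<le> ennreal B' * (ennreal (norm (f x)) * indicator (K \<times> V) x)"
      using bdd
    proof eventually_elim
      fix x assume "norm (b' x) \<le> B'"
      then have "norm (f x * b' x) \<le> B' * norm (f x)"
        unfolding norm_mult by (subst mult.commute) (rule mult_right_mono, auto)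
      then show "ennreal (norm (indicator (K \<times> V) x *\<^sub>R (f x * b' x)))
        \<le> ennreal B' * (ennreal (norm (f x)) * indicator (K \<times> V) x)"
        using B' by (cases "x \<in> K \<times> V") (simp_all add: ennreal_mult[symmetric] ennreal_leI)
    qed
  qed
  also have "\<dots> = ennreal B' * (\<integral>\<^sup>+y\<in>K \<times> V. ennreal (norm (f y)) \<partial>lborel)"
    by (rule nn_integral_cmult) measurable
  also have "\<dots> \<le> ennreal B' * (H * ennreal m)"
    using H unfolding em by (intro mult_left_mono) auto
  finally have N: "ennreal (norm ?N) \<le> ennreal B' * (H * ennreal m)" .
  have "norm (rect_mean b' K V f) \<le> norm ?N * (1 / (c' * m))"
  proof -
    have "norm ?N / norm (LINT x:K \<times> V|lborel. b' x) \<le> norm ?N / (c' * m)"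
      using den c' m_pos by (intro frac_le) auto
    then show ?thesis by (simp add: rect_mean_def norm_divide)
  qed
  then have "ennreal (norm (rect_mean b' K V f)) \<le> ennreal (norm ?N) * ennreal (1 / (c' * m))"
    using c' m_pos by (subst ennreal_mult[symmetric]) (auto intro: ennreal_leI)
  also have "\<dots> \<le> ennreal B' * (H * ennreal m) * ennreal (1 / (c' * m))"
    by (intro mult_right_mono N) simp
  also have "\<dots> = (ennreal B' * (ennreal m * ennreal (1 / (c' * m)))) * H" by (simp add: mult_ac)
  also have "ennreal B' * (ennreal m * ennreal (1 / (c' * m))) = ennreal (B' * (m * (1 / (c' * m))))"
    using B' m_pos c' by (subst ennreal_mult[symmetric], simp, simp, subst ennreal_mult[symmetric], simp_all)
  also have "B' * (m * (1 / (c' * m))) = B' / c'" using m_pos by simp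
  finally show ?thesis .
qed

end

context paraproduct
begin

text \<open>Cauchy--Schwarz separates \<open>r * \<nu>\<close> from \<open>dn\<close>. The embedding
  is applied to squared means, masses \<open>\<nu>^2\<close> and the squared maximal function. In
  \<open>224 = 56 * 4\<close> the 56 comes from the packing bound and 4 is the root of the constant
  of the strong maximal function.\<close>

lemma sum_pairing_bound:
  assumes F: "finite F" "F \<subseteq> D \<times> E" and f: "f \<in> L2" and g: "g \<in> L2"
    and b': "Linfty_bounded B' b'" "pseudo_accretive c' b'"
  shows "(\<Sum>(K, V)\<in>F. norm (rect_mean b' K V f * T K V g))
    \<le> 224 * (B' / c') * sqrt (A\<^sub>d * A\<^sub>S) * A * L2_norm f * L2_norm g"
proof -
  have c': "c' > 0" using b' by (simp add: pseudo_accretive_def)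
  have B': "B' \<ge> 0" by (rule Linfty_bounded_nonneg[OF b'(1)])
  have [measurable]: "f \<in> borel_measurable borel" "g \<in> borel_measurable borel"
    by (rule L2_measurable[OF f], rule L2_measurable[OF g])
  have FD: "fst P \<in> D" "snd P \<in> E" if "P \<in> F" for P using that F by auto
  obtain H where H [measurable]: "H \<in> borel_measurable borel"
    and Hle: "\<And>K V x. (K, V) \<in> F \<Longrightarrow> x \<in> K \<times> V \<Longrightarrow>
      (\<integral>\<^sup>+y\<in>K \<times> V. ennreal (norm (f y)) \<partial>lborel) \<le> H x * emeasure lborel (K \<times> V)"
    and HL: "(\<integral>\<^sup>+x. (H x)\<^sup>2 \<partial>lborel) \<le> 16 * (\<integral>\<^sup>+x. (ennreal (norm (f x)))\<^sup>2 \<partial>lborel)"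
    by (rule strong_maximal[OF F, of "\<lambda>x. ennreal (norm (f x))"]) measurable
  define r where "r P = norm (rect_mean b' (fst P) (snd P) f)" for P
  define k where "k = (56 * A)\<^sup>2 * A\<^sub>d"
  have k: "k \<ge> 0" using A\<^sub>d_pos by (simp add: k_def)
  have "(\<integral>\<^sup>+x. (ennreal (B' / c') * H x)\<^sup>2 \<partial>lborel) = (ennreal (B' / c'))\<^sup>2 * (\<integral>\<^sup>+x. (H x)\<^sup>2 \<partial>lborel)"
    unfolding power_mult_distrib by (rule nn_integral_cmult) measurable
  also have "\<dots> \<le> (ennreal (B' / c'))\<^sup>2 * (16 * (\<integral>\<^sup>+x. (ennreal (norm (f x)))\<^sup>2 \<partial>lborel))"
    by (intro mult_left_mono HL) simp
  also have "(\<integral>\<^sup>+x. (ennreal (norm (f x)))\<^sup>2 \<partial>lborel) = ennreal ((L2_norm f)\<^sup>2)"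
    unfolding L2_nn_integral[OF f, symmetric] by (simp add: ennreal_power)
  finally have HB: "(\<integral>\<^sup>+x. (ennreal (B' / c') * H x)\<^sup>2 \<partial>lborel) \<le> (ennreal (B' / c'))\<^sup>2 * (16 * ennreal ((L2_norm f)\<^sup>2))" .
  have "ennreal (\<Sum>P\<in>F. (r P)\<^sup>2 * (\<nu> g P)\<^sup>2) \<le> ennreal k * (\<integral>\<^sup>+x. (ennreal (B' / c') * H x)\<^sup>2 \<partial>lborel)"
  proof (rule finite_Carleson_embedding[where X = "\<lambda>P. fst P \<times> snd P"])
    show "finite F" by fact
    show "fst P \<times> snd P \<in> sets lborel" if "P \<in> F" for P using rect_borel[OF FD[OF that]] by simp
    show "ennreal ((r P)\<^sup>2) \<le> (ennreal (B' / c') * H x)\<^sup>2" if "P \<in> F" "x \<in> fst P \<times> snd P" for P x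
    proof -
      have "ennreal (r P) \<le> ennreal (B' / c') * H x"
        unfolding r_def using that by (intro rect_mean_le b' f FD Hle) auto
      then have "(ennreal (r P))\<^sup>2 \<le> (ennreal (B' / c') * H x)\<^sup>2" by (rule power_mono) simp
      then show ?thesis by (simp add: r_def ennreal_power)
    qed
    fix G assume G: "G \<subseteq> F"
    have "ennreal (\<Sum>P\<in>G. (\<nu> g P)\<^sup>2) \<le> ennreal (k * measure lborel (\<Union>P\<in>G. fst P \<times> snd P))"
      unfolding k_def using G F finite_subset by (intro ennreal_leI carleson g) auto
    also have "\<dots> = ennreal k * ennreal (measure lborel (\<Union>P\<in>G. fst P \<times> snd P))"
      using k by (intro ennreal_mult) auto
    \<comment> \<open>\<open>measure\<close> reads 0 where \<open>emeasure\<close> is infinite, so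
      the comparison holds in every case.\<close>
    also have "\<dots> \<le> ennreal k * emeasure lborel (\<Union>P\<in>G. fst P \<times> snd P)"
      by (intro mult_left_mono) (simp_all add: measure_def ennreal_enn2real_if)
    finally show "ennreal (\<Sum>P\<in>G. (\<nu> g P)\<^sup>2) \<le> ennreal k * emeasure lborel (\<Union>P\<in>G. fst P \<times> snd P)" .
  qed simp_all
  also have "\<dots> \<le> ennreal k * ((ennreal (B' / c'))\<^sup>2 * (16 * ennreal ((L2_norm f)\<^sup>2)))"
    by (intro mult_left_mono HB) simp
  also have "ennreal k * ((ennreal (B' / c'))\<^sup>2 * (16 * ennreal ((L2_norm f)\<^sup>2)))
      = ennreal (k * ((B' / c')\<^sup>2 * (16 * (L2_norm f)\<^sup>2)))"
    using k B' c' by (simp add: ennreal_mult ennreal_power)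
  finally have rn: "(\<Sum>P\<in>F. (r P)\<^sup>2 * (\<nu> g P)\<^sup>2) \<le> k * ((B' / c')\<^sup>2 * (16 * (L2_norm f)\<^sup>2))"
    using k by (subst (asm) ennreal_le_iff) auto
  have dsum: "(\<Sum>P\<in>F. (dn g P)\<^sup>2) \<le> A\<^sub>S * (L2_norm g)\<^sup>2"
  proof -
    have "ennreal (\<Sum>P\<in>F. (dn g P)\<^sup>2) = (\<Sum>P\<in>F. ennreal ((dn g P)\<^sup>2))" by (rule sum_ennreal[symmetric]) simp
    also have "\<dots> = (\<Sum>(K, V)\<in>F. \<integral>\<^sup>+x. ennreal ((norm (diff_rect D E b\<^sub>1 b\<^sub>2 K V g x))\<^sup>2) \<partial>lborel)"
    proof (intro sum.cong refl)
      fix P assume P: "P \<in> F"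
      show "ennreal ((dn g P)\<^sup>2) = (case P of (K, V) \<Rightarrow> \<integral>\<^sup>+x. ennreal ((norm (diff_rect D E b\<^sub>1 b\<^sub>2 K V g x))\<^sup>2) \<partial>lborel)"
        unfolding case_prod_unfold diff_rect_eq[OF FD[OF P] g] dn_def
        by (rule L2_nn_integral[OF bistep_L2[OF FD[OF P]], symmetric])
    qed
    also have "\<dots> \<le> ennreal A\<^sub>S * (\<integral>\<^sup>+x. ennreal ((norm (g x))\<^sup>2) \<partial>lborel)"
      by (rule bi_square_function_bound[OF F]) measurable
    also have "\<dots> = ennreal (A\<^sub>S * (L2_norm g)\<^sup>2)"
      unfolding L2_nn_integral[OF g] using A\<^sub>S_pos by (intro ennreal_mult[symmetric]) auto
    finally show ?thesis using A\<^sub>S_pos by (subst (asm) ennreal_le_iff) auto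
  qed
  have "(\<Sum>(K, V)\<in>F. norm (rect_mean b' K V f * T K V g)) = (\<Sum>P\<in>F. (r P * \<nu> g P) * dn g P)"
  proof (intro sum.cong refl)
    fix P assume "P \<in> F"
    then have "P \<in> D \<times> E" using F by auto
    then show "(case P of (K, V) \<Rightarrow> norm (rect_mean b' K V f * T K V g)) = (r P * \<nu> g P) * dn g P"
      unfolding case_prod_unfold norm_mult r_def by (subst T_eq_\<nu>_dn[OF _ g]) (simp_all only: mult.assoc)
  qed
  also have "\<dots> \<le> 224 * (B' / c') * sqrt (A\<^sub>d * A\<^sub>S) * A * L2_norm f * L2_norm g"
  proof (rule power2_le_imp_le)
    have "(\<Sum>P\<in>F. (r P * \<nu> g P) * dn g P)\<^sup>2 \<le> (\<Sum>P\<in>F. (r P * \<nu> g P)\<^sup>2) * (\<Sum>P\<in>F. (dn g P)\<^sup>2)"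
      by (rule Cauchy_Schwarz_ineq_sum)
    also have "\<dots> \<le> (k * ((B' / c')\<^sup>2 * (16 * (L2_norm f)\<^sup>2))) * (A\<^sub>S * (L2_norm g)\<^sup>2)"
      using rn dsum k unfolding power_mult_distrib
      by (intro mult_mono) (auto intro!: sum_nonneg mult_nonneg_nonneg)
    also have "\<dots> = (224 * (B' / c') * sqrt (A\<^sub>d * A\<^sub>S) * A * L2_norm f * L2_norm g)\<^sup>2"
      using A\<^sub>d_pos A\<^sub>S_pos unfolding k_def power_mult_distrib
      by (subst real_sqrt_pow2) (simp_all add: power_mult_distrib)
    finally show "(\<Sum>P\<in>F. (r P * \<nu> g P) * dn g P)\<^sup>2 \<le> (224 * (B' / c') * sqrt (A\<^sub>d * A\<^sub>S) * A * L2_norm f * L2_norm g)\<^sup>2" .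
    show "0 \<le> 224 * (B' / c') * sqrt (A\<^sub>d * A\<^sub>S) * A * L2_norm f * L2_norm g"
      using B' c' A_nonneg A\<^sub>d_pos A\<^sub>S_pos by (intro mult_nonneg_nonneg) auto
  qed
  finally show ?thesis .
qed

section \<open>The series as a bounded functional, and its representation\<close>

context
  fixes b' f :: "(real ^ 'n) \<times> (real ^ 'm) \<Rightarrow> complex" and B' c' :: real
  assumes f: "f \<in> L2" and b': "Linfty_bounded B' b'" "pseudo_accretive c' b'"
begin

definition C\<^sub>0 :: real where
  "C\<^sub>0 = 224 * (B' / c') * sqrt (A\<^sub>d * A\<^sub>S) * A * L2_norm f"

text \<open>The finite bounds are uniform and concern absolute values, so the convergence is
  absolute and hence unconditional.\<close>

lemma series_bound:
  assumes g: "g \<in> L2"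
  shows "(\<lambda>(K, V). rect_mean b' K V f * T K V g) summable_on D \<times> E"
    "norm (\<Sum>\<^sub>\<infinity>(K, V)\<in>D \<times> E. rect_mean b' K V f * T K V g) \<le> C\<^sub>0 * L2_norm g"
proof -
  let ?t = "\<lambda>P. case P of (K, V) \<Rightarrow> rect_mean b' K V f * T K V g"
  have fin: "(\<Sum>P\<in>F. norm (?t P)) \<le> C\<^sub>0 * L2_norm g" if "finite F" "F \<subseteq> D \<times> E" for F
    using sum_pairing_bound[OF that f g b'] by (simp add: C\<^sub>0_def case_prod_unfold)
  have abs: "(\<lambda>P. norm (?t P)) summable_on D \<times> E"
    by (rule nonneg_bdd_above_summable_on) (auto intro!: bdd_aboveI[of _ "C\<^sub>0 * L2_norm g"] fin)
  then show "?t summable_on D \<times> E" by (rule abs_summable_summable)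
  have "norm (infsum ?t (D \<times> E)) \<le> (\<Sum>\<^sub>\<infinity>P\<in>D \<times> E. norm (?t P))" by (rule norm_infsum_bound[OF abs])
  also have "\<dots> \<le> C\<^sub>0 * L2_norm g" by (rule infsum_le_finite_sums[OF abs fin])
  finally show "norm (infsum ?t (D \<times> E)) \<le> C\<^sub>0 * L2_norm g" .
qed

text \<open>Each term is linear in \<open>g\<close>, and uniqueness of \<open>has_sum\<close> passes
  linearity to the sum; the resulting bounded functional is represented by Riesz.\<close>

lemma paraproduct_exists:
  assumes b'_eq: "b' = b\<^sub>1' \<otimes>\<^sub>t b\<^sub>2'"
  shows "\<exists>h. is_full_paraproduct D E b\<^sub>1' b\<^sub>2' b\<^sub>1 b\<^sub>2 a f h"
proof -
  define \<Lambda> where "\<Lambda> g = (\<Sum>\<^sub>\<infinity>(K, V)\<in>D \<times> E. rect_mean b' K V f * T K V g)" for g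
  have hs: "((\<lambda>(K, V). rect_mean b' K V f * T K V g) has_sum \<Lambda> g) (D \<times> E)" if "g \<in> L2" for g
    unfolding \<Lambda>_def by (rule has_sum_infsum[OF series_bound(1)[OF that]])
  obtain h where h: "h \<in> L2" "\<And>g. g \<in> L2 \<Longrightarrow> \<Lambda> g = (LINT x|lborel. h x * g x)"
  proof (rule L2_Riesz[of \<Lambda> C\<^sub>0])
    fix g k :: "(real ^ 'n) \<times> (real ^ 'm) \<Rightarrow> complex" assume gk: "g \<in> L2" "k \<in> L2"
    have "((\<lambda>P. (case P of (K, V) \<Rightarrow> rect_mean b' K V f * T K V g) + (case P of (K, V) \<Rightarrow> rect_mean b' K V f * T K V k))
        has_sum (\<Lambda> g + \<Lambda> k)) (D \<times> E)"
      by (intro has_sum_add hs gk)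
    also have "?this \<longleftrightarrow> ((\<lambda>(K, V). rect_mean b' K V f * T K V (\<lambda>x. g x + k x)) has_sum (\<Lambda> g + \<Lambda> k)) (D \<times> E)"
      by (intro has_sum_cong) (auto simp: T_add gk distrib_left)
    finally show "\<Lambda> (\<lambda>x. g x + k x) = \<Lambda> g + \<Lambda> k"
      using hs[OF L2_add[OF gk]] by (rule has_sum_unique[rotated])
  next
    fix c and g :: "(real ^ 'n) \<times> (real ^ 'm) \<Rightarrow> complex" assume g: "g \<in> L2"
    have "((\<lambda>P. c * (case P of (K, V) \<Rightarrow> rect_mean b' K V f * T K V g)) has_sum (c * \<Lambda> g)) (D \<times> E)"
      by (intro has_sum_cmult_right hs g)
    also have "?this \<longleftrightarrow> ((\<lambda>(K, V). rect_mean b' K V f * T K V (\<lambda>x. c * g x)) has_sum (c * \<Lambda> g)) (D \<times> E)"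
      by (intro has_sum_cong) (auto simp: T_scale g)
    finally show "\<Lambda> (\<lambda>x. c * g x) = c * \<Lambda> g"
      using hs[OF L2_scale[OF g]] by (rule has_sum_unique[rotated])
  next
    fix g :: "(real ^ 'n) \<times> (real ^ 'm) \<Rightarrow> complex" assume "g \<in> L2"
    then show "norm (\<Lambda> g) \<le> C\<^sub>0 * L2_norm g" unfolding \<Lambda>_def by (rule series_bound(2))
  next
    fix h assume "h \<in> L2" "\<And>g. g \<in> L2 \<Longrightarrow> \<Lambda> g = (LINT x|lborel. h x * g x)"
    then show thesis by (rule that)
  qed
  have "is_full_paraproduct D E b\<^sub>1' b\<^sub>2' b\<^sub>1 b\<^sub>2 a f h"
    unfolding is_full_paraproduct_def b'_eq[symmetric]
  proof (intro conjI ballI h(1))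
    fix g :: "(real ^ 'n) \<times> (real ^ 'm) \<Rightarrow> complex" assume g: "g \<in> L2"
    show "((\<lambda>(K, V). rect_mean b' K V f * T K V g) has_sum (LINT x|lborel. h x * g x)) (D \<times> E)"
      using hs[OF g] unfolding h(2)[OF g] .
  qed
  then show ?thesis by blast
qed

text \<open>Testing the defining property with the conjugate of \<open>h\<close> gives the squared
  norm of \<open>h\<close> on one side and the bound of the functional on the other.\<close>

lemma paraproduct_norm_le:
  assumes "b' = b\<^sub>1' \<otimes>\<^sub>t b\<^sub>2'" and h: "is_full_paraproduct D E b\<^sub>1' b\<^sub>2' b\<^sub>1 b\<^sub>2 a f h"
  shows "L2_norm h \<le> C\<^sub>0"
proof -
  have hL: "h \<in> L2" using h by (simp add: is_full_paraproduct_def)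
  let ?g = "\<lambda>x. cnj (h x)"
  have g: "?g \<in> L2" by (rule L2_cnj[OF hL])
  have "((\<lambda>(K, V). rect_mean b' K V f * T K V ?g) has_sum (LINT x|lborel. h x * ?g x)) (D \<times> E)"
    using h g unfolding is_full_paraproduct_def assms(1) by blast
  then have "(LINT x|lborel. h x * ?g x) = (\<Sum>\<^sub>\<infinity>(K, V)\<in>D \<times> E. rect_mean b' K V f * T K V ?g)"
    by (rule infsumI[symmetric])
  then have "norm (LINT x|lborel. h x * ?g x) \<le> C\<^sub>0 * L2_norm h"
    using series_bound(2)[OF g] by (simp add: L2_norm_cnj)
  also have "(LINT x|lborel. h x * ?g x) = (LINT x|lborel. complex_of_real ((norm (h x))\<^sup>2))"
    by (intro Bochner_Integration.integral_cong refl) (rule complex_norm_square[symmetric])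
  also have "\<dots> = complex_of_real ((L2_norm h)\<^sup>2)"
    unfolding L2_norm_power2 by (rule integral_complex_of_real)
  finally have le: "L2_norm h * L2_norm h \<le> C\<^sub>0 * L2_norm h"
    by (simp add: power2_eq_square norm_mult)
  have "0 \<le> C\<^sub>0"
    using Linfty_bounded_nonneg[OF b'(1)] b'(2) A_nonneg A\<^sub>d_pos A\<^sub>S_pos
    unfolding C\<^sub>0_def pseudo_accretive_def by (intro mult_nonneg_nonneg) auto
  then show ?thesis
  proof (cases "L2_norm h = 0")
    case False
    then have "0 < L2_norm h" using L2_norm_nonneg[of h] by linarith
    then show ?thesis using le by simp
  qed simp
qed

end

end

text \<open>The infimum is itself an admissible bound: dividing by a positive \<open>H1\<close> norm
  exhibits a lower bound of all admissible constants, and where that norm is zero any admissible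
  constant forces \<open>a \<phi> = 0\<close>.\<close>

lemma BMO_norm_bound:
  assumes "a \<in> BMO D E"
  shows "0 \<le> BMO_norm D E a" "\<phi> \<in> H1 D E \<Longrightarrow> norm (a \<phi>) \<le> BMO_norm D E a * H1_norm D E \<phi>"
proof -
  let ?S = "{A. 0 \<le> A \<and> (\<forall>\<phi>\<in>H1 D E. norm (a \<phi>) \<le> A * H1_norm D E \<phi>)}"
  have H1_nonneg: "0 \<le> H1_norm D E \<phi>" for \<phi>
    unfolding H1_norm_def square_fun_def by (intro integral_nonneg_AE AE_I2 real_sqrt_ge_zero infsum_nonneg) auto
  obtain A where A: "\<And>\<phi>. \<phi> \<in> H1 D E \<Longrightarrow> norm (a \<phi>) \<le> A * H1_norm D E \<phi>"
    using assms unfolding BMO_def by blast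
  \<comment> \<open>The constant supplied by membership in \<open>BMO\<close> may be negative, while
    the infimum ranges over nonnegative ones.\<close>
  have "norm (a \<phi>) \<le> max A 0 * H1_norm D E \<phi>" if "\<phi> \<in> H1 D E" for \<phi>
    using A[OF that] mult_right_mono[of A "max A 0" "H1_norm D E \<phi>"] H1_nonneg[of \<phi>] by linarith
  then have ne: "?S \<noteq> {}" by (auto intro!: exI[of _ "max A 0"])
  show "0 \<le> BMO_norm D E a" unfolding BMO_norm_def by (rule cInf_greatest[OF ne]) auto
  show "norm (a \<phi>) \<le> BMO_norm D E a * H1_norm D E \<phi>" if \<phi>: "\<phi> \<in> H1 D E"
  proof (cases "H1_norm D E \<phi> = 0")
    case True
    then show ?thesis using A[OF \<phi>] by simp
  next
    case False
    then have pos: "0 < H1_norm D E \<phi>" using H1_nonneg[of \<phi>] by linarith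
    have "norm (a \<phi>) / H1_norm D E \<phi> \<le> BMO_norm D E a"
      unfolding BMO_norm_def by (rule cInf_greatest[OF ne]) (use \<phi> pos in \<open>auto simp: pos_divide_le_eq\<close>)
    then show ?thesis using pos by (simp add: pos_divide_le_eq)
  qed
qed

text \<open>The two factors of \<open>b\<close> are normalised by the means \<open>s\<close>, \<open>t\<close> of the other factor over unit cubes;
  only the ratio \<open>B / c\<close> and the product of the bounds are controlled.\<close>

lemma tensor_factors:
  fixes b\<^sub>1 :: "real ^ 'n \<Rightarrow> complex" and b\<^sub>2 :: "real ^ 'm \<Rightarrow> complex"
  assumes D: "dyadic_grid D" and E: "dyadic_grid E"
    and bdd: "Linfty_bounded B (b\<^sub>1 \<otimes>\<^sub>t b\<^sub>2)" and acc: "pseudo_accretive c (b\<^sub>1 \<otimes>\<^sub>t b\<^sub>2)"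
  obtains s t where "0 < s" "0 < t" "c < s * t"
    "biaccretive D E b\<^sub>1 b\<^sub>2 (B / s) (B / t) (c / s) (c / t)"
proof -
  let ?b = "b\<^sub>1 \<otimes>\<^sub>t b\<^sub>2"
  have c: "c > 0" using acc by (simp add: pseudo_accretive_def)
  have b_meas: "?b \<in> borel_measurable (borel \<Otimes>\<^sub>M borel)"
    and bAE: "AE x in lborel. norm (?b x) \<le> B" using bdd by (auto simp: Linfty_bounded_def borel_prod)
  from bAE have "AE x in lborel \<Otimes>\<^sub>M lborel. norm (?b x) \<le> B" unfolding lborel_prod .
  then have AE1: "AE x\<^sub>1 in lborel. AE x\<^sub>2 in lborel. norm (?b (x\<^sub>1, x\<^sub>2)) \<le> B"
    by (rule lborel_pair.AE_pair)
  have AE2: "AE x\<^sub>2 in lborel. AE x\<^sub>1 in lborel. norm (?b (x\<^sub>1, x\<^sub>2)) \<le> B"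
  proof -
    have "{x \<in> space (lborel \<Otimes>\<^sub>M lborel). norm (?b x) \<le> B} \<in> sets (lborel \<Otimes>\<^sub>M lborel)"
      using b_meas by measurable
    then show ?thesis
      using lborel_pair.AE_commute[of "\<lambda>y z. norm (?b (y, z)) \<le> B"] AE1 by simp
  qed
  define Q1 Q2 where "Q1 = cube (0 :: real ^ 'n) 1" and "Q2 = cube (0 :: real ^ 'm) 1"
  have big: "c * measure lborel (cube u l \<times> cube v k) < norm (LINT x:cube u l \<times> cube v k|lborel. ?b x)"
    if "l > 0" "k > 0" for u :: "real ^ 'n" and v :: "real ^ 'm" and l k
  proof -
    have "0 < measure lborel (cube u l \<times> cube v k)"
      unfolding measure_lborel_Times[OF cube_borel cube_borel]
      by (intro mult_pos_pos measure_cube_pos that)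
    moreover have "norm (LINT x:cube u l \<times> cube v k|lborel. ?b x) / measure lborel (cube u l \<times> cube v k) > c"
      using acc that unfolding pseudo_accretive_def by blast
    ultimately show ?thesis by (simp add: pos_less_divide_eq)
  qed
  have nz: "(LINT x:Q1 \<times> Q2|lborel. ?b x) \<noteq> 0"
  proof -
    have "0 \<le> c * measure lborel (Q1 \<times> Q2)" using c by simp
    also have "\<dots> < norm (LINT x:Q1 \<times> Q2|lborel. ?b x)"
      unfolding Q1_def Q2_def by (rule big) simp_all
    finally show ?thesis by auto
  qed
  have b_borel [measurable]: "?b \<in> borel_measurable borel" using b_meas by (simp add: borel_prod)
  have Q: "emeasure lborel Q1 < \<infinity>" "emeasure lborel Q2 < \<infinity>" "0 < measure lborel Q1" "0 < measure lborel Q2"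
    using emeasure_cube_finite[of "0 :: real ^ 'n" 1] emeasure_cube_finite[of "0 :: real ^ 'm" 1]
      measure_cube_pos[of 1 "0 :: real ^ 'n"] measure_cube_pos[of 1 "0 :: real ^ 'm"]
    by (simp_all add: Q1_def Q2_def)
  have Qb [measurable]: "Q1 \<in> sets borel" "Q2 \<in> sets borel" by (auto simp: Q1_def Q2_def)
  obtain z where z: "?b z \<noteq> 0"
  proof -
    have "\<exists>z. ?b z \<noteq> 0"
    proof (rule ccontr)
      assume "\<not> ?thesis"
      then have "?b z = 0" for z by blast
      with nz show False by (simp add: set_lebesgue_integral_def)
    qed
    then show ?thesis using that by blast
  qed
  \<comment> \<open>Accretivity excludes \<open>b = 0\<close>. At a point where both factors are
    nonzero, each factor is a section of \<open>b\<close> divided by a constant, hence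
    measurable.\<close>
  then have z12: "b\<^sub>1 (fst z) \<noteq> 0" "b\<^sub>2 (snd z) \<noteq> 0" by (auto simp: tensor_def case_prod_unfold)
  have m1 [measurable]: "b\<^sub>1 \<in> borel_measurable borel"
  proof -
    have "(\<lambda>x. ?b (x, snd z) / b\<^sub>2 (snd z)) \<in> borel_measurable borel" using b_meas by measurable
    then show ?thesis using z12 by (simp add: tensor_def)
  qed
  have m2 [measurable]: "b\<^sub>2 \<in> borel_measurable borel"
  proof -
    have "(\<lambda>x. ?b (fst z, x) / b\<^sub>1 (fst z)) \<in> borel_measurable borel" using b_meas by measurable
    then show ?thesis using z12 by (simp add: tensor_def)
  qed
  have int: "set_integrable lborel (Q1 \<times> Q2) ?b"
    using Q by (intro bounded_set_integral(1)[OF b_borel _ _ bAE]) (simp_all add: emeasure_lborel_Times ennreal_mult_less_top)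
  have fub: "(LINT x:Q1 \<times> Q2|lborel. ?b x) = (LINT x\<^sub>1:Q1|lborel. b\<^sub>1 x\<^sub>1 * (LINT x\<^sub>2:Q2|lborel. b\<^sub>2 x\<^sub>2))"
    unfolding set_integral_Times(1)[OF int] by (simp add: tensor_def)
  \<comment> \<open>Dividing by the value of one factor at a suitable point gives a crude bound for
    the other. It depends on that point and serves to make the factors integrable on cubes, so that
    integrals over rectangles factorise.\<close>
  obtain x\<^sub>1 where x\<^sub>1: "b\<^sub>1 x\<^sub>1 \<noteq> 0" "AE x\<^sub>2 in lborel. norm (?b (x\<^sub>1, x\<^sub>2)) \<le> B"
  proof -
    have "\<exists>x\<^sub>1. b\<^sub>1 x\<^sub>1 \<noteq> 0 \<and> (AE x\<^sub>2 in lborel. norm (?b (x\<^sub>1, x\<^sub>2)) \<le> B)"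
    proof (rule ccontr)
      assume no: "\<not> ?thesis"
      have "AE x\<^sub>1 in lborel. b\<^sub>1 x\<^sub>1 = 0"
        using AE1 by eventually_elim (use no in blast)
      then have "(LINT x\<^sub>1:Q1|lborel. b\<^sub>1 x\<^sub>1 * (LINT x\<^sub>2:Q2|lborel. b\<^sub>2 x\<^sub>2)) = 0"
        unfolding set_lebesgue_integral_def
        by (intro integral_eq_zero_AE) (auto elim: eventually_mono)
      with nz fub show False by simp
    qed
    then show ?thesis using that by blast
  qed
  have bdd2: "AE x in lborel. norm (b\<^sub>2 x) \<le> B / norm (b\<^sub>1 x\<^sub>1)"
    using x\<^sub>1(2)
  proof eventually_elim
    fix x assume "norm (?b (x\<^sub>1, x)) \<le> B"
    then show "norm (b\<^sub>2 x) \<le> B / norm (b\<^sub>1 x\<^sub>1)"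
      using x\<^sub>1(1) by (simp add: tensor_def norm_mult pos_le_divide_eq mult.commute)
  qed
  obtain x\<^sub>2 where x\<^sub>2: "b\<^sub>2 x\<^sub>2 \<noteq> 0" "AE x\<^sub>1 in lborel. norm (?b (x\<^sub>1, x\<^sub>2)) \<le> B"
  proof -
    have "\<exists>x\<^sub>2. b\<^sub>2 x\<^sub>2 \<noteq> 0 \<and> (AE x\<^sub>1 in lborel. norm (?b (x\<^sub>1, x\<^sub>2)) \<le> B)"
    proof (rule ccontr)
      assume no: "\<not> ?thesis"
      have "AE x\<^sub>2 in lborel. b\<^sub>2 x\<^sub>2 = 0"
        using AE2 by eventually_elim (use no in blast)
      then have "(LINT x\<^sub>2:Q2|lborel. b\<^sub>2 x\<^sub>2) = 0"
        unfolding set_lebesgue_integral_def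
        by (intro integral_eq_zero_AE) (auto elim: eventually_mono)
      with nz fub show False by (simp add: set_lebesgue_integral_def)
    qed
    then show ?thesis using that by blast
  qed
  have bdd1: "AE x in lborel. norm (b\<^sub>1 x) \<le> B / norm (b\<^sub>2 x\<^sub>2)"
    using x\<^sub>2(2)
  proof eventually_elim
    fix x assume "norm (?b (x, x\<^sub>2)) \<le> B"
    then show "norm (b\<^sub>1 x) \<le> B / norm (b\<^sub>2 x\<^sub>2)"
      using x\<^sub>2(1) by (simp add: tensor_def norm_mult pos_le_divide_eq)
  qed
  have fac: "(LINT x:cube u l \<times> cube v k|lborel. ?b x) = (LINT x:cube u l|lborel. b\<^sub>1 x) * (LINT x:cube v k|lborel. b\<^sub>2 x)"
    for u l v k
    by (intro set_integral_tensor m1 m2 cube_borel bounded_set_integral(1)[OF m1 _ _ bdd1]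
        bounded_set_integral(1)[OF m2 _ _ bdd2] emeasure_cube_finite)
  \<comment> \<open>The product \<open>s * t\<close> is the modulus of the mean of \<open>b\<close>
    over \<open>Q1 \<times> Q2\<close>: it exceeds \<open>c\<close> and does not change when the
    factors are rescaled reciprocally.\<close>
  define s t where "s = norm (LINT x:Q2|lborel. b\<^sub>2 x) / measure lborel Q2"
    and "t = norm (LINT x:Q1|lborel. b\<^sub>1 x) / measure lborel Q1"
  have fac0: "(LINT x:Q1 \<times> Q2|lborel. ?b x) = (LINT x:Q1|lborel. b\<^sub>1 x) * (LINT x:Q2|lborel. b\<^sub>2 x)"
    unfolding Q1_def Q2_def by (rule fac)
  have s: "0 < s" and t: "0 < t" using nz Q unfolding fac0 s_def t_def by auto
  have st: "c < s * t"
    using big[of 1 1 0 0] Q unfolding Q1_def[symmetric] Q2_def[symmetric] fac0 norm_mult s_def t_def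
    by (simp add: measure_lborel_Times field_simps)
  interpret D: grid D by (unfold_locales) (rule D)
  interpret E: grid E by (unfold_locales) (rule E)
  have accD: "accretive D b\<^sub>1 (B / s) (c / s)"
  proof
    show "b\<^sub>1 \<in> borel_measurable borel" by (rule m1)
    show "0 < c / s" using c s by simp
    \<comment> \<open>For almost every \<open>y\<close> the section of \<open>b\<close> is bounded
      by \<open>B\<close>; integrating it over \<open>Q2\<close> leaves \<open>s\<close> times the
      modulus of \<open>b\<^sub>1 y\<close>.\<close>
    show "AE x in lborel. norm (b\<^sub>1 x) \<le> B / s"
      using AE1
    proof eventually_elim
      fix y assume "AE x\<^sub>2 in lborel. norm (?b (y, x\<^sub>2)) \<le> B"
      then have "norm (LINT x:Q2|lborel. b\<^sub>1 y * b\<^sub>2 x) \<le> B * measure lborel Q2"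
        by (intro bounded_set_integral(2)) (use Q in \<open>simp_all add: tensor_def\<close>)
      then have "norm (b\<^sub>1 y) * (s * measure lborel Q2) \<le> B * measure lborel Q2"
        using Q by (simp add: norm_mult s_def)
      then show "norm (b\<^sub>1 y) \<le> B / s" using Q s by (simp add: pos_le_divide_eq mult.assoc[symmetric])
    qed
    fix I assume "I \<in> D"
    then obtain u l where I: "l > 0" "I = cube u l" by (rule D.cell_is_cube)
    \<comment> \<open>Accretivity of \<open>b\<close> is tested on the rectangle with the reference
      cube as second side, whose factor again contributes \<open>s\<close>.\<close>
    have "c * measure lborel (I \<times> Q2) < norm ((LINT x:I|lborel. b\<^sub>1 x) * (LINT x:Q2|lborel. b\<^sub>2 x))"
      using big[of l 1 u 0] I unfolding Q2_def fac by simp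
    then have "(c * measure lborel I) * measure lborel Q2 < (norm (LINT x:I|lborel. b\<^sub>1 x) * s) * measure lborel Q2"
      using Q by (simp add: norm_mult s_def I(2) measure_lborel_Times mult.assoc)
    then have "c * measure lborel I < norm (LINT x:I|lborel. b\<^sub>1 x) * s"
      using Q by (simp add: mult_less_cancel_right)
    then show "c / s * measure lborel I \<le> norm (LINT y:I|lborel. b\<^sub>1 y)"
      using s by (simp add: field_simps)
  qed
  have accE: "accretive E b\<^sub>2 (B / t) (c / t)"
  proof
    show "b\<^sub>2 \<in> borel_measurable borel" by (rule m2)
    show "0 < c / t" using c t by simp
    show "AE x in lborel. norm (b\<^sub>2 x) \<le> B / t"
      using AE2
    proof eventually_elim
      fix y assume "AE x\<^sub>1 in lborel. norm (?b (x\<^sub>1, y)) \<le> B"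
      then have "norm (LINT x:Q1|lborel. b\<^sub>2 y * b\<^sub>1 x) \<le> B * measure lborel Q1"
        by (intro bounded_set_integral(2)) (use Q in \<open>simp_all add: tensor_def mult.commute\<close>)
      then have "norm (b\<^sub>2 y) * (t * measure lborel Q1) \<le> B * measure lborel Q1"
        using Q by (simp add: norm_mult t_def)
      then show "norm (b\<^sub>2 y) \<le> B / t" using Q t by (simp add: pos_le_divide_eq mult.assoc[symmetric])
    qed
    fix J assume "J \<in> E"
    then obtain v k where J: "k > 0" "J = cube v k" by (rule E.cell_is_cube)
    have "c * measure lborel (Q1 \<times> J) < norm ((LINT x:Q1|lborel. b\<^sub>1 x) * (LINT x:J|lborel. b\<^sub>2 x))"
      using big[of 1 k 0 v] J unfolding Q1_def fac by simp
    then have "(c * measure lborel J) * measure lborel Q1 < (norm (LINT x:J|lborel. b\<^sub>2 x) * t) * measure lborel Q1"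
      using Q by (simp add: norm_mult t_def J(2) measure_lborel_Times mult_ac)
    then have "c * measure lborel J < norm (LINT x:J|lborel. b\<^sub>2 x) * t"
      using Q by (simp add: mult_less_cancel_right)
    then show "c / t * measure lborel J \<le> norm (LINT y:J|lborel. b\<^sub>2 y)"
      using t by (simp add: field_simps)
  qed
  show ?thesis by (rule that[OF s t st]) (simp add: biaccretive_def accD accE)
qed

theorem proposition3p4:
  fixes B c B' c' :: real
  shows "\<exists>C>0. \<forall>(b\<^sub>1 :: real ^ 'n \<Rightarrow> complex) (b\<^sub>2 :: real ^ 'm \<Rightarrow> complex)
      (b\<^sub>1' :: real ^ 'n \<Rightarrow> complex) (b\<^sub>2' :: real ^ 'm \<Rightarrow> complex)
      (D :: (real ^ 'n) set set) (E :: (real ^ 'm) set set) a.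
    Linfty_bounded B (b\<^sub>1 \<otimes>\<^sub>t b\<^sub>2) \<longrightarrow> pseudo_accretive c (b\<^sub>1 \<otimes>\<^sub>t b\<^sub>2) \<longrightarrow>
    Linfty_bounded B' (b\<^sub>1' \<otimes>\<^sub>t b\<^sub>2') \<longrightarrow> pseudo_accretive c' (b\<^sub>1' \<otimes>\<^sub>t b\<^sub>2') \<longrightarrow>
    dyadic_grid D \<longrightarrow> dyadic_grid E \<longrightarrow> a \<in> BMO D E \<longrightarrow>
    (\<forall>f\<in>L2.
      (\<exists>h. is_full_paraproduct D E b\<^sub>1' b\<^sub>2' b\<^sub>1 b\<^sub>2 a f h) \<and>
      (\<forall>h. is_full_paraproduct D E b\<^sub>1' b\<^sub>2' b\<^sub>1 b\<^sub>2 a f h \<longrightarrow>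
         L2_norm h \<le> C * BMO_norm D E a * L2_norm f))"
proof -
  \<comment> \<open>The one-parameter square function constant; it sees the factors only through
    \<open>B / c\<close>, which their normalisation does not change.\<close>
  define k where "k = 56 * (B / c) ^ 4"
  \<comment> \<open>\<open>max 1\<close> secures \<open>C > 0\<close> even for parameters that no
    admissible functions realise.\<close>
  define C where "C = max 1 (224 * (B' / c') * (k\<^sup>2 * (B\<^sup>2 / c)))"
  show ?thesis
  proof (intro exI[of _ C] conjI allI impI ballI)
    show "0 < C" by (simp add: C_def)
    fix b\<^sub>1 :: "real ^ 'n \<Rightarrow> complex" and b\<^sub>2 :: "real ^ 'm \<Rightarrow> complex"
      and b\<^sub>1' :: "real ^ 'n \<Rightarrow> complex" and b\<^sub>2' :: "real ^ 'm \<Rightarrow> complex"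
      and D :: "(real ^ 'n) set set" and E :: "(real ^ 'm) set set" and a
    fix f :: "(real ^ 'n) \<times> (real ^ 'm) \<Rightarrow> complex"
    assume b: "Linfty_bounded B (b\<^sub>1 \<otimes>\<^sub>t b\<^sub>2)" "pseudo_accretive c (b\<^sub>1 \<otimes>\<^sub>t b\<^sub>2)"
      and b': "Linfty_bounded B' (b\<^sub>1' \<otimes>\<^sub>t b\<^sub>2')" "pseudo_accretive c' (b\<^sub>1' \<otimes>\<^sub>t b\<^sub>2')"
      and D: "dyadic_grid D" and E: "dyadic_grid E" and a: "a \<in> BMO D E" and f: "f \<in> L2"
    obtain s t where st: "0 < s" "0 < t" "c < s * t"
      and bi: "biaccretive D E b\<^sub>1 b\<^sub>2 (B / s) (B / t) (c / s) (c / t)"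
      by (rule tensor_factors[OF D E b])
    have c: "0 < c" and c': "0 < c'" using b b' by (auto simp: pseudo_accretive_def)
    have B': "0 \<le> B'" by (rule Linfty_bounded_nonneg[OF b'(1)])
    interpret biaccretive D E b\<^sub>1 b\<^sub>2 "B / s" "B / t" "c / s" "c / t" by (rule bi)
    interpret paraproduct D E b\<^sub>1 b\<^sub>2 "B / s" "B / t" "c / s" "c / t" a "BMO_norm D E a"
      by unfold_locales (use a BMO_norm_bound[OF a] in auto)
    show "\<exists>h. is_full_paraproduct D E b\<^sub>1' b\<^sub>2' b\<^sub>1 b\<^sub>2 a f h"
      by (rule paraproduct_exists[OF f b' refl])
    fix h assume "is_full_paraproduct D E b\<^sub>1' b\<^sub>2' b\<^sub>1 b\<^sub>2 a f h"
    then have "L2_norm h \<le> 224 * (B' / c') * sqrt (A\<^sub>d * A\<^sub>S) * BMO_norm D E a * L2_norm f"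
      using paraproduct_norm_le[OF f b' refl] by (simp add: C\<^sub>0_def[OF f b'])
    also have "\<dots> \<le> C * BMO_norm D E a * L2_norm f"
    proof (intro mult_right_mono BMO_norm_bound(1)[OF a] L2_norm_nonneg)
      have r: "B / s / (c / s) = B / c" "B / t / (c / t) = B / c" using st c by auto
      have sq: "A\<^sub>d * A\<^sub>S = (k\<^sup>2 * (B\<^sup>2 / (s * t)))\<^sup>2"
        unfolding A\<^sub>d_def A\<^sub>S_def r k_def[symmetric]
        by (simp add: power2_eq_square mult_ac)
      have "0 \<le> k\<^sup>2 * (B\<^sup>2 / (s * t))" using st by simp
      then have "sqrt (A\<^sub>d * A\<^sub>S) = k\<^sup>2 * (B\<^sup>2 / (s * t))"
        by (rule real_sqrt_unique[OF sq[symmetric]])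
      \<comment> \<open>\<open>s * t\<close> depends on the functions; its lower bound
        \<open>c\<close> makes the constant uniform.\<close>
      also have "\<dots> \<le> k\<^sup>2 * (B\<^sup>2 / c)"
        using st c by (intro mult_left_mono divide_left_mono) auto
      finally have "224 * (B' / c') * sqrt (A\<^sub>d * A\<^sub>S) \<le> 224 * (B' / c') * (k\<^sup>2 * (B\<^sup>2 / c))"
        using B' c' by (intro mult_left_mono) auto
      then show "224 * (B' / c') * sqrt (A\<^sub>d * A\<^sub>S) \<le> C" by (simp add: C_def)
    qed
    finally show "L2_norm h \<le> C * BMO_norm D E a * L2_norm f" .
  qed
qed

end
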